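(* Fix $\varepsilon>0$. Let $V\subset\mathbb{R}$ be a finite set with $|V|=n$, and let $G$ be the random graph on vertex set $V$ in which each pair $\{x,y\}$ is an edge independently with probability $p=(1+\varepsilon)/n$ (i.e. each pairwise distance $|x-y|$ is revealed independently with probability $p$). Then, with probability tending to $1$ as $n\to\infty$, there is a subset $V'\subseteq V$ with $|V'|=\Omega(\varepsilon^3 n)$ which is reconstructible from $G$, i.e. $V'$ can be reconstructed up to translation and reflection from the revealed distances.
   Context: Given a finite set $V\subset\mathbb{R}$ and a graph $G$ on vertex set $V$, a subset $V'\subseteq V$ is reconstructible from $G$ if for every injective map $g:V\to\mathbb{R}$ with $|g(x)-g(y)|=|x-y|$ for every edge $xy$ of $G$, we have $|g(u)-g(v)|=|u-v|$ for all $u,v\in V'$. The implicit constant in $\Omega(\varepsilon^3 n)$ is absolute (independent of $\varepsilon$ and $n$).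
   Formalization: The bound Ω(ε³n) with an absolute constant is proved as c·min(1, ε³)·n, since for large ε the quantity cε³n exceeds n, the size of V; for ε ≤ 1 it is exactly cε³n. *)

theory Defs
  imports "HOL-Probability.Probability"
begin

text \<open>
  A simple graph on a vertex set \<open>V\<close> is given by its edge set, a set of two-element subsets of \<open>V\<close>.
\<close>

definition vertex_pairs :: "'a set \<Rightarrow> 'a set set" where
  "vertex_pairs V = {e. e \<subseteq> V \<and> card e = 2}"

text \<open>
  \<open>bernoulli_pmf\<close> clamps its parameter to \<open>[0, 1]\<close>; with \<open>p = (1 + \<epsilon>) / n\<close> this matters only for
  \<open>n < 1 + \<epsilon>\<close>, which is irrelevant as \<open>n\<close> tends to infinity.
\<close>

definition random_graph :: "'a set \<Rightarrow> real \<Rightarrow> 'a set set pmf" where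
  "random_graph V p =
     map_pmf (\<lambda>revealed. {e \<in> vertex_pairs V. revealed e})
       (Pi_pmf (vertex_pairs V) False (\<lambda>_. bernoulli_pmf p))"

definition reconstructible :: "real set \<Rightarrow> real set set \<Rightarrow> real set \<Rightarrow> bool" where
  "reconstructible V E V' \<longleftrightarrow>
     V' \<subseteq> V \<and>
     (\<forall>g :: real \<Rightarrow> real.
        inj_on g V \<longrightarrow>
        (\<forall>x\<in>V. \<forall>y\<in>V. {x, y} \<in> E \<longrightarrow> \<bar>g x - g y\<bar> = \<bar>x - y\<bar>) \<longrightarrow>
        (\<forall>u\<in>V'. \<forall>v\<in>V'. \<bar>g u - g v\<bar> = \<bar>u - v\<bar>))"

text \<open>
  A lower bound \<open>\<Omega>(\<epsilon>\<^sup>3 n)\<close> with a constant that does not depend on \<open>\<epsilon>\<close> cannot be meant literally for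
  large \<open>\<epsilon>\<close>, because a subset of \<open>V\<close> has at most \<open>n\<close> elements. For \<open>\<epsilon> \<le> 1\<close> the bound
  \<open>c * min 1 (\<epsilon> ^ 3) * n\<close> is literally \<open>c * \<epsilon> ^ 3 * n\<close>; for \<open>\<epsilon> > 1\<close> it is \<open>c * n\<close>, which on any
  bounded range of \<open>\<epsilon>\<close> is of the order \<open>\<epsilon> ^ 3 * n\<close>.
\<close>

end

theory Submission
  imports Defs "HOL-Real_Asymp.Real_Asymp"
begin

text \<open>
  Write the graph as the union of two independent random graphs, the first with edge probability
  \<open>(1 + e) / n\<close> for \<open>e = min 1 \<epsilon> / 2\<close> and the second sparser by a large constant factor. Depth-first search finds a path
  with \<open>m\<close> of order \<open>e\<^sup>2 n\<close> vertices in the first one; the second one adds random chords. After removing few vertices,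
  path and chords form an expander \<open>F\<close> of maximum degree three in which every set of at most half
  of the vertices has at least two outer neighbours.

  By symmetry the vertices of \<open>F\<close> may be labelled afterwards by random points of the given set. Let
  \<open>h\<close> preserve the revealed distances \<open>\<bar>\<pi> u - \<pi> w\<bar>\<close>. On every edge \<open>h - \<pi>\<close> or \<open>h + \<pi>\<close> is constant, so
  the edges are coloured with two colours, and each colouring forces linear relations between the
  labels, each of which holds with probability \<open>O(1 / n)\<close>. Since \<open>1 / n\<close> beats any constant, the
  number of relations must be \<open>o(n)\<close>, and then expansion yields a monochromatic component \<open>A\<close> with more
  than half of the vertices. A connected set \<open>B\<close> outside \<open>A\<close> forces \<open>d - 1\<close> further relations, where
  \<open>d\<close> is the number of its outer neighbours. As \<open>d \<ge> 2\<close> and \<open>d\<close> grows linearly in the size of \<open>B\<close>, the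
  expected number of vertices that lie in such a set for some \<open>h\<close> is bounded, and all other vertices
  of \<open>F\<close> keep their distances under every \<open>h\<close>.
\<close>

section \<open>Random subsets\<close>

text \<open>The given set may have additive structure, an arithmetic progression for instance, so
  genericity cannot exclude linear relations between its points; the randomness must come from the
  labelling. As infinitely many maps \<open>h\<close> have to be excluded at once, they are replaced
  by finitely many colourings, at most \<open>8 ^ card F\<close> globally and \<open>4 ^ k\<close>
  along a walk, and a union bound runs over these.

  Two outer neighbours are required because a piece attached at a single vertex can be reflected
  there and forces no relation.

  The chords have density \<open>\<delta>\<^sup>2 / m\<close> on \<open>m\<close> path vertices.
  Cuts are compared with \<open>\<delta> ^ 3 * m\<close>, which lies between the number of chords,
  of order \<open>\<delta>\<^sup>2 * m\<close>, and the expected number of pairs of meeting chords,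
  of order \<open>\<delta> ^ 4 * m\<close>. The failure bound of this stage tends to
  \<open>4 * \<delta>\<close> and not to 0, so \<delta> is chosen from the permitted failure
  probability before \<open>n\<close> grows. Expansion and the thresholds for \<open>n\<close>
  depend on \<delta>, the size of \<open>F\<close> does not: the final set has order
  \<open>e\<^sup>2 * n\<close>, which for \<epsilon> \<le> 1 covers the claimed cube.\<close>

definition rsub :: "'b set \<Rightarrow> real \<Rightarrow> 'b set pmf" where
  "rsub Y p = map_pmf (\<lambda>f. {e \<in> Y. f e}) (Pi_pmf Y False (\<lambda>_. bernoulli_pmf p))"

abbreviation ex_rsub :: "'b set \<Rightarrow> real \<Rightarrow> ('b set \<Rightarrow> real) \<Rightarrow> real" where
  "ex_rsub Y p f \<equiv> measure_pmf.expectation (rsub Y p) f"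

lemma random_graph_eq_rsub: "random_graph V p = rsub (vertex_pairs V) p"
  by (simp add: random_graph_def rsub_def)

lemma rsub_empty: "rsub {} p = return_pmf {}"
  by (simp add: rsub_def)

lemma rsub_insert:
  assumes "finite Y" "e \<notin> Y"
  shows "rsub (insert e Y) p =
    bernoulli_pmf p \<bind> (\<lambda>b. map_pmf (\<lambda>E. if b then insert e E else E) (rsub Y p))"
proof -
  have "rsub (insert e Y) p = map_pmf (\<lambda>f. {e' \<in> insert e Y. f e'})
     (map_pmf (\<lambda>(b, f). f(e := b)) (pair_pmf (bernoulli_pmf p) (Pi_pmf Y False (\<lambda>_.
         bernoulli_pmf p))))"
    using assms by (simp add: rsub_def Pi_pmf_insert)
  also have "\<dots> = map_pmf (\<lambda>(b, f). if b then insert e {e' \<in> Y. f e'} else {e' \<in> Y. f e'})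
     (pair_pmf (bernoulli_pmf p) (Pi_pmf Y False (\<lambda>_. bernoulli_pmf p)))"
    unfolding pmf.map_comp o_def using assms by (intro map_pmf_cong refl) (auto split: if_splits)
  also have "\<dots> = bernoulli_pmf p \<bind> (\<lambda>b. map_pmf (\<lambda>E. if b then insert e E else E) (rsub Y p))"
    by (auto simp: rsub_def pair_pmf_def map_bind_pmf map_pmf_def bind_assoc_pmf bind_return_pmf
        intro!: bind_pmf_cong)
  finally show ?thesis .
qed

lemma finite_set_rsub [simp]: "finite Y \<Longrightarrow> finite (set_pmf (rsub Y p))"
  by (rule finite_subset[of _ "Pow Y"]) (auto simp: rsub_def)

lemma set_rsub_subset: "E \<in> set_pmf (rsub Y p) \<Longrightarrow> E \<subseteq> Y"
  by (auto simp: rsub_def)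

lemma integrable_rsub [simp]: "finite Y \<Longrightarrow> integrable (measure_pmf (rsub Y p)) (f :: _ \<Rightarrow> real)"
  by (intro integrable_measure_pmf_finite) simp

lemma ex_rsub_empty: "ex_rsub {} p f = f {}"
  by (simp add: rsub_empty)

lemma ex_rsub_insert:
  assumes "finite Y" "e \<notin> Y" "0 \<le> p" "p \<le> 1"
  shows "ex_rsub (insert e Y) p f = p * ex_rsub Y p (\<lambda>E. f (insert e E)) + (1 - p) * ex_rsub Y p f"
proof -
  have "ex_rsub (insert e Y) p f =
    measure_pmf.expectation (bernoulli_pmf p) (\<lambda>b. ex_rsub Y p (\<lambda>E.
        f (if b then insert e E else E)))"
    unfolding rsub_insert[OF assms(1,2)]
    by (subst pmf_expectation_bind[where A =
        UNIV]) (use assms in \<open>auto simp: integral_measure_pmf_real[where A =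
        UNIV] UNIV_bool mult.commute\<close>)
  then show ?thesis using assms by (simp add: mult.commute)
qed

lemma ex_rsub_mono:
  assumes "finite Y" "\<And>E. E \<subseteq> Y \<Longrightarrow> f E \<le> g E"
  shows "ex_rsub Y p f \<le> ex_rsub Y p g"
  by (rule integral_mono_AE) (auto simp: AE_measure_pmf_iff assms dest: set_rsub_subset)

lemma ex_rsub_cong:
  assumes "finite Y" "\<And>E. E \<subseteq> Y \<Longrightarrow> f E = g E"
  shows "ex_rsub Y p f = ex_rsub Y p g"
  by (rule integral_cong_AE) (auto simp: AE_measure_pmf_iff assms dest: set_rsub_subset)

lemma prob_eq_ex_rsub: "measure_pmf.prob M A = measure_pmf.expectation M (\<lambda>E. of_bool (E \<in> A))"
proof -
  have "(\<lambda>E. of_bool (E \<in> A)) = (indicator A :: _ \<Rightarrow> real)" by (auto simp: indicator_def)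
  then show ?thesis by simp
qed

text \<open>Two-round exposure: an element is missed by both rounds with probability
  \<open>(1 - p) * (1 - q)\<close>. It allows a path to be fixed in the first round before the
  chords are drawn.\<close>

lemma ex_rsub_union:
  assumes "finite Y" "0 \<le> p" "p \<le> 1" "0 \<le> q" "q \<le> 1"
  shows "ex_rsub Y p (\<lambda>E1. ex_rsub Y q (\<lambda>E2. f (E1 \<union> E2))) = ex_rsub Y (p + q - p * q) f"
  using assms(1)
proof (induction Y arbitrary: f)
  case empty
  show ?case by (simp add: ex_rsub_empty)
next
  case (insert e Y)
  have pq: "0 \<le> p + q - p * q" "p + q - p * q \<le> 1"
  proof -
    have "p * q \<le> p" "(1 - p) * (1 - q) \<ge> 0" using assms mult_left_le[of q p] by auto
    then show "0 \<le> p + q - p * q" "p + q - p * q \<le> 1" using assms by (auto simp: algebra_simps)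
  qed
  note st = ex_rsub_insert[OF insert.hyps]
  have a: "ex_rsub (insert e Y) q (\<lambda>E2. f (E1 \<union> E2)) =
     q * ex_rsub Y q (\<lambda>E2. f (insert e (E1 \<union> E2))) + (1 - q) * ex_rsub Y q (\<lambda>E2. f (E1 \<union>
         E2))" for E1
    using st[of q "\<lambda>E2. f (E1 \<union> E2)"] assms by simp
  have b: "ex_rsub Y q (\<lambda>E2. f (insert e (E1 \<union> E2))) = ex_rsub Y q (\<lambda>E2. (\<lambda>E. f (insert e E)) (E1 \<union>
      E2))" for E1
    by simp
  let ?A = "ex_rsub Y (p + q - p * q) (\<lambda>E. f (insert e E))"
  let ?B = "ex_rsub Y (p + q - p * q) f"
  have IHA: "ex_rsub Y p (\<lambda>E1. ex_rsub Y q (\<lambda>E2. f (insert e (E1 \<union> E2)))) = ?A"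
    using insert.IH[of "\<lambda>E. f (insert e E)"] by simp
  have IHB: "ex_rsub Y p (\<lambda>E1. ex_rsub Y q (\<lambda>E2. f (E1 \<union> E2))) = ?B"
    using insert.IH[of f] .
  have "ex_rsub (insert e Y) p (\<lambda>E1. ex_rsub (insert e Y) q (\<lambda>E2. f (E1 \<union> E2))) =
     p * (q * ?A + (1 - q) * ?A) + (1 - p) * (q * ?A + (1 - q) * ?B)"
    unfolding a using insert.hyps
    by (subst st) (use assms in \<open>simp_all add: IHA IHB\<close>)
  also have "\<dots> = (p + q - p * q) * ?A + (1 - (p + q - p * q)) * ?B"
    by (simp add: algebra_simps)
  also have "\<dots> = ex_rsub (insert e Y) (p + q - p * q) f"
    using st[of "p + q - p * q" f] pq by simp
  finally show ?case .
qed

text \<open>This replaces a coupling of the two densities: one element at a time, the weight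
  \<open>q - p\<close> moves to the conditional expectation given that the element is present, which
  is the larger one.\<close>

lemma ex_rsub_prob_mono:
  assumes "finite Y" "0 \<le> p" "p \<le> q" "q \<le> 1" "\<And>E E'. E \<subseteq> E' \<Longrightarrow> f E \<le> f E'"
  shows "ex_rsub Y p f \<le> ex_rsub Y q f"
  using assms(1,5)
proof (induction Y arbitrary: f)
  case empty
  show ?case by (simp add: ex_rsub_empty)
next
  case (insert e Y)
  let ?f = "\<lambda>E. f (insert e E)"
  have 1: "ex_rsub Y p ?f \<le> ex_rsub Y q ?f" "ex_rsub Y p f \<le> ex_rsub Y q f"
    by (intro insert.IH insert.prems; blast)+
  have 2: "ex_rsub Y p f \<le> ex_rsub Y p ?f"
    by (intro ex_rsub_mono insert.hyps insert.prems) auto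
  have 3: "ex_rsub Y q f \<le> ex_rsub Y q ?f"
    by (intro ex_rsub_mono insert.hyps insert.prems) auto
  have "p * ex_rsub Y p ?f + (1 - p) * ex_rsub Y p f \<le> p * ex_rsub Y q ?f + (1 - p) * ex_rsub Y q f"
    using 1 assms by (intro add_mono mult_left_mono) auto
  also have "\<dots> \<le> q * ex_rsub Y q ?f + (1 - q) * ex_rsub Y q f"
    using mult_right_mono[of p q "ex_rsub Y q ?f - ex_rsub Y q f"] 3 assms
        by (simp add: algebra_simps)
  finally show ?case using assms by (subst (1 2) ex_rsub_insert[OF insert.hyps]) auto
qed

text \<open>The generating function of a binomial count at 1/2. With Markov's inequality it yields
  the lower tail for the number of chords across a cut.\<close>

lemma ex_rsub_half_power:
  assumes "finite Y" "Z \<subseteq> Y" "0 \<le> p" "p \<le> 1"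
  shows "ex_rsub Y p (\<lambda>E. (1/2) ^ card (E \<inter> Z)) = (1 - p / 2) ^ card Z"
  using assms(1,2)
proof (induction Y arbitrary: Z)
  case empty
  then show ?case by (simp add: ex_rsub_empty)
next
  case (insert e Y)
  show ?case
  proof (cases "e \<in> Z")
    case True
    have fin: "finite (Z - {e})" using insert by (meson finite.insertI finite_Diff finite_subset)
    have a: "ex_rsub Y p (\<lambda>E. (1/2) ^ card (insert e E \<inter> Z)) = 1/2 * (1 - p / 2) ^ card (Z - {e})"
    proof -
      have "ex_rsub Y p (\<lambda>E. (1/2) ^ card (insert e E \<inter> Z)) =
        ex_rsub Y p (\<lambda>E. 1/2 * (1/2) ^ card (E \<inter> (Z - {e})))"
      proof (rule ex_rsub_cong[OF insert.hyps(1)])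
        fix E assume E: "E \<subseteq> Y"
        have "insert e E \<inter> Z = insert e (E \<inter> (Z - {e}))" using True by auto
        then show "(1/2::real) ^ card (insert e E \<inter> Z) = 1/2 * (1/2) ^ card (E \<inter> (Z - {e}))"
          using fin by simp
      qed
      also have "\<dots> = 1/2 * (1 - p / 2) ^ card (Z - {e})"
        using insert.IH[of "Z - {e}"] insert.prems True by (simp add: subset_insert_iff)
      finally show ?thesis .
    qed
    have b: "ex_rsub Y p (\<lambda>E. (1/2) ^ card (E \<inter> Z)) = (1 - p / 2) ^ card (Z - {e})"
    proof -
      have "ex_rsub Y p (\<lambda>E. (1/2) ^ card (E \<inter> Z)) = ex_rsub Y p (\<lambda>E. (1/2) ^ card (E \<inter> (Z - {e})))"
      proof (rule ex_rsub_cong[OF insert.hyps(1)])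
        fix E assume "E \<subseteq> Y"
        then have "E \<inter> Z = E \<inter> (Z - {e})" using insert.hyps by auto
        then show "(1/2::real) ^ card (E \<inter> Z) = (1/2) ^ card (E \<inter> (Z - {e}))" by simp
      qed
      also have "\<dots> = (1 - p / 2) ^ card (Z - {e})"
        by (rule insert.IH) (use insert.prems in auto)
      finally show ?thesis .
    qed
    have "card Z = Suc (card (Z - {e}))" using True fin
        by (metis card.insert_remove insert_absorb finite_insert insert_Diff finite_Diff_insert)
    then show ?thesis
      by (subst ex_rsub_insert[OF insert.hyps assms(3,4)]) (simp add: a b algebra_simps
          add_divide_distrib)
  next
    case False
    then have "Z \<subseteq> Y" using insert by auto
    have "ex_rsub Y p (\<lambda>E. (1/2) ^ card (insert e E \<inter> Z)) = ex_rsub Y p (\<lambda>E. (1/2) ^ card (E \<inter> Z))"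
      using False by simp
    then show ?thesis using insert.IH[OF \<open>Z \<subseteq> Y\<close>]
      by (subst ex_rsub_insert[OF insert.hyps assms(3,4)]) (simp add: algebra_simps)
  qed
qed

lemma ex_rsub_subset:
  assumes "finite Y" "Z \<subseteq> Y" "0 \<le> p" "p \<le> 1"
  shows "ex_rsub Y p (\<lambda>E. of_bool (Z \<subseteq> E)) = p ^ card Z"
  using assms(1,2)
proof (induction Y arbitrary: Z)
  case empty
  then show ?case by (simp add: ex_rsub_empty)
next
  case (insert e Y)
  show ?case
  proof (cases "e \<in> Z")
    case True
    have fin: "finite (Z - {e})" using insert by (meson finite.insertI finite_Diff finite_subset)
    have "(Z \<subseteq> insert e E) = (Z - {e} \<subseteq> E)" for E using True by auto
    then have a: "ex_rsub Y p (\<lambda>E. of_bool (Z \<subseteq> insert e E)) = p ^ card (Z - {e})"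
      using insert.IH[of "Z - {e}"] insert by auto
    have b: "ex_rsub Y p (\<lambda>E. of_bool (Z \<subseteq> E)) = ex_rsub Y p (\<lambda>E. 0)"
      by (rule ex_rsub_cong) (use insert True in auto)
    have "card Z = Suc (card (Z - {e}))" using True fin
        by (metis card.insert_remove insert_absorb finite_insert insert_Diff finite_Diff_insert)
    then show ?thesis
      by (subst ex_rsub_insert[OF insert.hyps assms(3,4)]) (simp add: a b)
  next
    case False
    then have "Z \<subseteq> Y" using insert by auto
    have "(Z \<subseteq> insert e E) = (Z \<subseteq> E)" for E using False by auto
    then show ?thesis using insert.IH[OF \<open>Z \<subseteq> Y\<close>]
      by (subst ex_rsub_insert[OF insert.hyps assms(3,4)]) (simp add: algebra_simps)
  qed
qed

lemma map_image_rsub: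
  assumes "finite Y" "inj_on \<phi> Y"
  shows "map_pmf ((`) \<phi>) (rsub Y p) = rsub (\<phi> ` Y) p"
  using assms
proof (induction Y)
  case empty
  show ?case by (simp add: rsub_empty)
next
  case (insert e Y)
  have "map_pmf ((`) \<phi>) (rsub (insert e Y) p) =
    bernoulli_pmf p \<bind> (\<lambda>b. map_pmf (\<lambda>E.
        if b then insert (\<phi> e) E else E) (map_pmf ((`) \<phi>) (rsub Y p)))"
    unfolding rsub_insert[OF insert.hyps] map_bind_pmf pmf.map_comp o_def
    by (intro bind_pmf_cong refl map_pmf_cong) auto
  also have "\<dots> = rsub (insert (\<phi> e) (\<phi> ` Y)) p"
    using insert by (subst rsub_insert) auto
  finally show ?case by simp
qed

section \<open>Long paths by depth-first search\<close>

definition has_path :: "'a set \<Rightarrow> nat \<Rightarrow> 'a set set \<Rightarrow> bool" where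
  "has_path V l E \<longleftrightarrow> (\<exists>xs. distinct xs \<and> length xs = l \<and> set xs \<subseteq> V \<and>
      (\<forall>i. Suc i < l \<longrightarrow> {xs ! i, xs ! Suc i} \<in> E))"

definition path_in :: "'a set set \<Rightarrow> 'a list \<Rightarrow> bool" where
  "path_in K us \<longleftrightarrow> (\<forall>i. Suc i < length us \<longrightarrow> {us ! i, us ! Suc i} \<in> K)"

text \<open>
  A state of a depth-first search: \<open>us\<close> is the stack, \<open>S\<close> the set of finished vertices, \<open>T\<close> the set
  of unvisited vertices, \<open>Q\<close> the set of pairs queried so far, and \<open>K \<subseteq> Q\<close> the set of edges found.
\<close>

definition dfs_state :: "'a set \<Rightarrow> nat \<Rightarrow> 'a set set \<Rightarrow> 'a set set \<Rightarrow> 'a list \<Rightarrow> 'a set \<Rightarrow> 'a set \<Rightarrow> bool"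
    where
  "dfs_state V l Q K us S T \<longleftrightarrow>
     K \<subseteq> Q \<and> Q \<subseteq> vertex_pairs V \<and> distinct us \<and> path_in K us \<and>
     set us \<inter> S = {} \<and> set us \<inter> T = {} \<and> S \<inter> T = {} \<and> set us \<union> S \<union> T = V \<and>
     (\<forall>s\<in>S. \<forall>t\<in>T. {s, t} \<in> Q) \<and> card K \<le> card S + length us \<and>
     2 * card S \<le> card V \<and> length us \<le> l"

lemma path_in_Cons: "path_in K (u # us) \<Longrightarrow> path_in K us"
  unfolding path_in_def by (metis Suc_less_eq length_Cons nth_Cons_Suc)

lemma finite_vertex_pairs [simp]: "finite V \<Longrightarrow> finite (vertex_pairs V)"
  unfolding vertex_pairs_def by (rule finite_subset[of _ "Pow V"]) auto

abbreviation ex_graph :: "'a set \<Rightarrow> real \<Rightarrow> ('a set set \<Rightarrow> real) \<Rightarrow> real" where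
  "ex_graph V p f \<equiv> ex_rsub (vertex_pairs V) p f"

lemma card_cross_pairs:
  assumes "finite S" "finite T" "S \<inter> T = {}"
  shows "card ((\<lambda>(s, t). {s, t}) ` (S \<times> T)) = card S * card T"
proof -
  have "inj_on (\<lambda>(s, t). {s, t}) (S \<times> T)"
    using assms by (auto simp: inj_on_def doubleton_eq_iff)
  then show ?thesis by (simp add: card_image card_cartesian_product)
qed

lemma dfs_queries:
  assumes "dfs_state V l Q K us S T" "finite V"
  shows "card S * card T \<le> card Q" "card S + length us + card T = card V"
proof -
  have fin: "finite S" "finite T" "finite Q"
    using assms finite_subset[OF _ finite_vertex_pairs[of V]] unfolding dfs_state_def by auto
  have "(\<lambda>(s, t). {s, t}) ` (S \<times> T) \<subseteq> Q" using assms unfolding dfs_state_def by auto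
  then show "card S * card T \<le> card Q"
    using card_cross_pairs[of S T] fin assms unfolding dfs_state_def by (metis card_mono)
  have "card (set us \<union> S \<union> T) = card (set us) + card S + card T"
  proof -
    have "set us \<inter> S = {}" "(set us \<union> S) \<inter> T = {}" using assms unfolding dfs_state_def by auto
    then show ?thesis using fin by (simp add: card_Un_disjoint)
  qed
  moreover have "set us \<union> S \<union> T = V" "card (set us) = length us"
    using assms unfolding dfs_state_def by (auto simp: distinct_card)
  ultimately show "card S + length us + card T = card V" by simp
qed

text \<open>The moves that cost no query: a new root is put on an empty stack, and a top vertex
  without unqueried pairs to \<open>T\<close> is finished. Doubling \<open>card T\<close> in the
  measure makes the first move decrease it although the stack grows.\<close>

lemma dfs_normalise:
  assumes "dfs_state V l Q K us S T" "finite V" "card Q \<le> N" "length us < l"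
    and half: "2 * N < card V div 2 * (card V - 2 * l - 2)"
    and l: "1 \<le> l" "2 * l + 2 < card V"
  shows "\<exists>us' S' T' u t. dfs_state V l Q K us' S' T' \<and> length us' < l \<and>
           (\<exists>us''. us' = u # us'') \<and> t \<in> T' \<and> {u, t} \<notin> Q \<or>
         dfs_state V l Q K us' S' T' \<and> length us' = l"
  using assms(1,4)
proof (induction "2 * card T + length us" arbitrary: us S T rule: less_induct)
  case less
  note st = less.prems(1)
  have fin: "finite S" "finite T" "finite Q"
    using st \<open>finite V\<close> finite_subset[OF _ finite_vertex_pairs[of V]] unfolding dfs_state_def
        by auto
  note q = dfs_queries[OF st \<open>finite V\<close>]
  show ?case
  proof (cases us)
    case Nil
    have "card T > 0" using q st Nil l unfolding dfs_state_def by auto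
    then obtain t where t: "t \<in> T" by fastforce
    have st': "dfs_state V l Q K [t] S (T - {t})"
      using st t Nil l unfolding dfs_state_def path_in_def by auto
    show ?thesis
    proof (cases "l = 1")
      case True
      then have "length [t] = l" by simp
      then show ?thesis using st' by blast
    next
      case False
      have "card (T - {t}) < card T" using t fin by (meson card_Diff1_less)
      then have "2 * card (T - {t}) + length [t] < 2 * card T + length us" using Nil by simp
      from less.hyps[OF this st'] show ?thesis using False l by simp
    qed
  next
    case (Cons u us')
    show ?thesis
    proof (cases "\<exists>t\<in>T. {u, t} \<notin> Q")
      case True
      then show ?thesis using less.prems Cons by blast
    next
      case False
      have u: "u \<notin> S" "u \<notin> T" using st Cons unfolding dfs_state_def by auto
      \<comment> \<open>If \<open>S\<close> passed half of \<open>V\<close>, then \<open>S\<close>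
        and \<open>T\<close> would both be so large that the pairs between them, all of them
        queried, exceed \<open>N\<close> by \<open>half\<close>.\<close>
      have *: "2 * card (insert u S) \<le> card V"
      proof (rule ccontr)
        assume "\<not> ?thesis"
        then have 1: "card V \<le> 2 * card S + 1" using u fin by simp
        have S2: "2 * card S \<le> card V" using st unfolding dfs_state_def by auto
        have "card V div 2 \<le> card S" using 1 by linarith
        moreover have "card V - 2 * l - 2 \<le> 2 * card T" using q(2) 1 S2 less.prems(2) by linarith
        ultimately have "card V div 2 * (card V - 2 * l - 2) \<le> card S * (2 * card T)"
            by (rule mult_le_mono)
        then show False using half q(1) assms(3) by simp
      qed
      have p: "path_in K us'" using st Cons path_in_Cons unfolding dfs_state_def by auto
      have st': "dfs_state V l Q K us' (insert u S) T"
        using st False * u fin p unfolding dfs_state_def Cons by auto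
      show ?thesis using less.hyps[OF _ st'] Cons less.prems(2) by simp
    qed
  qed
qed

text \<open>With \<open>k\<close> edges found and a short stack, at least \<open>k - l\<close>
  vertices are finished. The product \<open>s * (card V - s - l)\<close> is concave in
  \<open>s\<close> and has the same value at \<open>k - l\<close> and at \<open>card V - k\<close>;
  \<open>card S\<close> lies between these, so more than \<open>N\<close> pairs would have been
  queried.\<close>

lemma dfs_terminal:
  assumes "dfs_state V l Q K us S T" "finite V" "card Q \<le> N" "length us < l"
    and "int N < (int k - int l) * (int (card V) - int k)"
    and "2 * N < card V div 2 * (card V - 2 * l - 2)" "k \<le> card K"
    and kl: "l < k" "2 * k \<le> card V" "2 * l + 2 < card V"
  shows False
proof -
  note q = dfs_queries[OF assms(1,2)]
  have s: "int k - int l \<le> int (card S)" "2 * card S \<le> card V" "card K \<le> card S + length us"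
    using assms unfolding dfs_state_def by auto
  have t: "int (card T) \<ge> int (card V) - int (card S) - int l" using q(2) assms(4) by linarith
  have "int (card S) * int (card T) \<le> int N" using q(1) assms(3)
      by (metis of_nat_le_iff of_nat_mult order_trans)
  moreover have "int (card S) * (int (card V) - int (card S) - int l) \<le> int (card S) * int (card T)"
    using t by (intro mult_left_mono) auto
  moreover have "(int k - int l) * (int (card V) - int k) \<le>
      int (card S) * (int (card V) - int (card S) - int l)"
  proof -
    define x where "x = int (card S) - (int k - int l)"
    have "int (card S) * (int (card V) - int (card S) - int l) - (int k - int l) * (int (card V) -
        int k)
      = x * (int (card V) - int k - int (card S))"
      unfolding x_def by (simp add: algebra_simps)
    moreover have "x \<ge> 0" using s x_def by auto
    moreover have "int (card V) - int k - int (card S) \<ge> 0" using s kl by linarith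
    ultimately show ?thesis by (metis diff_ge_0_iff_ge mult_nonneg_nonneg)
  qed
  ultimately show False using assms(5) by linarith
qed

lemma dfs_path: "dfs_state V l Q K us S T \<Longrightarrow> length us = l \<Longrightarrow> K \<subseteq> E \<Longrightarrow> has_path V l E"
  unfolding dfs_state_def has_path_def path_in_def by (intro exI[of _ us]) auto

text \<open>
  Induction on the number of remaining queries: the bound is a martingale along the search. It is at
  least one if too few edges have been found after \<open>N\<close> queries, and by \<open>dfs_terminal\<close> there is a
  path otherwise.
\<close>

lemma dfs_failure_bound:
  fixes p z :: real
  assumes fin: "finite V" and p: "0 \<le> p" "p \<le> 1" and z: "0 < z" "z \<le> 1"
    and nums: "int N < (int k - int l) * (int (card V) - int k)"
      "2 * N < card V div 2 * (card V - 2 * l - 2)" "1 \<le> l" "l < k" "2 * k \<le> card V" "2 * l + 2 <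
          card V"
    and "dfs_state V l Q K us S T" "card Q \<le> N"
  shows "ex_rsub (vertex_pairs V - Q) p (\<lambda>E. of_bool (\<not> has_path V l (K \<union> E)))
     \<le> z powi (int (card K) - int k) * (1 - p + p * z) ^ (N - card Q)"
  using assms(12,13)
proof (induction "N - card Q" arbitrary: Q K us S T)
  case 0
  then have N: "card Q = N" by simp
  show ?case
  proof (cases "length us = l")
    case True
    then have "ex_rsub (vertex_pairs V - Q) p (\<lambda>E. of_bool (\<not> has_path V l (K \<union> E))) =
       ex_rsub (vertex_pairs V - Q) p (\<lambda>E. 0)"
      using dfs_path[OF 0(2)] fin by (intro ex_rsub_cong) auto
    also have "\<dots> \<le> z powi (int (card K) - int k) * (1 - p + p * z) ^ (N - card Q)" using z p by simp
    finally show ?thesis .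
  next
    case False
    then have "length us < l" using 0 unfolding dfs_state_def by auto
    then have "card K < k" using dfs_terminal[OF 0(2) fin, of N k] nums N by force
    then have "1 \<le> z powi (int (card K) - int k)"
      using z by (simp add: power_int_def field_simps one_le_inverse power_le_one)
    moreover have "ex_rsub (vertex_pairs V - Q) p (\<lambda>E. of_bool (\<not> has_path V l (K \<union> E))) \<le>
       ex_rsub (vertex_pairs V - Q) p (\<lambda>E. 1)" using fin by (intro ex_rsub_mono) auto
    ultimately show ?thesis using N by simp
  qed
next
  case (Suc d)
  have nn: "0 \<le> z powi (int (card K) - int k) * (1 - p + p * z) ^ (N - card Q)" using z p by simp
  have path: "ex_rsub (vertex_pairs V - Q) p (\<lambda>E. of_bool (\<not> has_path V l (K \<union> E))) = 0"
    if "dfs_state V l Q K us' S' T'" "length us' = l" for us' S' T'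
  proof -
    have "ex_rsub (vertex_pairs V - Q) p (\<lambda>E. of_bool (\<not> has_path V l (K \<union> E))) =
       ex_rsub (vertex_pairs V - Q) p (\<lambda>E. 0)"
      using dfs_path[OF that] fin by (intro ex_rsub_cong) auto
    then show ?thesis by simp
  qed
  show ?case
  proof (cases "length us < l")
    case False
    then show ?thesis using path[of us S T] Suc nn unfolding dfs_state_def by auto
  next
    case True
    from dfs_normalise[OF Suc(3) fin Suc(4) True nums(2,3,6)] obtain us' S' T' u t where
      alt: "dfs_state V l Q K us' S' T' \<and> length us' < l \<and> (\<exists>us''. us' = u # us'') \<and> t \<in> T' \<and>
          {u, t} \<notin> Q \<or>
         dfs_state V l Q K us' S' T' \<and> length us' = l" by blast
    show ?thesis
    proof (cases "length us' = l")
      case True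
      then show ?thesis using path[of us' S' T'] alt nn by auto
    next
      case False
      then obtain us'' where st: "dfs_state V l Q K us' S' T'" and len: "length us' < l"
        and us': "us' = u # us''" and t: "t \<in> T'" and ut: "{u, t} \<notin> Q" using alt by auto
      let ?e = "{u, t}"
      have uV: "u \<in> V" "t \<in> V" "u \<noteq> t" using st t unfolding dfs_state_def us' by auto
      then have e: "?e \<in> vertex_pairs V" unfolding vertex_pairs_def by auto
      have finQ: "finite Q" "finite K"
        using st finite_subset[OF _ finite_vertex_pairs[OF fin]] unfolding dfs_state_def
            by (auto intro: finite_subset)
      have eK: "?e \<notin> K" using ut st unfolding dfs_state_def by auto
      have cQ: "card (insert ?e Q) = Suc (card Q)" "card (insert ?e K) = Suc (card K)"
        using finQ ut eK by auto
      have no: "dfs_state V l (insert ?e Q) K us' S' T'"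
        using st e unfolding dfs_state_def by auto
      have pth: "path_in (insert ?e K) (t # us')"
        using st unfolding dfs_state_def path_in_def us'
        by (auto simp: nth_Cons insert_commute split: nat.splits)
      have yes: "dfs_state V l (insert ?e Q) (insert ?e K) (t # us') S' (T' - {t})"
        using st e len t pth finQ eK unfolding dfs_state_def by auto
      have d: "d = N - card (insert ?e Q)" "card (insert ?e Q) \<le> N" using Suc(2) cQ by auto
      let ?Y = "vertex_pairs V - insert ?e Q"
      have Y: "vertex_pairs V - Q = insert ?e ?Y" using e ut by auto
      have I1: "ex_rsub ?Y p (\<lambda>E. of_bool (\<not> has_path V l (insert ?e K \<union> E)))
         \<le> z powi (int (Suc (card K)) - int k) * (1 - p + p * z) ^ d"
        using Suc(1)[OF d(1) yes d(2)] d cQ by simp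
      have I2: "ex_rsub ?Y p (\<lambda>E. of_bool (\<not> has_path V l (K \<union> E)))
         \<le> z powi (int (card K) - int k) * (1 - p + p * z) ^ d"
        using Suc(1)[OF d(1) no d(2)] d by simp
      have zz: "z powi (int (Suc (card K)) - int k) = z * z powi (int (card K) - int k)"
        using z power_int_add_1'[of z "int (card K) - int k"] by (simp add: algebra_simps)
      have "ex_rsub (vertex_pairs V - Q) p (\<lambda>E. of_bool (\<not> has_path V l (K \<union> E))) =
        p * ex_rsub ?Y p (\<lambda>E. of_bool (\<not> has_path V l (insert ?e K \<union> E))) +
        (1 - p) * ex_rsub ?Y p (\<lambda>E. of_bool (\<not> has_path V l (K \<union> E)))"
        unfolding Y using fin p by (subst ex_rsub_insert) auto
      also have "\<dots> \<le> p * (z powi (int (Suc (card K)) - int k) * (1 - p + p * z) ^ d) +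
         (1 - p) * (z powi (int (card K) - int k) * (1 - p + p * z) ^ d)"
        using I1 I2 p by (intro add_mono mult_left_mono) auto
      also have "\<dots> = z powi (int (card K) - int k) * (1 - p + p * z) ^ Suc d"
        unfolding zz by (simp add: algebra_simps)
      finally show ?thesis using Suc(2) by simp
    qed
  qed
qed

lemma path_failure_bound:
  fixes p z :: real
  assumes fin: "finite V" and p: "0 \<le> p" "p \<le> 1" and z: "0 < z" "z \<le> 1"
    and nums: "int N < (int k - int l) * (int (card V) - int k)"
      "2 * N < card V div 2 * (card V - 2 * l - 2)" "1 \<le> l" "l < k" "2 * k \<le> card V" "2 * l + 2 <
          card V"
  shows "ex_graph V p (\<lambda>E. of_bool (\<not> has_path V l E)) \<le> (1 - p + p * z) ^ N / z ^ k"
proof -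
  have "dfs_state V l {} {} [] {} V" by (auto simp: dfs_state_def path_in_def)
  from dfs_failure_bound[OF assms this] have
    "ex_graph V p (\<lambda>E. of_bool (\<not> has_path V l E)) \<le> z powi (- int k) * (1 - p + p * z) ^ N"
    by simp
  then show ?thesis using z by (simp add: power_int_minus field_simps)
qed

section \<open>Graphs of classes with few cycles\<close>

text \<open>
  Pieces \<open>P x\<close> that are separated from the rest by one vertex and \<open>Q\<close> are small in total: by
  \<open>exp\<close> a nonempty piece has a neighbour in \<open>Q\<close>, and a vertex of \<open>Q\<close> is next to at most three pieces.
\<close>

lemma small_pieces:
  fixes adj :: "'a \<Rightarrow> 'a \<Rightarrow> bool" and \<beta> :: real
  defines "nb \<equiv> \<lambda>F S. {j \<in> F - S. \<exists>i\<in>S. adj i j}"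
  assumes fin: "finite F" "finite I" and QF: "Q \<subseteq> F" and beta: "0 < \<beta>"
    and sym: "\<And>i j. adj i j \<Longrightarrow> adj j i"
    and deg: "\<And>i. i \<in> F \<Longrightarrow> card {j \<in> F. adj i j} \<le> 3"
    and exp: "\<And>S. S \<subseteq> F \<Longrightarrow> S \<noteq> {} \<Longrightarrow> 2 * card S \<le> card F \<Longrightarrow>
      2 \<le> card (nb F S) \<and> \<beta> * card S \<le> card (nb F S)"
    and P: "\<And>x. x \<in> I \<Longrightarrow> P x \<subseteq> F" "\<And>x. x \<in> I \<Longrightarrow> 2 * card (P x) \<le> card F"
      "\<And>x. x \<in> I \<Longrightarrow> \<exists>w. nb F (P x) \<subseteq> insert w Q"
      "\<And>x y. x \<in> I \<Longrightarrow> y \<in> I \<Longrightarrow> x \<noteq> y \<Longrightarrow> P x \<inter> P y = {}"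
  shows "\<beta> * card (\<Union>x\<in>I. P x) \<le> 6 * card Q"
proof -
  have finQ: "finite Q" using QF fin finite_subset by blast
  have finP: "finite (P x)" if "x \<in> I" for x using P(1)[OF that] fin finite_subset by blast
  have one: "\<beta> * card (P x) \<le> 2 * card {q \<in> Q. \<exists>i\<in>P x. adj i q}" if x: "x \<in> I" for x
  proof (cases "P x = {}")
    case False
    obtain w where w: "nb F (P x) \<subseteq> insert w Q" using P(3)[OF x] by blast
    let ?N = "{q \<in> Q. \<exists>i\<in>P x. adj i q}"
    have "nb F (P x) \<subseteq> insert w ?N" using w unfolding nb_def by auto
    then have "card (nb F (P x)) \<le> card (insert w ?N)" using finQ by (intro card_mono) auto
    also have "\<dots> \<le> Suc (card ?N)" by (simp add: card_insert_if finQ)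
    finally have le: "card (nb F (P x)) \<le> Suc (card ?N)" .
    moreover have e: "2 \<le> card (nb F (P x))" "\<beta> * card (P x) \<le> card (nb F (P x))"
      using exp[OF P(1)[OF x] False P(2)[OF x]] by auto
    \<comment> \<open>There are at least two outer neighbours and at most one of them is
      \<open>w\<close>, so one lies in \<open>Q\<close>; then
      \<open>1 + card ?N \<le> 2 * card ?N\<close> absorbs the vertex \<open>w\<close>.\<close>
    ultimately have "1 \<le> card ?N" by linarith
    then show ?thesis using le e by linarith
  qed simp
  have cnt: "card {x \<in> I. \<exists>i\<in>P x. adj i q} \<le> 3" if "q \<in> Q" for q
  proof -
    let ?X = "{x \<in> I. \<exists>i\<in>P x. adj i q}"
    let ?A = "\<lambda>x. {j \<in> P x. adj q j}"
    have "card ?X = (\<Sum>x\<in>?X. 1)" by simp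
    also have "\<dots> \<le> (\<Sum>x\<in>?X. card (?A x))"
    proof (rule sum_mono)
      fix x assume "x \<in> ?X"
      then have "?A x \<noteq> {}" "finite (?A x)" using sym finP by auto
      then show "1 \<le> card (?A x)" by (simp add: Suc_leI card_gt_0_iff)
    qed
    also have "\<dots> = card (\<Union>x\<in>?X. ?A x)"
      by (rule card_UN_disjoint[symmetric]) (use fin finP P(4) in auto)
    also have "\<dots> \<le> card {j \<in> F. adj q j}"
      by (rule card_mono) (use fin P(1) in auto)
    also have "\<dots> \<le> 3" using deg QF that by auto
    finally show ?thesis .
  qed
  have "card (\<Union>x\<in>I. P x) = (\<Sum>x\<in>I. card (P x))"
    by (rule card_UN_disjoint) (use fin finP P(4) in auto)
  then have "\<beta> * card (\<Union>x\<in>I. P x) = (\<Sum>x\<in>I. \<beta> * card (P x))" by (simp add: sum_distrib_left)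
  also have "\<dots> \<le> (\<Sum>x\<in>I. 2 * real (card {q \<in> Q. \<exists>i\<in>P x. adj i q}))"
    using one by (intro sum_mono) simp
  also have "\<dots> = 2 * real (\<Sum>x\<in>I. card {q \<in> Q. \<exists>i\<in>P x. adj i q})" by (simp add: sum_distrib_left)
  also have "(\<Sum>x\<in>I. card {q \<in> Q. \<exists>i\<in>P x. adj i q}) = (\<Sum>q\<in>Q. card {x \<in> I. \<exists>i\<in>P x. adj i q})"
    using sum.swap_restrict[OF fin(2) finQ, of "\<lambda>_ _. 1::nat" "\<lambda>x q. \<exists>i\<in>P x. adj i q"] by simp
  also have "\<dots> \<le> (\<Sum>q\<in>Q. 3)" by (rule sum_mono) (use cnt in auto)
  finally show ?thesis by simp
qed

text \<open>
  The classes of \<open>c1\<close> and \<open>c2\<close> are the nodes of a graph whose edges are the vertices of the given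
  expander. The vertices outside \<open>Q\<close> form a spanning tree of it; every edge of the tree splits
  the expander into two sides that touch only in that edge and in \<open>Q\<close>, hence one of them is small.
  The central class is the node to which all these edges point.
\<close>

lemma central_class:
  fixes c1 c2 :: "nat \<Rightarrow> 'c" and adj :: "nat \<Rightarrow> nat \<Rightarrow> bool" and \<beta> :: real and v :: nat
  defines "nb \<equiv> \<lambda>F S. {j \<in> F - S. \<exists>i\<in>S. adj i j}"
  defines "Q \<equiv> {i. 0 < i \<and> i < v \<and> (\<exists>j<i. c1 j = c1 i) \<and> (\<exists>j<i. c2 j = c2 i)}"
  assumes disj: "\<And>i j. c1 i \<noteq> c2 j" and beta: "0 < \<beta>" "\<beta> \<le> 1"
    and share: "\<And>i j. i < v \<Longrightarrow> j < v \<Longrightarrow> adj i j \<Longrightarrow> c1 i = c1 j \<or> c2 i = c2 j"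
    and sym: "\<And>i j. adj i j \<Longrightarrow> adj j i"
    and conn: "\<And>i. 0 < i \<Longrightarrow> i < v \<Longrightarrow> \<exists>j<i. adj i j"
    and deg: "\<And>i. i < v \<Longrightarrow> card {j \<in> {..<v}. adj i j} \<le> 3"
    and exp: "\<And>S. S \<subseteq> {..<v} \<Longrightarrow> S \<noteq> {} \<Longrightarrow> 2 * card S \<le> v \<Longrightarrow>
      2 \<le> card (nb {..<v} S) \<and> \<beta> * card S \<le> card (nb {..<v} S)"
    and Q: "14 * card Q \<le> \<beta> * v"
  shows "\<exists>c. 2 * card {i. i < v \<and> c1 i \<noteq> c \<and> c2 i \<noteq> c} \<le> v"
proof -
  define J where "J = {..<v} - Q"
  \<comment> \<open>Vertex \<open>i\<close> is an edge between the classes \<open>c1 i\<close> and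
    \<open>c2 i\<close>. For a tree edge, \<open>new i\<close> is the endpoint not met before and
    \<open>old i\<close> the other one; at index 0 the class \<open>c1 0\<close> is declared the
    root.\<close>
  define new where "new i = (if i = 0 then c2 0 else if \<exists>j<i. c1 j = c1 i then c2 i else c1 i)"
      for i
  define old where "old i = (if i = 0 then c1 0 else if \<exists>j<i. c1 j = c1 i then c1 i else c2 i)"
      for i
  have on: "old i \<noteq> new i" "{old i, new i} = {c1 i, c2 i}" for i
    using disj[of i i] by (auto simp: old_def new_def)
  have newfresh: "new i \<noteq> c1 j" "new i \<noteq> c2 j" if "i \<in> J" "j < i" for i j
  proof -
    have "c1 j \<noteq> c1 i \<or> new i = c2 i" "c2 j \<noteq> c2 i \<or> new i = c1 i" "new i = c1 i \<or> new i = c2 i"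
      using that unfolding J_def Q_def new_def by auto
    then show "new i \<noteq> c1 j" "new i \<noteq> c2 j" using disj[of j i] disj[of i j] disj[of i i] by metis+
  qed
  have oldseen: "\<exists>j<i. old i = c1 j \<or> old i = c2 j" if i: "i \<in> J" "0 < i" for i
  proof -
    obtain j where j: "j < i" "adj i j" using conn[of i] i unfolding J_def by auto
    then have "c1 i = c1 j \<or> c2 i = c2 j" using share[of i j] that unfolding J_def by auto
    then show ?thesis using j(1) \<open>0 < i\<close> unfolding old_def by (metis not_gr_zero)
  qed
  have new_inj: "i = j" if "i \<in> J" "j \<in> J" "new i = new j" for i j
  proof (rule ccontr)
    assume "i \<noteq> j"
    moreover have "new i \<in> {c1 i, c2 i}" "new j \<in> {c1 j, c2 j}" using on(2) by blast+
    ultimately show False using newfresh that by (metis insert_iff nat_neq_iff singletonD)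
  qed
  have born: "c = c1 0 \<or> (\<exists>j\<in>J. new j = c)" if c: "c = c1 i \<or> c = c2 i" "i < v" for c i
  proof -
    \<comment> \<open>The first vertex that meets the class \<open>c\<close>. It is not in
      \<open>Q\<close>, because both classes of a vertex in \<open>Q\<close> have been met
      earlier.\<close>
    define j where "j = (LEAST j. c = c1 j \<or> c = c2 j)"
    have j: "c = c1 j \<or> c = c2 j" unfolding j_def using c(1) by (rule LeastI)
    have min: "c \<noteq> c1 k" "c \<noteq> c2 k" if "k < j" for k using that not_less_Least unfolding j_def
        by blast+
    have "j \<le> i" unfolding j_def using c(1) by (rule Least_le)
    then have jv: "j < v" using c by simp
    show ?thesis
    proof (cases "j = 0")
      case True
      have "0 \<in> J" using jv True by (auto simp: J_def Q_def)
      then show ?thesis using j True by (auto simp: new_def)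
    next
      case False
      have "j \<notin> Q"
      proof
        assume "j \<in> Q"
        then obtain k k' where "k < j" "c1 k = c1 j" "k' < j" "c2 k' = c2 j" unfolding Q_def by auto
        then show False using j min[of k] min[of k'] by auto
      qed
      then have jJ: "j \<in> J" using jv J_def by auto
      moreover obtain k where "k < j" "old j = c1 k \<or> old j = c2 k" using oldseen[OF jJ] False
          by auto
      then have "old j \<noteq> c" using min[of k] by auto
      moreover have "c \<in> {old j, new j}" unfolding on(2) using j by auto
      ultimately show ?thesis by auto
    qed
  qed
  \<comment> \<open>The child relation on tree edges. A child has a larger index than its parent,
    and by \<open>new_inj\<close> there is at most one parent; \<open>D i\<close> is the set of
    edges strictly below \<open>i\<close>.\<close>
  define R where "R = {(i, j). i \<in> J \<and> j \<in> J \<and> new i = old j}"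
  have Rless: "i < j" if "(i, j) \<in> R" for i j
  proof (rule ccontr)
    assume "\<not> i < j"
    moreover have "i \<noteq> j" using that on(1)[of j] unfolding R_def by auto
    ultimately have "j < i" by simp
    moreover have "old j \<in> {c1 j, c2 j}" using on(2) by blast
    ultimately show False using newfresh[of i j] that unfolding R_def by auto
  qed
  have Rtless: "i < j" if "(i, j) \<in> R\<^sup>+" for i j
    using that
  proof (induction rule: trancl_induct)
    case (base y)
    then show ?case by (rule Rless)
  next
    case (step y z)
    then show ?case using Rless[of y z] by simp
  qed
  have RJ: "j \<in> J" if "(i, j) \<in> R\<^sup>+" for i j
    using tranclD2[OF that] unfolding R_def by auto
  have sv: "single_valued (R\<inverse>)"
    unfolding single_valued_def R_def using new_inj by auto
  define D where "D i = {j. (i, j) \<in> R\<^sup>+}" for i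
  have DJ: "D i \<subseteq> J" "i \<notin> D i" for i unfolding D_def using RJ Rtless by auto
  \<comment> \<open>Both classes of an edge in \<open>D i\<close> are \<open>new\<close> endpoints
    of edges in \<open>insert i (D i)\<close>, and a tree edge that contains such a class is either
    that edge itself or one of its children.\<close>
  have edge: "k \<in> insert i (D i)" if jk: "j \<in> D i" "k \<in> J" "adj j k" for i j k
  proof -
    have jJ: "j \<in> J" using that DJ by auto
    then have "c1 j = c1 k \<or> c2 j = c2 k" using share[of j k] jk unfolding J_def by auto
    then obtain c where "c \<in> {c1 j, c2 j}" "c \<in> {c1 k, c2 k}" by blast
    then have c: "c \<in> {old j, new j}" "c \<in> {old k, new k}" by (simp_all only: on(2))
    obtain i' where i': "i' \<in> insert i (D i)" "i' \<in> J" "c = new i'"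
    proof (cases "c = new j")
      case True
      then show ?thesis using jk(1) jJ by (intro that[of j]) auto
    next
      case False
      then have "c = old j" using c by auto
      obtain i' where i': "(i, i') \<in> R\<^sup>*" "(i', j) \<in> R" using tranclD2[of i j R] jk(1)
          by (auto simp: D_def)
      then have "i' \<in> insert i (D i)" by (auto simp: D_def dest: rtranclD)
      moreover have "i' \<in> J" "c = new i'" using i'(2) \<open>c = old j\<close> unfolding R_def by auto
      ultimately show ?thesis by (rule that)
    qed
    show ?thesis
    proof (cases "c = new k")
      case True
      then have "new k = new i'" using i'(3) by (rule subst)
      then have "k = i'" by (rule new_inj[OF jk(2) i'(2)])
      then show ?thesis using i'(1) by simp
    next
      case False
      then have "c = old k" using c(2) by simp
      then have "(i', k) \<in> R" using i'(2,3) jk(2) by (simp add: R_def)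
      then show ?thesis using i'(1) unfolding D_def by (auto intro: trancl_into_trancl)
    qed
  qed
  have nbD: "nb {..<v} (D i) \<subseteq> insert i Q" for i
  proof
    fix k assume "k \<in> nb {..<v} (D i)"
    then obtain j where "k < v" "k \<notin> D i" "j \<in> D i" "adj j k" unfolding nb_def by auto
    then show "k \<in> insert i Q" using edge[of j i k] unfolding J_def by auto
  qed
  have nbR: "nb {..<v} (J - insert i (D i)) \<subseteq> insert i Q" for i
  proof
    fix j assume "j \<in> nb {..<v} (J - insert i (D i))"
    then obtain k where k: "j < v" "j \<notin> J - insert i (D i)" "k \<in> J" "k \<notin> insert i (D i)" "adj k j"
      unfolding nb_def by auto
    then show "j \<in> insert i Q" using edge[of j i k] sym[of k j] unfolding J_def by auto
  qed
  have childdisj: "(insert c (D c)) \<inter> (insert c' (D c')) = {}" if "old c = old c'" "c \<noteq> c'" "c \<in> J"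
      "c' \<in> J" for c c'
  proof -
    have no: False if cc: "(c, c') \<in> R\<^sup>+" "old c = old c'" "c \<in> J" for c c'
    proof -
      obtain i' where i': "(c, i') \<in> R\<^sup>*" "(i', c') \<in> R" using tranclD2[OF cc(1)] by auto
      then have "(i', c) \<in> R" using cc by (auto simp: R_def)
      then have "i' < c" by (rule Rless)
      moreover have "c \<le> i'" using i'(1) Rtless[of c i'] by (auto dest: rtranclD)
      ultimately show False by simp
    qed
    show ?thesis
    proof (rule ccontr)
      assume "\<not> ?thesis"
      then obtain j where "(c, j) \<in> R\<^sup>*" "(c', j) \<in> R\<^sup>*" unfolding D_def
          by (auto intro: trancl_into_rtrancl)
      then have "(j, c) \<in> (R\<inverse>)\<^sup>*" "(j, c') \<in> (R\<inverse>)\<^sup>*" by (auto simp: rtrancl_converse)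
      from single_valued_confluent[OF sv this] have "(c, c') \<in> R\<^sup>* \<or> (c', c) \<in> R\<^sup>*"
        by (auto simp: rtrancl_converse)
      then show False using no[of c c'] no[of c' c] that by (auto dest: rtranclD)
    qed
  qed
  \<comment> \<open>The vertices outside the class \<open>N\<close> lie in \<open>Q\<close> or in a
    piece. After multiplication by \<beta> they count at most \<open>card Q\<close> and
    \<open>6 * card Q\<close>; twice the sum is the 14 of the hypothesis on
    \<open>Q\<close>.\<close>
  have finish: ?thesis if i: "finite I" and P: "\<And>x. x \<in> I \<Longrightarrow> P x \<subseteq> J" "\<And>x. x \<in> I \<Longrightarrow> 2 * card (P x) \<le>
      v"
      "\<And>x. x \<in> I \<Longrightarrow> nb {..<v} (P x) \<subseteq> insert x Q"
      "\<And>x y. x \<in> I \<Longrightarrow> y \<in> I \<Longrightarrow> x \<noteq> y \<Longrightarrow> P x \<inter> P y = {}"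
    and cov: "\<And>j. j \<in> J \<Longrightarrow> c1 j \<noteq> N \<Longrightarrow> c2 j \<noteq> N \<Longrightarrow> j \<in> (\<Union>x\<in>I. P x)" for I :: "nat set" and P N
  proof -
    have QF: "Q \<subseteq> {..<v}" unfolding Q_def by auto
    have s: "\<beta> * card (\<Union>x\<in>I. P x) \<le> 6 * card Q"
    proof (rule small_pieces[of "{..<v}" I Q \<beta> adj P])
      show "P x \<subseteq> {..<v}" if "x \<in> I" for x using P(1)[OF that] J_def by auto
      show "\<exists>w. {j \<in> {..<v} - P x. \<exists>i\<in>P x. adj i j} \<subseteq> insert w Q" if "x \<in> I" for x
        using P(3)[OF that] unfolding nb_def by blast
      show "2 \<le> card {j \<in> {..<v} - S. \<exists>i\<in>S. adj i j} \<and>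
          \<beta> * card S \<le> card {j \<in> {..<v} - S. \<exists>i\<in>S. adj i j}"
        if "S \<subseteq> {..<v}" "S \<noteq> {}" "2 * card S \<le> card {..<v}" for S
        using exp[of S] that unfolding nb_def by simp
    qed (use i QF beta sym deg P in auto)
    have "{i. i < v \<and> c1 i \<noteq> N \<and> c2 i \<noteq> N} \<subseteq> Q \<union> (\<Union>x\<in>I. P x)"
      using cov unfolding J_def by blast
    moreover have "finite (Q \<union> (\<Union>x\<in>I. P x))"
      by (rule finite_subset[of _ "{..<v}"]) (use QF P(1) J_def in auto)
    ultimately have "card {i. i < v \<and> c1 i \<noteq> N \<and> c2 i \<noteq> N} \<le> card (Q \<union> (\<Union>x\<in>I. P x))"
        by (rule card_mono[rotated])
    also have "\<dots> \<le> card Q + card (\<Union>x\<in>I. P x)" by (rule card_Un_le)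
    finally have "\<beta> * card {i. i < v \<and> c1 i \<noteq> N \<and> c2 i \<noteq> N} \<le> \<beta> * (card Q + card (\<Union>x\<in>I. P x))"
      using beta by (intro mult_left_mono) auto
    also have "\<dots> \<le> card Q + 6 * card Q"
      using s mult_right_mono[of \<beta> 1 "real (card Q)"] beta by (simp add: algebra_simps)
    also have "2 * \<dots> \<le> \<beta> * v" using Q by simp
    finally have "\<beta> * (2 * card {i. i < v \<and> c1 i \<noteq> N \<and> c2 i \<noteq> N}) \<le> \<beta> * v" by simp
    then have "2 * card {i. i < v \<and> c1 i \<noteq> N \<and> c2 i \<noteq> N} \<le> v" using beta by simp
    then show ?thesis by blast
  qed
  have finJ: "finite J" unfolding J_def by simp
  define Big where "Big = {i \<in> J. v < 2 * card (D i)}"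
  show ?thesis
  proof (cases "Big = {}")
    case True
    \<comment> \<open>No edge has a large part below it, so the root class is central and the pieces
      are the parts below its edges. Those edges contain the root class themselves and need not be
      covered.\<close>
    let ?I = "{c \<in> J. old c = c1 0}"
    have cov: "\<exists>c\<in>?I. j \<in> insert c (D c)" if "j \<in> J" for j
      using that
    proof (induction j rule: less_induct)
      case (less j)
      show ?case
      proof (cases "old j = c1 0")
        case True
        then show ?thesis using less by auto
      next
        case False
        have "old j \<in> {c1 j, c2 j}" using on(2) by blast
        then obtain i where i: "i \<in> J" "new i = old j" using born[of "old j" j] False less
            unfolding J_def by auto
        then have ij: "(i, j) \<in> R" using less by (auto simp: R_def)
        then obtain c where "c \<in> ?I" "i \<in> insert c (D c)" using less.IH[of i] Rless i by blast
        then show ?thesis using ij unfolding D_def by (auto intro: trancl_into_trancl)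
      qed
    qed
    show ?thesis
    proof (rule finish[of ?I D "c1 0"])
      show "2 * card (D x) \<le> v" if "x \<in> ?I" for x using that True unfolding Big_def by auto
      show "D x \<inter> D y = {}" if "x \<in> ?I" "y \<in> ?I" "x \<noteq> y" for x y
        using childdisj[of x y] that by auto
      show "j \<in> (\<Union>x\<in>?I. D x)" if "j \<in> J" "c1 j \<noteq> c1 0" "c2 j \<noteq> c1 0" for j
      proof -
        have "old j \<in> {c1 j, c2 j}" using on(2) by blast
        then have "old j \<noteq> c1 0" using that by auto
        then show ?thesis using cov[OF that(1)] by auto
      qed
    qed (use finJ DJ nbD in auto)
  next
    case False
    have finB: "finite Big" unfolding Big_def using finJ by simp
    \<comment> \<open>Descendants have larger indices, so no child of this edge is in
      \<open>Big\<close>; its lower end \<open>new i\<close> is the central class.\<close>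
    define i where "i = Max Big"
    have i: "i \<in> Big" unfolding i_def using Max_in[OF finB False] .
    have imax: "k \<le> i" if "k \<in> Big" for k unfolding i_def using finB that by simp
    let ?I = "insert i {c \<in> J. old c = new i}"
    \<comment> \<open>The piece of index \<open>i\<close> is the part of the tree that is not below
      \<open>i\<close>; the other pieces are the parts below the children of
      \<open>i\<close>.\<close>
    let ?P = "\<lambda>x. if x = i then J - insert i (D i) else D x"
    have iJ: "i \<in> J" using i Big_def by auto
    have ch: "x \<in> D i" "x \<noteq> i" if "x \<in> J" "old x = new i" for x
    proof -
      have "(i, x) \<in> R" using that iJ by (auto simp: R_def)
      then show "x \<in> D i" "x \<noteq> i" unfolding D_def using Rless by auto
    qed
    have chD: "D x \<subseteq> D i" if "x \<in> J" "old x = new i" for x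
      using ch(1)[OF that] unfolding D_def by (auto intro: trancl_trans)
    show ?thesis
    proof (rule finish[of ?I ?P "new i"])
      show "2 * card (?P x) \<le> v" if "x \<in> ?I" for x
      proof (cases "x = i")
        case True
        have "card (J - insert i (D i)) \<le> card ({..<v} - D i)"
            by (rule card_mono) (auto simp: J_def)
        also have "\<dots> = v - card (D i)" using DJ(1)[of i] finite_subset[OF DJ(1)[of i] finJ]
          by (subst card_Diff_subset) (auto simp: J_def)
        finally show ?thesis using i True unfolding Big_def by auto
      next
        case False
        then have "x \<in> J" "old x = new i" using that by auto
        then have "i < x" using ch(1) Rtless unfolding D_def by auto
        then have "x \<notin> Big" using imax by force
        then show ?thesis using False that unfolding Big_def by auto
      qed
      show "nb {..<v} (?P x) \<subseteq> insert x Q" if "x \<in> ?I" for x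
        using nbD nbR by auto
      show "?P x \<inter> ?P y = {}" if "x \<in> ?I" "y \<in> ?I" "x \<noteq> y" for x y
        using childdisj[of x y] that chD by auto
      show "j \<in> (\<Union>x\<in>?I. ?P x)" if "j \<in> J" "c1 j \<noteq> new i" "c2 j \<noteq> new i" for j
      proof (cases "j \<in> insert i (D i)")
        case False
        then show ?thesis using that by auto
      next
        case True
        have jo: "old j \<noteq> new i" "new j \<noteq> new i" using that on(2)[of j]
            by (metis insertCI insertE singletonD)+
        then have "j \<noteq> i" by auto
        then have "(i, j) \<in> R\<^sup>+" using True unfolding D_def by auto
        then obtain c where c: "(i, c) \<in> R" "(c, j) \<in> R\<^sup>*" using tranclD by metis
        then have "c \<in> J" "old c = new i" unfolding R_def by auto
        moreover have "j \<noteq> c" using \<open>old c = new i\<close> jo by auto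
        then have "j \<in> D c" using c unfolding D_def by (metis mem_Collect_eq rtranclD)
        ultimately show ?thesis using ch by auto
      qed
    qed (use finJ DJ in auto)
  qed
qed

section \<open>Random labels on an expander\<close>

lemma card_permutes_restrict_eq:
  assumes "finite V" "W \<subseteq> V"
  shows "card {\<pi>. \<pi> permutes V \<and> restrict \<pi> W = g} \<le> fact (card V - card W)"
proof (cases "\<exists>\<pi>. \<pi> permutes V \<and> restrict \<pi> W = g")
  case True
  then obtain \<pi>0 where p0: "\<pi>0 permutes V" "restrict \<pi>0 W = g" by blast
  let ?A = "{\<pi>. \<pi> permutes V \<and> restrict \<pi> W = g}"
  have inj: "inj_on (\<lambda>\<pi>. inv \<pi>0 \<circ> \<pi>) ?A"
  proof (rule inj_onI)
    fix \<pi> \<pi>' assume "inv \<pi>0 \<circ> \<pi> = inv \<pi>0 \<circ> \<pi>'"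
    then have "\<pi>0 \<circ> (inv \<pi>0 \<circ> \<pi>) = \<pi>0 \<circ> (inv \<pi>0 \<circ> \<pi>')" by simp
    then show "\<pi> = \<pi>'" using permutes_inv_o(1)[OF p0(1)] by (simp add: o_assoc)
  qed
  have "(\<lambda>\<pi>. inv \<pi>0 \<circ> \<pi>) ` ?A \<subseteq> {\<pi>. \<pi> permutes (V - W)}"
  proof
    fix \<tau> assume "\<tau> \<in> (\<lambda>\<pi>. inv \<pi>0 \<circ> \<pi>) ` ?A"
    then obtain \<pi> where pi: "\<pi> permutes V" "restrict \<pi> W = g" "\<tau> = inv \<pi>0 \<circ> \<pi>" by blast
    have "\<tau> permutes V" unfolding pi(3) using permutes_compose[OF pi(1) permutes_inv[OF p0(1)]] .
    moreover have "\<tau> x = x" if "x \<in> W" for x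
    proof -
      have "\<pi> x = \<pi>0 x" using pi(2) p0(2) that by (metis restrict_apply')
      then show ?thesis using permutes_inverses(2)[OF p0(1)] pi(3) by simp
    qed
    ultimately show "\<tau> \<in> {\<pi>. \<pi> permutes (V - W)}"
      unfolding permutes_def by blast
  qed
  then have "card ?A \<le> card {\<pi>. \<pi> permutes (V - W)}"
    by (rule card_inj_on_le[OF inj]) (use assms in \<open>simp add: finite_permutations\<close>)
  also have "\<dots> = fact (card (V - W))" using assms by (intro card_permutations) auto
  also have "card (V - W) = card V - card W" using assms by (meson card_Diff_subset finite_subset)
  finally show ?thesis .
next
  case False
  then have "{\<pi>. \<pi> permutes V \<and> restrict \<pi> W = g} = {}" by blast
  then show ?thesis by (metis card.empty zero_le)
qed

text \<open>As long as at most half of the values are used, \<open>n \<le> 2 * (n - k)\<close>, so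
  each factor of the falling factorial loses at most 2 against \<open>n\<close>.\<close>

lemma power_mult_fact_le:
  fixes n k :: nat
  assumes "2 * k \<le> n"
  shows "n ^ k * fact (n - k) \<le> 2 ^ k * fact n"
  using assms
proof (induction k)
  case (Suc k)
  have "n - k = Suc (n - Suc k)" using Suc.prems by simp
  then have f: "fact (n - k) = (n - k) * fact (n - Suc k)" by (metis fact_Suc of_nat_id)
  have "n ^ Suc k * fact (n - Suc k) = n * (n ^ k * fact (n - Suc k))" by simp
  also have "\<dots> \<le> (2 * (n - k)) * (n ^ k * fact (n - Suc k))" using Suc.prems
      by (intro mult_right_mono) auto
  also have "\<dots> = 2 * (n ^ k * fact (n - k))" unfolding f by simp
  also have "\<dots> \<le> 2 * (2 ^ k * fact n)" using Suc by simp
  finally show ?case by simp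
qed simp

text \<open>Each vertex of \<open>W - D\<close>, whose label is determined by the others, costs a
  factor \<open>1 / card V\<close>: there are at most \<open>card V ^ card D\<close> restrictions to
  \<open>W\<close>, each with \<open>fact (card V - card W)\<close> extensions. All probability
  bounds for labels rest on this count.\<close>

lemma card_determined_permutations:
  assumes "finite V" "D \<subseteq> W" "W \<subseteq> V" "2 * card W \<le> card V"
    and det: "\<And>\<pi> \<pi>'. \<pi> permutes V \<Longrightarrow> \<pi>' permutes V \<Longrightarrow> \<Phi> \<pi> \<Longrightarrow> \<Phi> \<pi>' \<Longrightarrow> (\<And>x. x \<in> D \<Longrightarrow> \<pi> x = \<pi>' x) \<Longrightarrow>
       (\<And>x. x \<in> W \<Longrightarrow> \<pi> x = \<pi>' x)"
  shows "card {\<pi>. \<pi> permutes V \<and> \<Phi> \<pi>} * card V ^ (card W - card D) \<le> 2 ^ card W * fact (card V)"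
proof -
  let ?A = "{\<pi>. \<pi> permutes V \<and> \<Phi> \<pi>}"
  define RR where "RR = (\<lambda>\<pi>. restrict \<pi> W) ` ?A"
  have finA: "finite ?A" using finite_permutations[OF assms(1)] by (rule rev_finite_subset) auto
  have fin: "finite W" "finite D" using assms finite_subset by metis+
  have "card RR \<le> card (D \<rightarrow>\<^sub>E V)"
  proof (rule card_inj_on_le[of "\<lambda>g. restrict g D"])
    show "inj_on (\<lambda>g. restrict g D) RR"
    proof (rule inj_onI)
      fix g g' assume "g \<in> RR" "g' \<in> RR" and eq: "restrict g D = restrict g' D"
      then obtain \<pi> \<pi>' where p: "\<pi> permutes V" "\<Phi> \<pi>" "g = restrict \<pi> W" "\<pi>' permutes V" "\<Phi> \<pi>'" "g' =
          restrict \<pi>' W"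
        unfolding RR_def by blast
      have "\<pi> x = \<pi>' x" if "x \<in> D" for x
        using fun_cong[OF eq, of x] that assms(2) p by (auto simp: subset_iff)
      then have "\<pi> x = \<pi>' x" if "x \<in> W" for x using det[OF p(1,4,2,5)] that by blast
      then show "g = g'" using p by (auto intro!: restrict_ext)
    qed
    show "(\<lambda>g. restrict g D) ` RR \<subseteq> D \<rightarrow>\<^sub>E V"
      unfolding RR_def using assms(2,3) permutes_in_image by (fastforce simp: subset_iff)
    show "finite (D \<rightarrow>\<^sub>E V)" using fin assms by (intro finite_PiE) auto
  qed
  also have "\<dots> = card V ^ card D" using fin by (simp add: card_PiE)
  finally have RR: "card RR \<le> card V ^ card D" .
  have "?A \<subseteq> (\<Union>g\<in>RR. {\<pi>. \<pi> permutes V \<and> restrict \<pi> W = g})" unfolding RR_def by auto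
  then have "card ?A \<le> card (\<Union>g\<in>RR. {\<pi>. \<pi> permutes V \<and> restrict \<pi> W = g})"
    using finA by (intro card_mono finite_UN_I)
      (auto simp: RR_def intro: rev_finite_subset[OF finite_permutations[OF assms(1)]])
  also have "\<dots> \<le> (\<Sum>g\<in>RR. card {\<pi>. \<pi> permutes V \<and> restrict \<pi> W = g})"
    by (rule card_UN_le) (use finA RR_def in auto)
  also have "\<dots> \<le> (\<Sum>g\<in>RR. fact (card V - card W))"
    using card_permutes_restrict_eq[OF assms(1,3)] by (intro sum_mono) auto
  also have "\<dots> \<le> card V ^ card D * fact (card V - card W)" using RR by simp
  finally have "card ?A * card V ^ (card W - card D)
    \<le> (card V ^ card D * fact (card V - card W)) * card V ^ (card W - card D)" by (rule
        mult_right_mono) simp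
  also have "\<dots> = card V ^ card W * fact (card V - card W)"
    using card_mono[OF fin(1) assms(2)]
        by (simp add: power_add[symmetric] algebra_simps flip: power_add)
  also have "\<dots> \<le> 2 ^ card W * fact (card V)" by (rule power_mult_fact_le[OF assms(4)])
  finally show ?thesis .
qed

section \<open>Vertex expanders of maximum degree three\<close>

definition neighbours :: "'a set set \<Rightarrow> 'a set \<Rightarrow> 'a \<Rightarrow> 'a set" where
  "neighbours H F u = {w \<in> F. {u, w} \<in> H}"

definition outer_boundary :: "'a set set \<Rightarrow> 'a set \<Rightarrow> 'a set \<Rightarrow> 'a set" where
  "outer_boundary H F S = {y \<in> F - S. \<exists>u\<in>S. {u, y} \<in> H}"

definition cubic_expander :: "real \<Rightarrow> 'a set set \<Rightarrow> 'a set \<Rightarrow> bool" where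
  "cubic_expander \<beta> H F \<longleftrightarrow> finite F \<and> (\<forall>u\<in>F. card (neighbours H F u) \<le> 3) \<and>
     (\<forall>S\<subseteq>F. S \<noteq> {} \<longrightarrow> 2 * card S \<le> card F \<longrightarrow>
        2 \<le> card (outer_boundary H F S) \<and> \<beta> * card S \<le> card (outer_boundary H F S))"

lemma cubic_expander_expansion:
  fixes \<beta> :: real
  assumes "cubic_expander \<beta> H F" "S \<subseteq> F" "S \<noteq> {}" "2 * card S \<le> card F"
  shows "2 \<le> card (outer_boundary H F S)" "\<beta> * card S \<le> card (outer_boundary H F S)"
  using assms unfolding cubic_expander_def by auto

text \<open>Connectedness in the form needed for inductions along an enumeration. A longest list
  with this property exhausts \<open>F\<close>: otherwise its set or the complement is at most half
  of \<open>F\<close>, and expansion provides an edge between the two.\<close>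

lemma cubic_expander_order:
  assumes "cubic_expander \<beta> H F"
  shows "\<exists>us. distinct us \<and> set us = F \<and> (\<forall>i<length us. 0 < i \<longrightarrow> (\<exists>j<i. {us ! j, us ! i} \<in> H))"
proof -
  have fin: "finite F" using assms cubic_expander_def by blast
  let ?P = "\<lambda>us. distinct us \<and> set us \<subseteq> F \<and> (\<forall>i<length us. 0 < i \<longrightarrow> (\<exists>j<i. {us ! j, us ! i} \<in> H))"
  have b: "\<forall>us. ?P us \<longrightarrow> length us < Suc (card F)"
    using fin by (metis card_mono distinct_card less_Suc_eq_le)
  have "?P []" by simp
  from ex_has_greatest_nat[OF this b] obtain us where us: "?P us" and max: "\<And>us'. ?P us' \<Longrightarrow>
      length us' \<le> length us"
    by blast
  have "set us = F"
  proof (rule ccontr)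
    assume ne: "set us \<noteq> F"
    have "\<exists>y\<in>F - set us. us = [] \<or> (\<exists>u\<in>set us. {u, y} \<in> H)"
    proof (cases "us = []")
      case True
      then show ?thesis using ne us by auto
    next
      case False
      show ?thesis
      proof (cases "2 * card (set us) \<le> card F")
        case True
        then have "2 \<le> card (outer_boundary H F (set us))" using assms us False
            unfolding cubic_expander_def by simp
        then have "outer_boundary H F (set us) \<noteq> {}" by auto
        then show ?thesis unfolding outer_boundary_def by blast
      next
        case False
        have "card (F - set us) = card F - card (set us)" using us fin
            by (simp add: card_Diff_subset)
        then have "2 * card (F - set us) \<le> card F" using False by simp
        moreover have "F - set us \<noteq> {}" using ne us by auto
        ultimately have "2 \<le> card (outer_boundary H F (F - set us))" using assms
            unfolding cubic_expander_def by simp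
        then have "outer_boundary H F (F - set us) \<noteq> {}" by auto
        then obtain x u where "x \<in> F" "x \<in> set us" "{u, x} \<in> H" "u \<in> F - set us"
          unfolding outer_boundary_def by blast
        then show ?thesis by (metis insert_commute)
      qed
    qed
    then obtain y where y: "y \<in> F" "y \<notin> set us" "us = [] \<or> (\<exists>u\<in>set us. {u, y} \<in> H)" by blast
    have "?P (us @ [y])"
    proof (intro conjI allI impI)
      fix i assume i: "i < length (us @ [y])" "0 < i"
      show "\<exists>j<i. {(us @ [y]) ! j, (us @ [y]) ! i} \<in> H"
      proof (cases "i < length us")
        case True
        then obtain j where "j < i" "{us ! j, us ! i} \<in> H" using us i by blast
        then show ?thesis using True by (intro exI[of _ j]) (auto simp: nth_append)
      next
        case False
        then have il: "i = length us" using i by simp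
        then obtain u where "u \<in> set us" "{u, y} \<in> H" using y i by auto
        then obtain j where "j < length us" "us ! j = u" by (auto simp: in_set_conv_nth)
        then show ?thesis using il \<open>{u, y} \<in> H\<close> by (intro exI[of _ j]) (auto simp: nth_append)
      qed
    qed (use us y in auto)
    then show False using max[of "us @ [y]"] by simp
  qed
  then show ?thesis using us by blast
qed

section \<open>Two-coloured edges and their classes\<close>

text \<open>
  For a map \<open>h\<close> that preserves the lengths of the edges up to sign, put \<open>a u = h u - \<pi> u\<close>: along
  an edge either \<open>a\<close> or \<open>a + 2 \<pi> = h + \<pi>\<close> is constant. The set \<open>\<sigma>\<close> collects the edges of the
  first kind.
\<close>

definition sign_consistent :: "'a set set \<Rightarrow> 'a set \<Rightarrow> 'a set set \<Rightarrow> ('a \<Rightarrow> real) \<Rightarrow> ('a \<Rightarrow> real) \<Rightarrow> bool"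
    where
  "sign_consistent H F \<sigma> f a \<longleftrightarrow> (\<forall>u\<in>F. \<forall>w\<in>F. {u, w} \<in> H \<longrightarrow>
     (if {u, w} \<in> \<sigma> then a u = a w else a u + 2 * f u = a w + 2 * f w))"

text \<open>The component of \<open>u\<close> in the graph of the edges of colour \<open>s\<close>.
  The tag \<open>s\<close> keeps the classes of the two colours apart, as
  \<open>central_class\<close> demands.\<close>

definition sign_class :: "'a set set \<Rightarrow> 'a set \<Rightarrow> 'a set set \<Rightarrow> bool \<Rightarrow> 'a \<Rightarrow> bool \<times> 'a set" where
  "sign_class H F \<sigma> s u = (s, {(u, w). u \<in> F \<and> w \<in> F \<and> {u, w} \<in> H \<and> ({u, w} \<in> \<sigma> \<longleftrightarrow> s)}\<^sup>* `` {u})"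

lemma sign_class_edge:
  assumes "u \<in> F" "w \<in> F" "{u, w} \<in> H" "{u, w} \<in> \<sigma> \<longleftrightarrow> s"
  shows "sign_class H F \<sigma> s u = sign_class H F \<sigma> s w"
proof -
  define r where "r = {(u, w). u \<in> F \<and> w \<in> F \<and> {u, w} \<in> H \<and> ({u, w} \<in> \<sigma> \<longleftrightarrow> s)}"
  have "(u, w) \<in> r" "(w, u) \<in> r" using assms by (auto simp: r_def insert_commute)
  then have "r\<^sup>* `` {u} = r\<^sup>* `` {w}" by (auto intro: converse_rtrancl_into_rtrancl)
  then show ?thesis by (simp add: sign_class_def r_def)
qed

lemma sign_class_const:
  assumes "\<And>u w. u \<in> F \<Longrightarrow> w \<in> F \<Longrightarrow> {u, w} \<in> H \<Longrightarrow> ({u, w} \<in> \<sigma> \<longleftrightarrow> s) \<Longrightarrow> \<phi> u = \<phi> w"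
    and "sign_class H F \<sigma> s u = sign_class H F \<sigma> s w"
  shows "\<phi> u = \<phi> w"
proof -
  define r where "r = {(u, w). u \<in> F \<and> w \<in> F \<and> {u, w} \<in> H \<and> ({u, w} \<in> \<sigma> \<longleftrightarrow> s)}"
  have "w \<in> r\<^sup>* `` {w}" by simp
  then have "(u, w) \<in> r\<^sup>*" using assms(2) by (simp add: sign_class_def r_def) blast
  then show ?thesis
    by (induction rule: rtrancl_induct) (use assms(1) in \<open>auto simp: r_def\<close>)
qed

lemma sign_class_ne: "sign_class H F \<sigma> True u \<noteq> sign_class H F \<sigma> False w"
  by (simp add: sign_class_def)

text \<open>
  Adding the vertices in the order \<open>us\<close> as edges between their two classes, exactly those in
  \<open>excess\<close> close a cycle; their labels are determined by the labels of the other vertices.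
\<close>

definition excess :: "'a set set \<Rightarrow> 'a set \<Rightarrow> 'a list \<Rightarrow> 'a set set \<Rightarrow> nat set" where
  "excess H F us \<sigma> = {i. 0 < i \<and> i < length us \<and>
     (\<exists>j<i. sign_class H F \<sigma> True (us ! j) = sign_class H F \<sigma> True (us ! i)) \<and>
     (\<exists>j<i. sign_class H F \<sigma> False (us ! j) = sign_class H F \<sigma> False (us ! i))}"

text \<open>Compare two solutions: \<open>da\<close> is constant on classes of the first colour,
  \<open>db\<close> on those of the second, and the labels at a vertex agree iff
  \<open>da = db\<close> there. Along \<open>us\<close>, a vertex outside the excess inherits one of
  the two values over an edge and the other from equality of its labels; an excess vertex inherits
  both from earlier members of its classes. So \<open>da\<close> and \<open>db\<close> are equal to
  one constant everywhere.\<close>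

lemma sign_consistent_determined:
  assumes us: "distinct us" "set us = F" "\<forall>i<length us. 0 < i \<longrightarrow> (\<exists>j<i. {us ! j, us ! i} \<in> H)"
    and cons: "sign_consistent H F \<sigma> f a" "sign_consistent H F \<sigma> f' a'"
    and eq: "\<And>i. i < length us \<Longrightarrow> i \<notin> excess H F us \<sigma> \<Longrightarrow> f (us ! i) = f' (us ! i)"
    and "x \<in> F"
  shows "f x = f' x"
proof -
  define da where "da u = a' u - a u" for u
  define db where "db u = (a' u + 2 * f' u) - (a u + 2 * f u)" for u
  have ca: "da u = da w" if "sign_class H F \<sigma> True u = sign_class H F \<sigma> True w" for u w
    by (rule sign_class_const[OF _ that]) (use cons in \<open>auto simp: sign_consistent_def da_def\<close>)
  have cb: "db u = db w" if "sign_class H F \<sigma> False u = sign_class H F \<sigma> False w" for u w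
    by (rule sign_class_const[OF _ that]) (use cons in \<open>auto simp: sign_consistent_def db_def\<close>)
  have same: "da (us ! i) = db (us ! i)" if "i < length us" "i \<notin> excess H F us \<sigma>" for i
    using eq[OF that] by (simp add: da_def db_def)
  have main: "da (us ! i) = da (us ! 0) \<and> db (us ! i) = da (us ! 0)" if "i < length us" for i
    using that
  proof (induction i rule: less_induct)
    case (less i)
    show ?case
    proof (cases "i = 0")
      case True
      then show ?thesis using same[of 0] less by (auto simp: excess_def)
    next
      case i0: False
      show ?thesis
      proof (cases "i \<in> excess H F us \<sigma>")
        case True
        then obtain j k where "j < i" "sign_class H F \<sigma> True (us ! j) =
            sign_class H F \<sigma> True (us ! i)"
          "k < i" "sign_class H F \<sigma> False (us ! k) = sign_class H F \<sigma> False (us ! i)"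
              unfolding excess_def by auto
        then show ?thesis using ca cb less by (metis less_trans)
      next
        case False
        obtain j where j: "j < i" "{us ! j, us ! i} \<in> H" using us(3) less.prems i0 by auto
        have jF: "us ! j \<in> F" "us ! i \<in> F" using j less.prems us(2) by auto
        have "da (us ! j) = da (us ! i) \<or> db (us ! j) = db (us ! i)"
          using sign_class_edge[OF jF j(2), of \<sigma> True] sign_class_edge[OF jF j(2), of \<sigma> False] ca cb
              by metis
        then show ?thesis using same[OF less.prems False] less.IH[OF j(1)] j less.prems by auto
      qed
    qed
  qed
  obtain i where "i < length us" "us ! i = x" using \<open>x \<in> F\<close> us(2) by (metis in_set_conv_nth)
  then show ?thesis using main[of i] by (simp add: da_def db_def)
qed

lemma card_sign_consistent:
  assumes V: "finite V" "F \<subseteq> V" "2 * card F \<le> card V"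
    and us: "distinct us" "set us = F" "\<forall>i<length us. 0 < i \<longrightarrow> (\<exists>j<i. {us ! j, us ! i} \<in> H)"
  shows "card {\<pi>. \<pi> permutes V \<and> (\<exists>a. sign_consistent H F \<sigma> \<pi> a)} * card V ^ card (excess H F us \<sigma>)
     \<le> 2 ^ card F * fact (card V)"
proof -
  let ?Q = "excess H F us \<sigma>"
  let ?QF = "(!) us ` ?Q"
  have Q: "?Q \<subseteq> {..<length us}" by (auto simp: excess_def)
  have inj: "inj_on ((!) us) ?Q" using us(1) Q
      by (auto simp: inj_on_def nth_eq_iff_index_eq subset_iff)
  then have cQ: "card ?QF = card ?Q" by (rule card_image)
  have QF: "?QF \<subseteq> F" using Q us(2) by auto
  have finF: "finite F" using us(2) by auto
  have "card F - card (F - ?QF) = card ?Q"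
    using card_Diff_subset[of ?QF F] QF finF cQ card_mono[OF finF QF] finite_subset[OF QF finF]
        by simp
  moreover have "card {\<pi>. \<pi> permutes V \<and>
      (\<exists>a. sign_consistent H F \<sigma> \<pi> a)} * card V ^ (card F - card (F - ?QF))
     \<le> 2 ^ card F * fact (card V)"
  proof (rule card_determined_permutations[OF V(1) _ V(2,3)])
    fix \<pi> \<pi>' x assume c: "\<exists>a. sign_consistent H F \<sigma> \<pi> a" "\<exists>a. sign_consistent H F \<sigma> \<pi>' a"
      and e: "\<And>x. x \<in> F - ?QF \<Longrightarrow> \<pi> x = \<pi>' x" and x: "x \<in> F"
    have "\<pi> (us ! i) = \<pi>' (us ! i)" if "i < length us" "i \<notin> ?Q" for i
    proof (rule e)
      have "us ! i \<notin> ?QF" using that Q us(1) by (auto simp: nth_eq_iff_index_eq subset_iff)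
      then show "us ! i \<in> F - ?QF" using that us(2) by auto
    qed
    then show "\<pi> x = \<pi>' x" using sign_consistent_determined[OF us _ _ _ x] c by metis
  qed auto
  ultimately show ?thesis by simp
qed

text \<open>Transfer of \<open>central_class\<close> along the enumeration \<open>us\<close>; the
  tag of the class found tells which colour \<open>s\<close> it belongs to.\<close>

lemma sign_central_class:
  fixes \<beta> :: real
  assumes core: "cubic_expander \<beta> H F" "0 < \<beta>" "\<beta> \<le> 1"
    and us: "distinct us" "set us = F" "\<forall>i<length us. 0 < i \<longrightarrow> (\<exists>j<i. {us ! j, us ! i} \<in> H)"
    and Q: "14 * card (excess H F us \<sigma>) \<le> \<beta> * card F"
  shows "\<exists>s c. 2 * card {u \<in> F. sign_class H F \<sigma> s u \<noteq> c} \<le> card F"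
proof -
  let ?v = "length us"
  define adj where "adj i j \<longleftrightarrow> {us ! i, us ! j} \<in> H" for i j
  have v: "card F = ?v" using us distinct_card by fastforce
  have img: "inj_on ((!) us) S" if "S \<subseteq> {..<?v}" for S
    using us(1) that by (auto simp: inj_on_def nth_eq_iff_index_eq subset_iff)
  have full: "(!) us ` {..<?v} = F" using us(2) by (auto simp: in_set_conv_nth)
  let ?c1 = "\<lambda>i. sign_class H F \<sigma> True (us ! i)" and ?c2 = "\<lambda>i. sign_class H F \<sigma> False (us ! i)"
  have "\<exists>c. 2 * card {i. i < ?v \<and> ?c1 i \<noteq> c \<and> ?c2 i \<noteq> c} \<le> ?v"
  proof (rule central_class[where \<beta> = \<beta> and adj = adj])
    show "?c1 i = ?c1 j \<or> ?c2 i = ?c2 j" if "i < ?v" "j < ?v" "adj i j" for i j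
    proof -
      have uF: "us ! i \<in> F" "us ! j \<in> F" using that us(2) by auto
      show ?thesis using sign_class_edge[OF uF, of H \<sigma> True] sign_class_edge[OF uF,
          of H \<sigma> False] that
        unfolding adj_def by blast
    qed
    show "\<exists>j<i. adj i j" if "0 < i" "i < ?v" for i
    proof -
      obtain j where "j < i" "{us ! j, us ! i} \<in> H" using us(3) \<open>0 < i\<close> \<open>i < ?v\<close> by blast
      then show ?thesis unfolding adj_def by (metis insert_commute)
    qed
    show "card {j \<in> {..<?v}. adj i j} \<le> 3" if "i < ?v" for i
    proof -
      have "(!) us ` {j \<in> {..<?v}. adj i j} = neighbours H F (us ! i)"
        unfolding neighbours_def adj_def using full by (auto simp: image_iff)
      then have "card {j \<in> {..<?v}. adj i j} = card (neighbours H F (us ! i))"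
        using card_image[OF img[of "{j \<in> {..<?v}. adj i j}"]]
            by (metis (no_types, lifting) mem_Collect_eq subsetI)
      then show ?thesis using core(1) that us(2) unfolding cubic_expander_def by auto
    qed
    show "2 \<le> card {j \<in> {..<?v} - S. \<exists>i\<in>S. adj i j} \<and>
       \<beta> * card S \<le> card {j \<in> {..<?v} - S. \<exists>i\<in>S. adj i j}"
      if S: "S \<subseteq> {..<?v}" "S \<noteq> {}" "2 * card S \<le> ?v" for S
    proof -
      let ?S = "(!) us ` S"
      have cS: "card ?S = card S" using img[OF S(1)] by (rule card_image)
      have "(!) us ` {j \<in> {..<?v} - S. \<exists>i\<in>S. adj i j} = outer_boundary H F ?S"
      proof (intro equalityI subsetI)
        fix y assume "y \<in> (!) us ` {j \<in> {..<?v} - S. \<exists>i\<in>S. adj i j}"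
        then obtain j i where "y = us ! j" "j < ?v" "j \<notin> S" "i \<in> S" "adj i j" by auto
        moreover then have "us ! j \<notin> ?S" using us(1) S(1)
            by (auto simp: nth_eq_iff_index_eq subset_iff)
        ultimately show "y \<in> outer_boundary H F ?S" using full
            by (auto simp: outer_boundary_def adj_def)
      next
        fix y assume "y \<in> outer_boundary H F ?S"
        then obtain i where "y \<in> F" "y \<notin> ?S" "i \<in> S" "{us ! i, y} \<in> H"
            by (auto simp: outer_boundary_def)
        moreover then obtain j where "y = us ! j" "j < ?v" using full by auto
        ultimately show "y \<in> (!) us ` {j \<in> {..<?v} - S. \<exists>i\<in>S. adj i j}" by (auto simp: adj_def)
      qed
      moreover have "{j \<in> {..<?v} - S. \<exists>i\<in>S. adj i j} \<subseteq> {..<?v}" by auto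
      ultimately have "card {j \<in> {..<?v} - S. \<exists>i\<in>S. adj i j} = card (outer_boundary H F ?S)"
        using card_image[OF img] by metis
      moreover have "?S \<subseteq> F" "?S \<noteq> {}" using S full by auto
      ultimately show ?thesis using cubic_expander_expansion[OF core(1), of ?S] S(3) v cS by simp
    qed
    show "14 * card {i. 0 < i \<and> i < ?v \<and> (\<exists>j<i. ?c1 j = ?c1 i) \<and> (\<exists>j<i. ?c2 j = ?c2 i)} \<le> \<beta> * ?v"
      using Q v unfolding excess_def by simp
    show "adj j i" if "adj i j" for i j using that unfolding adj_def by (metis insert_commute)
  qed (use core in \<open>auto simp: sign_class_ne\<close>)
  then obtain c where c: "2 * card {i. i < ?v \<and> ?c1 i \<noteq> c \<and> ?c2 i \<noteq> c} \<le> ?v" by blast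
  define s where "s = fst c"
  have "{u \<in> F. sign_class H F \<sigma> s u \<noteq> c} \<subseteq> (!) us ` {i. i < ?v \<and> ?c1 i \<noteq> c \<and> ?c2 i \<noteq> c}"
  proof
    fix u assume u: "u \<in> {u \<in> F. sign_class H F \<sigma> s u \<noteq> c}"
    then obtain i where i: "i < ?v" "u = us ! i" using us(2) by (auto simp: in_set_conv_nth)
    have "fst (sign_class H F \<sigma> (\<not> s) u) \<noteq> fst c" unfolding s_def sign_class_def by simp
    then have "sign_class H F \<sigma> (\<not> s) u \<noteq> c" by blast
    then have "?c1 i \<noteq> c \<and> ?c2 i \<noteq> c" using u i by (cases s) auto
    then show "u \<in> (!) us ` {i. i < ?v \<and> ?c1 i \<noteq> c \<and> ?c2 i \<noteq> c}" using i by auto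
  qed
  then have "card {u \<in> F. sign_class H F \<sigma> s u \<noteq> c} \<le> card {i. i < ?v \<and> ?c1 i \<noteq> c \<and> ?c2 i \<noteq> c}"
    by (rule surj_card_le[rotated]) simp
  then have "2 * card {u \<in> F. sign_class H F \<sigma> s u \<noteq> c} \<le> card F" using c v by simp
  then show ?thesis by blast
qed

section \<open>Walks covering connected sets\<close>

primrec walks :: "('a \<Rightarrow> 'a set) \<Rightarrow> nat \<Rightarrow> 'a \<Rightarrow> 'a list set" where
  "walks nb 0 z = {[z]}"
| "walks nb (Suc k) z = (\<Union>u\<in>nb z. (#) z ` walks nb k u)"

lemma walks_props:
  assumes "ws \<in> walks nb k z" "\<And>u. u \<in> F \<Longrightarrow> nb u \<subseteq> F" "z \<in> F"
  shows "length ws = Suc k" "ws \<noteq> []" "hd ws = z" "set ws \<subseteq> F"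
proof -
  have "length ws = Suc k \<and> ws \<noteq> [] \<and> hd ws = z \<and> set ws \<subseteq> F"
    using assms(1,3)
  proof (induction k arbitrary: ws z)
    case (Suc k)
    then obtain u ws' where u: "u \<in> nb z" "ws' \<in> walks nb k u" "ws = z # ws'" by auto
    then show ?case using Suc.IH[of ws' u] assms(2) Suc.prems by auto
  qed auto
  then show "length ws = Suc k" "ws \<noteq> []" "hd ws = z" "set ws \<subseteq> F" by auto
qed

lemma card_walks:
  assumes "finite F" "\<And>u. u \<in> F \<Longrightarrow> nb u \<subseteq> F" "\<And>u. u \<in> F \<Longrightarrow> card (nb u) \<le> d" "z \<in> F"
  shows "finite (walks nb k z) \<and> card (walks nb k z) \<le> d ^ k"
  using assms(4)
proof (induction k arbitrary: z)
  case (Suc k)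
  have fin: "finite (nb z)" using assms Suc.prems finite_subset by metis
  have IH: "finite (walks nb k u) \<and> card (walks nb k u) \<le> d ^ k" if "u \<in> nb z" for u
    using Suc that assms(2) by blast
  have "card (walks nb (Suc k) z) \<le> (\<Sum>u\<in>nb z. card ((#) z ` walks nb k u))"
    using fin by (simp add: card_UN_le)
  also have "\<dots> \<le> (\<Sum>u\<in>nb z. d ^ k)"
    by (rule sum_mono) (use IH card_image_le le_trans in blast)
  also have "\<dots> \<le> d * d ^ k" using assms(3)[OF Suc.prems] by simp
  finally show ?case using fin IH by auto
qed simp

text \<open>A detour \<open>u\<close>, \<open>y\<close>, \<open>u\<close> at the first visit to
  \<open>u\<close> costs two steps. This is why a set of \<open>k + 1\<close> vertices is paired
  with walks of \<open>2 * k\<close> steps.\<close>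

lemma walks_extend:
  assumes "ws \<in> walks nb k z" "u \<in> set ws" "y \<in> nb u" "\<And>u y. y \<in> nb u \<Longrightarrow> u \<in> F \<Longrightarrow> u \<in> nb y"
    "z \<in> F" "\<And>u. u \<in> F \<Longrightarrow> nb u \<subseteq> F"
  shows "\<exists>ws'\<in>walks nb (Suc (Suc k)) z. set ws' = insert y (set ws)"
  using assms(1,2,5)
proof (induction k arbitrary: ws z)
  case 0
  then have "z \<in> nb y" using assms(3,4) by auto
  then show ?case using 0 assms(3) by (intro bexI[of _ "[z, y, z]"]) auto
next
  case (Suc k)
  then obtain x ws' where x: "x \<in> nb z" "ws' \<in> walks nb k x" "ws = z # ws'" by auto
  show ?case
  proof (cases "u = z")
    case True
    then have "z \<in> nb y" using assms(3,4) Suc by auto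
    then have "y # ws \<in> walks nb (Suc (Suc k)) y" using Suc.prems(1)
        unfolding walks.simps(2)[of nb "Suc k"] by blast
    then have "z # y # ws \<in> walks nb (Suc (Suc (Suc k))) z"
      using True assms(3) unfolding walks.simps(2)[of nb "Suc (Suc k)"] by blast
    then show ?thesis using x by (intro bexI[of _ "z # y # ws"]) auto
  next
    case False
    then have "u \<in> set ws'" "x \<in> F" using Suc.prems x assms(6) by auto
    then obtain ws'' where "ws'' \<in> walks nb (Suc (Suc k)) x" "set ws'' = insert y (set ws')"
      using Suc.IH[OF x(2)] by blast
    then have "z # ws'' \<in> walks nb (Suc (Suc (Suc k))) z" "set (z # ws'') = insert y (set ws)"
      using x unfolding walks.simps(2)[of nb "Suc (Suc k)"] by (blast, simp add: insert_commute)
    then show ?thesis by blast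
  qed
qed

text \<open>The colours are attached to the steps of the walk and not to edges, so the colourings to
  be counted are just boolean lists.\<close>

fun walk_consistent :: "('a \<Rightarrow> real) \<Rightarrow> ('a \<Rightarrow> real) \<Rightarrow> 'a list \<Rightarrow> bool list \<Rightarrow> bool" where
  "walk_consistent f a (x # y # ws) (s # ss) \<longleftrightarrow>
     (if s then a x = a y else a x + 2 * f x = a y + 2 * f y) \<and> walk_consistent f a (y # ws) ss"
| "walk_consistent f a ws ss \<longleftrightarrow> True"

text \<open>If the labels agree, both kinds of step give the same equation for the difference
  \<open>a' - a\<close>, which is therefore constant along the walk.\<close>

lemma walk_consistent_shift:
  assumes "walk_consistent f a ws ss" "walk_consistent f' a' ws ss" "length ws = Suc (length ss)"
    and "\<And>u. u \<in> set ws \<Longrightarrow> f u = f' u"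
  shows "u \<in> set ws \<Longrightarrow> a' u - a u = a' (hd ws) - a (hd ws)"
  using assms
proof (induction f a ws ss rule: walk_consistent.induct)
  case (1 f a x y ws s ss)
  have "a' y - a y = a' x - a x"
    using 1(3,4) 1(6)[of x] 1(6)[of y] by (auto split: if_splits)
  moreover have "a' u - a u = a' y - a y" if "u \<in> set (y # ws)"
    using 1(1)[OF that] 1 by auto
  ultimately show ?case using 1(2) by auto
next
  case ("2_3" f a ws)
  then show ?case by (cases ws) auto
qed auto

lemma walk_consistent_exists:
  assumes "ws \<in> walks nb k z"
    and "\<And>u w. u \<in> set ws \<Longrightarrow> w \<in> set ws \<Longrightarrow> w \<in> nb u \<Longrightarrow> a u = a w \<or> a u + 2 * f u = a w + 2 * f w"
  shows "\<exists>ss. length ss = k \<and> walk_consistent f a ws ss"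
  using assms
proof (induction k arbitrary: ws z)
  case (Suc k)
  then obtain x ws' where x: "x \<in> nb z" "ws' \<in> walks nb k x" "ws = z # ws'" by auto
  then obtain ss where ss: "length ss = k" "walk_consistent f a ws' ss"
    using Suc.IH[OF x(2)] Suc.prems by force
  obtain ws'' where ws'': "ws' = x # ws''" using x(2) by (cases k) auto
  have "a z = a x \<or> a z + 2 * f z = a x + 2 * f x" using Suc.prems(2)[of z x] x ws'' by auto
  then have "walk_consistent f a ws ((a z = a x) # ss)" using x ws'' ss by auto
  then show ?case using ss by (intro exI[of _ "(a z = a x) # ss"]) simp
qed auto

text \<open>
  Here \<open>a = h - \<pi>\<close> is normalised to vanish on the central class, which contains the outer neighbours
  \<open>y\<close> of the walk; edges to them have the other colour, so \<open>h + \<pi>\<close> has the same value \<open>2 \<pi> y\<close> at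
  both ends. A connected set of \<open>k + 1\<close> vertices is covered by a walk of length \<open>2 k\<close>.
\<close>

definition walk_flexible :: "'a set set \<Rightarrow> 'a set \<Rightarrow> 'a list \<Rightarrow> bool list \<Rightarrow> ('a \<Rightarrow> real) \<Rightarrow> bool" where
  "walk_flexible H F ws ss f \<longleftrightarrow> (\<exists>a. walk_consistent f a ws ss \<and>
     (\<forall>u\<in>set ws. \<forall>y\<in>outer_boundary H F (set ws). {u, y} \<in> H \<longrightarrow> a u + 2 * f u = 2 * f y))"

definition flexible :: "'a set set \<Rightarrow> 'a set \<Rightarrow> ('a \<Rightarrow> real) \<Rightarrow> 'a set" where
  "flexible H F f = {z \<in> F. \<exists>k ws ss. ws \<in> walks (neighbours H F) (2 * k) z \<and> card (set ws) =
      Suc k \<and>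
      2 * Suc k \<le> card F \<and> length ss = 2 * k \<and> walk_flexible H F ws ss f}"

text \<open>The labels on the walk leave one free shift of \<open>a\<close>. The label of a single
  outer neighbour \<open>y0\<close> fixes it, and then all other outer neighbours are determined:
  \<open>d\<close> outer neighbours give \<open>d - 1\<close> relations.\<close>

lemma walk_flexible_determined:
  assumes "walk_flexible H F ws ss f" "walk_flexible H F ws ss f'" "length ws = Suc (length ss)"
    and y0: "y0 \<in> outer_boundary H F (set ws)"
    and eq: "\<And>u. u \<in> insert y0 (set ws) \<Longrightarrow> f u = f' u"
    and x: "x \<in> set ws \<union> outer_boundary H F (set ws)"
  shows "f x = f' x"
proof (cases "x \<in> set ws")
  case False
  then have xb: "x \<in> outer_boundary H F (set ws)" using x by auto
  obtain a a' where a: "walk_consistent f a ws ss"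
      "\<And>u y. u \<in> set ws \<Longrightarrow> y \<in> outer_boundary H F (set ws) \<Longrightarrow> {u, y} \<in> H \<Longrightarrow> a u + 2 * f u = 2 * f y"
    and a': "walk_consistent f' a' ws ss"
      "\<And>u y. u \<in> set ws \<Longrightarrow> y \<in> outer_boundary H F (set ws) \<Longrightarrow> {u, y} \<in> H \<Longrightarrow> a' u + 2 * f' u = 2 * f' y"
    using assms(1,2) unfolding walk_flexible_def by blast
  have sh: "a' u - a u = a' (hd ws) - a (hd ws)" if "u \<in> set ws" for u
    by (rule walk_consistent_shift[OF a(1) a'(1) assms(3) _ that]) (use eq in auto)
  obtain u0 where u0: "u0 \<in> set ws" "{u0, y0} \<in> H" using y0 unfolding outer_boundary_def by auto
  obtain u where u: "u \<in> set ws" "{u, x} \<in> H" using xb unfolding outer_boundary_def by auto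
  have "a u0 = a' u0" using a(2)[OF u0(1) y0 u0(2)] a'(2)[OF u0(1) y0 u0(2)] eq[of u0] eq[of y0] u0
      by auto
  then have "a u = a' u" using sh[OF u0(1)] sh[OF u(1)] by simp
  then show ?thesis using a(2)[OF u(1) xb u(2)] a'(2)[OF u(1) xb u(2)] eq[of u] u by auto
qed (use eq in auto)

lemma card_walk_flexible:
  assumes V: "finite V" "F \<subseteq> V" "2 * card F \<le> card V" and ws: "set ws \<subseteq> F" "length ws =
      Suc (length ss)"
    and b: "1 \<le> card (outer_boundary H F (set ws))"
  shows "card {\<pi>. \<pi> permutes V \<and>
      walk_flexible H F ws ss \<pi>} * card V ^ (card (outer_boundary H F (set ws)) - 1)
     \<le> 2 ^ (card (set ws) + card (outer_boundary H F (set ws))) * fact (card V)"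
proof -
  let ?B = "outer_boundary H F (set ws)"
  obtain y0 where y0: "y0 \<in> ?B" using b by fastforce
  have finF: "finite F" using V finite_subset by blast
  have B: "?B \<subseteq> F" "set ws \<inter> ?B = {}" by (auto simp: outer_boundary_def)
  have finB: "finite ?B" using B finF finite_subset by blast
  have cU: "card (set ws \<union> ?B) = card (set ws) + card ?B" using B finB
      by (simp add: card_Un_disjoint)
  have cI: "card (insert y0 (set ws)) = Suc (card (set ws))" using y0 B
      by (subst card_insert_disjoint) auto
  have "card (set ws \<union> ?B) \<le> card F" using B ws finF by (intro card_mono) auto
  then have "card {\<pi>. \<pi> permutes V \<and> walk_flexible H F ws ss \<pi>} *
      card V ^ (card (set ws \<union> ?B) - card (insert y0 (set ws))) \<le>
          2 ^ card (set ws \<union> ?B) * fact (card V)"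
  proof (intro card_determined_permutations)
    show "\<pi> x = \<pi>' x" if "walk_flexible H F ws ss \<pi>" "walk_flexible H F ws ss \<pi>'"
      "\<And>x. x \<in> insert y0 (set ws) \<Longrightarrow> \<pi> x = \<pi>' x" "x \<in> set ws \<union> ?B" for \<pi> \<pi>' x
      using walk_flexible_determined[OF that(1,2) ws(2) y0 that(3,4)] .
  qed (use V y0 ws B in auto)
  then show ?thesis unfolding cU cI by simp
qed

text \<open>A vertex outside the central class lies in a maximal connected set outside it, whose
  outer neighbours are all central. The edges leaving the set have the other colour, since an edge
  of colour \<open>s\<close> would put both ends in one class; so the set certifies that the vertex
  is flexible. On the central class \<open>h - f\<close> or \<open>h + f\<close> is
  constant.\<close>

lemma rigid_of_central_class:
  assumes core: "cubic_expander \<beta> H F"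
    and central: "2 * card {u \<in> F. sign_class H F \<sigma> s u \<noteq> c} \<le> card F"
    and h: "\<And>u w. u \<in> F \<Longrightarrow> w \<in> F \<Longrightarrow> {u, w} \<in> H \<Longrightarrow> \<bar>h u - h w\<bar> = \<bar>f u - f w\<bar>"
    and sigma: "\<sigma> = {{u, w} | u w. u \<in> F \<and> w \<in> F \<and> {u, w} \<in> H \<and> h u - f u = h w - f w}"
    and u: "u \<in> F - flexible H F f" and w: "w \<in> F - flexible H F f"
  shows "\<bar>h u - h w\<bar> = \<bar>f u - f w\<bar>"
proof -
  let ?A = "{u \<in> F. sign_class H F \<sigma> s u = c}"
  have fin: "finite F" and nbF: "\<And>u. neighbours H F u \<subseteq> F" and nbsym: "\<And>u y. y \<in> neighbours H F u \<Longrightarrow>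
      u \<in> F \<Longrightarrow> u \<in> neighbours H F y"
    using core by (auto simp: cubic_expander_def neighbours_def insert_commute)
  \<comment> \<open>Replacing \<open>h\<close> by \<open>- h\<close> exchanges the two colours; the
    sign reduces both values of \<open>s\<close> to one case.\<close>
  define \<theta> where "\<theta> = (if s then 1 else - 1 :: real)"
  have sg: "h u - f u = h w - f w" if "{u, w} \<in> \<sigma>" for u w
    using that unfolding sigma by (auto simp: doubleton_eq_iff)
  have nsg: "h u - f u \<noteq> h w - f w \<and> h u + f u = h w + f w" if "u \<in> F" "w \<in> F" "{u, w} \<in> H"
      "{u, w} \<notin> \<sigma>" for u w
  proof -
    have ne: "h u - f u \<noteq> h w - f w" using that unfolding sigma by blast
    then show ?thesis using h[OF that(1-3)] by (auto simp: abs_if split: if_splits)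
  qed
  define \<phi> where "\<phi> u = \<theta> * h u - f u" for u
  define \<psi> where "\<psi> u = \<theta> * h u + f u" for u
  have inside: "\<phi> u = \<phi> w" if "u \<in> F" "w \<in> F" "{u, w} \<in> H" "{u, w} \<in> \<sigma> \<longleftrightarrow> s" for u w
    using sg[of u w] nsg[of u w] that unfolding \<phi>_def \<theta>_def by (cases s) auto
  have across: "\<psi> u = \<psi> w" if "u \<in> F" "w \<in> F" "{u, w} \<in> H" "\<not> ({u, w} \<in> \<sigma> \<longleftrightarrow> s)" for u w
    using sg[of u w] nsg[of u w] that unfolding \<psi>_def \<theta>_def by (cases s) auto
  have const: "\<phi> u = \<phi> w" if "u \<in> ?A" "w \<in> ?A" for u w
    by (rule sign_class_const[of F H \<sigma> s, OF inside]) (use that in auto)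
  have inA: "z \<in> ?A" if z: "z \<in> F - flexible H F f" for z
  proof (rule ccontr)
    assume "z \<notin> ?A"
    let ?R = "{u \<in> F. sign_class H F \<sigma> s u \<noteq> c}"
    have zR: "z \<in> ?R" using z \<open>z \<notin> ?A\<close> by auto
    let ?P = "\<lambda>k. \<exists>ws\<in>walks (neighbours H F) (2 * k) z. set ws \<subseteq> ?R \<and> card (set ws) = Suc k"
    have P0: "?P 0" using zR by simp
    have b: "\<And>k. ?P k \<Longrightarrow> k \<le> card F"
    proof -
      fix k assume "?P k"
      then obtain ws where "set ws \<subseteq> F" "card (set ws) = Suc k" by auto
      then show "k \<le> card F" using card_mono[OF fin, of "set ws"] by simp
    qed
    \<comment> \<open>Maximality is taken among the sets covered by a walk from \<open>z\<close>, so
      the walk of \<open>2 * k\<close> steps comes with the set.\<close>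
    define k where "k = (GREATEST k. ?P k)"
    have k: "?P k" unfolding k_def by (rule GreatestI_nat[of ?P, OF P0 b])
    have max: "k' \<le> k" if "?P k'" for k' unfolding k_def by (rule Greatest_le_nat[of ?P, OF that b])
    obtain ws where ws: "ws \<in> walks (neighbours H F) (2 * k) z" "set ws \<subseteq> ?R" "card (set ws) =
        Suc k"
      using k by blast
    have bA: "outer_boundary H F (set ws) \<subseteq> ?A"
    proof
      fix y assume y: "y \<in> outer_boundary H F (set ws)"
      then obtain u where u: "u \<in> set ws" "{u, y} \<in> H" "y \<in> F" "y \<notin> set ws"
          unfolding outer_boundary_def by auto
      show "y \<in> ?A"
      proof (rule ccontr)
        assume "y \<notin> ?A"
        then have yR: "y \<in> ?R" using u by auto
        have "y \<in> neighbours H F u" using u by (auto simp: neighbours_def)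
        moreover have "z \<in> F" using z by auto
        ultimately obtain ws' where "ws' \<in> walks (neighbours H F) (Suc (Suc (2 * k))) z" "set ws' =
            insert y (set ws)"
          using walks_extend[OF ws(1) u(1) _ nbsym _ nbF] by blast
        then have "?P (Suc k)" using ws yR u(4) by (intro bexI[of _ ws']) auto
        then show False using max by fastforce
      qed
    qed
    have "ws \<noteq> []" using ws(3) by auto
    \<comment> \<open>If the central class is empty, any value serves: by \<open>bA\<close> there
      are no outer neighbours to be tested.\<close>
    obtain \<alpha> where al: "\<And>y. y \<in> ?A \<Longrightarrow> \<phi> y = \<alpha>" using const by (cases "?A = {}") blast+
    define a where "a u = \<phi> u - \<alpha>" for u
    have "card (set ws) \<le> card ?R" using ws(2) fin by (intro card_mono) auto
    then have small: "2 * Suc k \<le> card F" using central ws(3) by simp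
    have ed: "a u = a w \<or> a u + 2 * f u = a w + 2 * f w" if "u \<in> set ws" "w \<in> set ws"
        "w \<in> neighbours H F u" for u w
    proof -
      have "u \<in> F" "w \<in> F" "{u, w} \<in> H" using that ws(2) by (auto simp: neighbours_def)
      then show ?thesis using inside[of u w] across[of u w] unfolding a_def \<phi>_def \<psi>_def by argo
    qed
    obtain ss where ss: "length ss = 2 * k" "walk_consistent f a ws ss"
      using walk_consistent_exists[OF ws(1), of a f] ed by blast
    have "a u + 2 * f u = 2 * f y" if "u \<in> set ws" "y \<in> outer_boundary H F (set ws)" "{u, y} \<in> H"
        for u y
    proof -
      have uy: "u \<in> F" "y \<in> F" "y \<in> ?A" "u \<in> ?R" using that ws(2) bA by auto
      then have "\<not> ({u, y} \<in> \<sigma> \<longleftrightarrow> s)" using sign_class_edge[OF uy(1,2) that(3), of \<sigma> s] by auto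
      then have "\<psi> u = \<psi> y" using across uy that(3) by blast
      then show ?thesis using al[OF uy(3)] unfolding a_def \<phi>_def \<psi>_def by simp
    qed
    then have "walk_flexible H F ws ss f" unfolding walk_flexible_def using ss(2) by blast
    then have "z \<in> flexible H F f" unfolding flexible_def using z ws ss(1) small by blast
    then show False using z by simp
  qed
  have "\<phi> u = \<phi> w" using const inA u w by blast
  then show ?thesis unfolding \<phi>_def \<theta>_def by (auto split: if_splits simp: abs_if)
qed

text \<open>The factor \<open>n ^ (d - 1)\<close> gained from \<open>d - 1\<close> relations must
  pay for exponentially many walks and leave one factor \<open>n\<close>. For bounded
  \<open>b\<close> the number \<open>M ^ b\<close> is at most \<open>C\<close> and
  \<open>d \<ge> 2\<close> provides \<open>n\<close>; otherwise
  \<open>d - 2 \<ge> \<beta> * b / 2\<close>, and \<open>M\<close> is below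
  \<open>n powr (\<beta> / 2)\<close>.\<close>

lemma power_tradeoff:
  fixes \<beta> M :: real
  assumes "0 < \<beta>" "1 \<le> M"
  shows "\<exists>C N. 1 \<le> C \<and> (\<forall>n b d :: nat. N \<le> n \<longrightarrow> 2 \<le> d \<longrightarrow> \<beta> * b \<le> d \<longrightarrow> M ^ b * n \<le>
      C * real n ^ (d - 1))"
proof -
  have "filterlim (\<lambda>n::nat. real n powr (\<beta> / 2)) at_top sequentially"
    using assms by real_asymp
  then have "\<forall>\<^sub>F n in sequentially. M \<le> real n powr (\<beta> / 2)" by (simp add: filterlim_at_top)
  then obtain N where N: "\<And>n. N \<le> n \<Longrightarrow> M \<le> real n powr (\<beta> / 2)"
      by (auto simp: eventually_at_top_linorder)
  define C where "C = M powr (4 / \<beta>)"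
  have C1: "1 \<le> C" unfolding C_def using assms by (simp add: ge_one_powr_ge_zero)
  have "M ^ b * n \<le> C * real n ^ (d - 1)" if n: "max 1 N \<le> n" and d: "2 \<le> d" "\<beta> * b \<le> d"
      for n b d :: nat
  proof -
    have n1: "1 \<le> real n" using n by simp
    have split: "real n ^ (d - 1) = real n * real n ^ (d - 2)" using d
        by (simp add: power_eq_if numeral_2_eq_2)
    have Mb: "M ^ b = M powr real b" using assms by (simp add: powr_realpow)
    have "M ^ b \<le> C * real n ^ (d - 2)"
    proof (cases "\<beta> * b \<le> 4")
      case True
      then have "real b \<le> 4 / \<beta>" using assms by (simp add: field_simps)
      then have "M ^ b \<le> C" unfolding Mb C_def using assms by (intro powr_mono) auto
      also have "\<dots> \<le> C * real n ^ (d - 2)" using n1 C1 by simp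
      finally show ?thesis .
    next
      case False
      then have e: "\<beta> / 2 * b \<le> real (d - 2)" using d by (simp add: of_nat_diff)
      have "M ^ b \<le> (real n powr (\<beta> / 2)) ^ b" using N[of n] n assms by (intro power_mono) auto
      also have "\<dots> = real n powr (\<beta> / 2 * b)" using n1 by (simp add: powr_power mult.commute)
      also have "\<dots> \<le> real n powr (real (d - 2))" using e n1 by (intro powr_mono) auto
      also have "\<dots> = real n ^ (d - 2)" using n1 by (simp add: powr_realpow)
      also have "\<dots> \<le> C * real n ^ (d - 2)" using C1 n1 by simp
      finally show ?thesis .
    qed
    then have "M ^ b * n \<le> (C * real n ^ (d - 2)) * n" using n1 by (intro mult_right_mono) auto
    then show ?thesis unfolding split by (simp add: mult_ac)
  qed
  then show ?thesis using C1 by blast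
qed

lemma card_outer_boundary_le:
  assumes "cubic_expander \<beta> H F" "S \<subseteq> F"
  shows "card (outer_boundary H F S) \<le> 3 * card S"
proof -
  have fin: "finite F" "finite S" using assms finite_subset unfolding cubic_expander_def by auto
  have "outer_boundary H F S \<subseteq> (\<Union>u\<in>S. neighbours H F u)"
      by (auto simp: outer_boundary_def neighbours_def)
  then have "card (outer_boundary H F S) \<le> card (\<Union>u\<in>S. neighbours H F u)"
    using fin by (intro card_mono) (auto simp: neighbours_def)
  also have "\<dots> \<le> (\<Sum>u\<in>S. card (neighbours H F u))" by (rule card_UN_le[OF fin(2)])
  also have "\<dots> \<le> (\<Sum>u\<in>S. 3)" by (rule sum_mono) (use assms in \<open>auto simp: cubic_expander_def\<close>)
  finally show ?thesis by simp
qed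

text \<open>
  \<open>1152 = 9 * 4 * 16 * 2\<close>: with \<open>k + 1\<close> vertices there are \<open>9 ^ k\<close> walks and \<open>4 ^ k\<close> colourings,
  \<open>16 ^ Suc k\<close> is lost in the estimate of each probability, and \<open>2\<close> makes the sum over \<open>k\<close> geometric.
\<close>

lemma card_flexible_permutations:
  fixes \<beta> C :: real
  assumes core: "cubic_expander \<beta> H F" and V: "finite V" "F \<subseteq> V" "2 * card F \<le> card V"
      and n: "N \<le> card V"
    and C: "1 \<le> C" "\<And>n b d :: nat. N \<le> n \<Longrightarrow> 2 \<le> d \<Longrightarrow> \<beta> * b \<le> d \<Longrightarrow> 1152 ^ b * n \<le> C * real n ^ (d - 1)"
    and z: "z \<in> F"
  shows "real (card {\<pi>. \<pi> permutes V \<and> z \<in> flexible H F \<pi>}) * card V \<le> 2 * C * fact (card V)"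
proof -
  let ?n = "card V"
  have fin: "finite F" and nbF: "\<And>u. neighbours H F u \<subseteq> F" and nb3: "\<And>u. u \<in> F \<Longrightarrow>
      card (neighbours H F u) \<le> 3"
    using core by (auto simp: cubic_expander_def neighbours_def)
  have finP: "finite {\<pi>. \<pi> permutes V \<and> Q \<pi>}" for Q
    using finite_permutations[OF V(1)] by (rule rev_finite_subset) auto
  define Wk where "Wk k = {ws \<in> walks (neighbours H F) (2 * k) z. card (set ws) = Suc k \<and>
      2 * Suc k \<le> card F}" for k
  define Sk where "Sk k = {ss :: bool list. length ss = 2 * k}" for k
  define X where "X ws ss = {\<pi>. \<pi> permutes V \<and> walk_flexible H F ws ss \<pi>}" for ws ss
  have W: "finite (Wk k)" "card (Wk k) \<le> 9 ^ k" for k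
  proof -
    have w: "finite (walks (neighbours H F) (2 * k) z)" "card (walks (neighbours H F) (2 * k) z) \<le>
        3 ^ (2 * k)"
      using card_walks[OF fin nbF nb3 z, where k = "2 * k"] by auto
    then show "finite (Wk k)" unfolding Wk_def by simp
    have "card (Wk k) \<le> card (walks (neighbours H F) (2 * k) z)"
      by (rule card_mono[OF w(1)]) (auto simp: Wk_def)
    also note w(2)
    finally have "card (Wk k) \<le> 3 ^ (2 * k)" .
    then show "card (Wk k) \<le> 9 ^ k" by (simp add: power_mult)
  qed
  have S: "finite (Sk k)" "card (Sk k) = 4 ^ k" for k
  proof -
    have "Sk k = {ss. set ss \<subseteq> UNIV \<and> length ss = 2 * k}" unfolding Sk_def by auto
    then show "finite (Sk k)" "card (Sk k) = 4 ^ k"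
      using finite_lists_length_eq[of "UNIV :: bool set"
          "2 * k"] card_lists_length_eq[of "UNIV :: bool set" "2 * k"]
      by (auto simp: power_mult)
  qed
  have X: "real (card (X ws ss)) * ?n \<le> C * fact ?n / 72 ^ Suc k" if ws: "ws \<in> Wk k"
      and ss: "ss \<in> Sk k" for k ws ss
  proof -
    let ?d = "card (outer_boundary H F (set ws))"
    have wk: "ws \<in> walks (neighbours H F) (2 * k) z" "card (set ws) = Suc k" "2 * Suc k \<le> card F"
        using ws Wk_def by auto
    note wp = walks_props[OF wk(1) nbF z]
    have ex: "2 \<le> ?d" "\<beta> * Suc k \<le> ?d"
      using cubic_expander_expansion[OF core wp(4)] wp(2) wk by auto
    have d3: "?d \<le> 3 * Suc k" using card_outer_boundary_le[OF core wp(4)] wk by simp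
    have n0: "0 < ?n" using z V by (auto simp: card_gt_0_iff)
    have "card (X ws ss) * ?n ^ (?d - 1) \<le> 2 ^ (Suc k + ?d) * fact ?n"
      using card_walk_flexible[OF V wp(4), of ss H] wp(1) ss ex wk(2) unfolding X_def Sk_def by simp
    \<comment> \<open>The walk has \<open>Suc k\<close> vertices and at most
      \<open>3 * Suc k\<close> outer neighbours; this is the origin of
      \<open>16 ^ Suc k\<close>.\<close>
    also have "\<dots> \<le> 2 ^ (4 * Suc k) * fact ?n" using d3
        by (intro mult_right_mono power_increasing) auto
    also have "\<dots> = 16 ^ Suc k * fact ?n" by (simp only: power_mult) simp
    finally have "real (card (X ws ss) * ?n ^ (?d - 1)) \<le> real (16 ^ Suc k * fact ?n)"
        using of_nat_mono by blast
    then have 1: "real (card (X ws ss)) * real ?n ^ (?d - 1) \<le> 16 ^ Suc k * fact ?n" by simp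
    have 2: "1152 ^ Suc k * real ?n \<le> C * real ?n ^ (?d - 1)" by (rule C(2)[OF n ex])
    have "(real (card (X ws ss)) * real ?n) * 1152 ^ Suc k =
        real (card (X ws ss)) * (1152 ^ Suc k * real ?n)" by simp
    also have "\<dots> \<le> real (card (X ws ss)) * (C * real ?n ^ (?d - 1))" using 2
        by (intro mult_left_mono) auto
    also have "\<dots> = C * (real (card (X ws ss)) * real ?n ^ (?d - 1))" by simp
    also have "\<dots> \<le> C * (16 ^ Suc k * fact ?n)" using 1 C(1) by (intro mult_left_mono) auto
    finally have 3: "(real (card (X ws ss)) * real ?n) * 1152 ^ Suc k \<le> C * (16 ^ Suc k * fact ?n)"
        .
    have "(1152::real) ^ Suc k = 16 ^ Suc k * 72 ^ Suc k" by (simp flip: power_mult_distrib)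
    then have "16 ^ Suc k * ((real (card (X ws ss)) * real ?n) * 72 ^ Suc k) \<le>
        16 ^ Suc k * (C * fact ?n)"
      using 3 by (simp add: mult_ac)
    then have "(real (card (X ws ss)) * real ?n) * 72 ^ Suc k \<le> C * fact ?n"
        by (rule mult_left_le_imp_le) simp
    then show ?thesis by (simp add: field_simps)
  qed
  have "{\<pi>. \<pi> permutes V \<and> z \<in> flexible H F \<pi>} \<subseteq> (\<Union>k<card F. \<Union>ws\<in>Wk k. \<Union>ss\<in>Sk k. X ws ss)"
    unfolding flexible_def Wk_def Sk_def X_def by force
  then have "card {\<pi>. \<pi> permutes V \<and> z \<in> flexible H F \<pi>} \<le> card (\<Union>k<card F. \<Union>ws\<in>Wk k. \<Union>ss\<in>Sk k.
      X ws ss)"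
    using W S finP unfolding X_def by (intro card_mono finite_UN_I) auto
  also have "\<dots> \<le> (\<Sum>k<card F. card (\<Union>ws\<in>Wk k. \<Union>ss\<in>Sk k. X ws ss))" by (rule card_UN_le) simp
  also have "\<dots> \<le> (\<Sum>k<card F. \<Sum>ws\<in>Wk k. card (\<Union>ss\<in>Sk k. X ws ss))"
    using W by (intro sum_mono card_UN_le)
  also have "\<dots> \<le> (\<Sum>k<card F. \<Sum>ws\<in>Wk k. \<Sum>ss\<in>Sk k. card (X ws ss))"
    using S by (intro sum_mono card_UN_le)
  finally have "real (card {\<pi>. \<pi> permutes V \<and> z \<in> flexible H F \<pi>}) * ?n
     \<le> real (\<Sum>k<card F. \<Sum>ws\<in>Wk k. \<Sum>ss\<in>Sk k. card (X ws ss)) * ?n"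
    by (intro mult_right_mono of_nat_mono) auto
  also have "\<dots> = (\<Sum>k<card F. \<Sum>ws\<in>Wk k. \<Sum>ss\<in>Sk k. real (card (X ws ss)) * ?n)"
    by (simp add: sum_distrib_right)
  also have "\<dots> \<le> (\<Sum>k<card F. \<Sum>ws\<in>Wk k. \<Sum>ss\<in>Sk k. C * fact ?n / 72 ^ Suc k)"
    using X by (intro sum_mono)
  also have "\<dots> = (\<Sum>k<card F. real (card (Wk k)) * 4 ^ k * (C * fact ?n / 72 ^ Suc k))"
      by (simp add: S mult.assoc)
  also have "\<dots> \<le> (\<Sum>k<card F. 9 ^ k * 4 ^ k * (C * fact ?n / 72 ^ Suc k))"
  proof (intro sum_mono mult_right_mono)
    show "real (card (Wk k)) \<le> 9 ^ k" for k using W(2)[of k]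
        by (metis of_nat_le_iff of_nat_numeral of_nat_power)
  qed (use C in auto)
  also have "\<dots> = (\<Sum>k<card F. C * fact ?n / 72 * (1/2) ^ k)"
  proof (intro sum.cong refl)
    fix k
    have "(72::real) ^ k = 9 ^ k * 4 ^ k * 2 ^ k" by (simp flip: power_mult_distrib)
    then show "9 ^ k * 4 ^ k * (C * fact ?n / 72 ^ Suc k) = C * fact ?n / 72 * (1/2) ^ k"
      by (simp add: field_simps)
  qed
  also have "\<dots> = C * fact ?n / 72 * (\<Sum>k<card F. (1/2) ^ k)" by (simp add: sum_distrib_left)
  also have "\<dots> \<le> C * fact ?n / 72 * 2"
  proof (intro mult_left_mono)
    show "(\<Sum>k<card F. (1/2) ^ k) \<le> (2::real)" using sum_gp_strict[of "1/2::real" "card F"] by simp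
  qed (use C in simp)
  also have "\<dots> \<le> 2 * C * fact ?n" using C(1) by simp
  finally show ?thesis .
qed

definition rigid_labels :: "'a set set \<Rightarrow> 'a set \<Rightarrow> ('a \<Rightarrow> real) \<Rightarrow> 'a set \<Rightarrow> bool" where
  "rigid_labels H F f Z \<longleftrightarrow> (\<forall>h :: 'a \<Rightarrow> real.
     (\<forall>u\<in>F. \<forall>w\<in>F. {u, w} \<in> H \<longrightarrow> \<bar>h u - h w\<bar> = \<bar>f u - f w\<bar>) \<longrightarrow>
     (\<forall>u\<in>Z. \<forall>w\<in>Z. \<bar>h u - h w\<bar> = \<bar>f u - f w\<bar>))"

definition mostly_rigid :: "'a set set \<Rightarrow> 'a set \<Rightarrow> ('a \<Rightarrow> real) \<Rightarrow> bool" where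
  "mostly_rigid H F f \<longleftrightarrow> (\<exists>Z\<subseteq>F. card F \<le> 2 * card Z \<and> rigid_labels H F f Z)"

text \<open>At most \<open>3 * card F\<close> edges have at most \<open>8 ^ card F\<close>
  colourings, and every excess vertex costs a factor \<open>1 / card V\<close>. The 32 per vertex is
  \<open>2 * 8 * 2\<close>: the loss in counting permutations, the colourings, and the exponential
  decay that is left over.\<close>

lemma card_excess_permutations:
  fixes \<beta> :: real
  assumes core: "cubic_expander \<beta> H F" and beta: "0 < \<beta>" and V: "finite V" "F \<subseteq> V" "2 * card F \<le>
      card V"
    and n: "32 \<le> real (card V) powr (\<beta> / 14)"
    and us: "distinct us" "set us = F" "\<forall>i<length us. 0 < i \<longrightarrow> (\<exists>j<i. {us ! j, us ! i} \<in> H)"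
  shows "real (card {\<pi>. \<pi> permutes V \<and> (\<exists>\<sigma>\<subseteq>{{u, w} | u w. u \<in> F \<and> w \<in> F \<and> {u, w} \<in> H}.
      \<beta> * card F < 14 * card (excess H F us \<sigma>) \<and> (\<exists>a. sign_consistent H F \<sigma> \<pi> a))}) * 2 ^ card F \<le>
          fact (card V)"
proof -
  let ?n = "card V" and ?v = "card F"
  let ?E = "{{u, w} | u w. u \<in> F \<and> w \<in> F \<and> {u, w} \<in> H}"
  have fin: "finite F" and nb3: "\<And>u. u \<in> F \<Longrightarrow> card (neighbours H F u) \<le> 3" using core
      by (auto simp: cubic_expander_def)
  have E: "?E = (\<Union>u\<in>F. (\<lambda>w. {u, w}) ` neighbours H F u)" unfolding neighbours_def by blast
  have finE: "finite ?E" unfolding E using fin by (auto simp: neighbours_def)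
  have "card ?E \<le> (\<Sum>u\<in>F. card ((\<lambda>w. {u, w}) ` neighbours H F u))" unfolding E
      by (rule card_UN_le[OF fin])
  also have "\<dots> \<le> (\<Sum>u\<in>F. 3)"
  proof (rule sum_mono)
    fix u assume u: "u \<in> F"
    have "finite (neighbours H F u)" using fin by (simp add: neighbours_def)
    then have "card ((\<lambda>w. {u, w}) ` neighbours H F u) \<le> card (neighbours H F u)"
        by (rule card_image_le)
    then show "card ((\<lambda>w. {u, w}) ` neighbours H F u) \<le> 3" using nb3[OF u] by simp
  qed
  finally have cE: "card ?E \<le> 3 * ?v" by simp
  have n1: "1 \<le> real ?n"
  proof (rule ccontr)
    assume "\<not> ?thesis"
    then have "?n = 0" by simp
    then show False using n by simp
  qed
  define \<Sigma> where "\<Sigma> = {\<sigma>. \<sigma> \<subseteq> ?E \<and> \<beta> * ?v < 14 * card (excess H F us \<sigma>)}"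
  have S: "finite \<Sigma>" "card \<Sigma> \<le> 8 ^ ?v"
  proof -
    have sub: "\<Sigma> \<subseteq> Pow ?E" unfolding \<Sigma>_def by auto
    then show "finite \<Sigma>" using finE finite_subset by blast
    have "card \<Sigma> \<le> card (Pow ?E)" using sub finE by (intro card_mono) auto
    then have "card \<Sigma> \<le> 2 ^ card ?E" by (simp only: card_Pow[OF finE])
    also have "\<dots> \<le> 2 ^ (3 * ?v)" using cE by (intro power_increasing) auto
    finally show "card \<Sigma> \<le> 8 ^ ?v" by (simp add: power_mult)
  qed
  define X where "X \<sigma> = {\<pi>. \<pi> permutes V \<and> (\<exists>a. sign_consistent H F \<sigma> \<pi> a)}" for \<sigma>
  have finX: "finite (X \<sigma>)" for \<sigma> unfolding X_def
    using finite_permutations[OF V(1)] by (rule rev_finite_subset) auto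
  have X: "real (card (X \<sigma>)) * 16 ^ ?v \<le> fact ?n" if "\<sigma> \<in> \<Sigma>" for \<sigma>
  proof -
    let ?q = "card (excess H F us \<sigma>)"
    have q: "\<beta> / 14 * ?v \<le> ?q" using that unfolding \<Sigma>_def by simp
    have "(32::real) ^ ?v \<le> (real ?n powr (\<beta> / 14)) ^ ?v" using n by (intro power_mono) auto
    also have "\<dots> = real ?n powr (\<beta> / 14 * ?v)" using n1 by (simp add: powr_power mult.commute)
    also have "\<dots> \<le> real ?n powr real ?q" using q n1 by (intro powr_mono) auto
    also have "\<dots> = real ?n ^ ?q" using n1 by (simp add: powr_realpow)
    finally have "real (card (X \<sigma>)) * 32 ^ ?v \<le> real (card (X \<sigma>)) * real ?n ^ ?q"
        by (intro mult_left_mono) auto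
    also have "\<dots> \<le> real (2 ^ ?v * fact ?n)"
      using card_sign_consistent[OF V us, of \<sigma>] unfolding X_def
          by (metis of_nat_le_iff of_nat_mult of_nat_power)
    finally have le: "real (card (X \<sigma>)) * 32 ^ ?v \<le> 2 ^ ?v * fact ?n" by simp
    have "(32::real) ^ ?v = 2 ^ ?v * 16 ^ ?v" by (simp flip: power_mult_distrib)
    then have "2 ^ ?v * (real (card (X \<sigma>)) * 16 ^ ?v) \<le> 2 ^ ?v * fact ?n" using le
        by (simp only: mult_ac)
    then show ?thesis by (rule mult_left_le_imp_le) simp
  qed
  have "{\<pi>. \<pi> permutes V \<and> (\<exists>\<sigma>\<subseteq>?E. \<beta> * ?v < 14 * card (excess H F us \<sigma>) \<and>
      (\<exists>a. sign_consistent H F \<sigma> \<pi> a))} = (\<Union>\<sigma>\<in>\<Sigma>. X \<sigma>)" (is "?L = _")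
    unfolding \<Sigma>_def X_def by auto
  then have "card ?L \<le> (\<Sum>\<sigma>\<in>\<Sigma>. card (X \<sigma>))" by (simp only: card_UN_le[OF S(1)])
  then have "real (card ?L) \<le> real (\<Sum>\<sigma>\<in>\<Sigma>. card (X \<sigma>))" by (rule of_nat_mono)
  then have "real (card ?L) \<le> (\<Sum>\<sigma>\<in>\<Sigma>. real (card (X \<sigma>)))" by (simp only: of_nat_sum)
  then have "real (card ?L) * 16 ^ ?v \<le> (\<Sum>\<sigma>\<in>\<Sigma>. real (card (X \<sigma>))) * 16 ^ ?v"
    by (rule mult_right_mono) simp
  also have "\<dots> = (\<Sum>\<sigma>\<in>\<Sigma>. real (card (X \<sigma>)) * 16 ^ ?v)" by (simp add: sum_distrib_right)
  also have "\<dots> \<le> (\<Sum>\<sigma>\<in>\<Sigma>. fact ?n)" using X by (rule sum_mono)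
  also have "\<dots> \<le> 8 ^ ?v * fact ?n"
    using S(2) by (simp add: mult_right_mono)
  finally have le: "real (card ?L) * 16 ^ ?v \<le> 8 ^ ?v * fact ?n" .
  have "(16::real) ^ ?v = 8 ^ ?v * 2 ^ ?v" by (simp flip: power_mult_distrib)
  then have "8 ^ ?v * (real (card ?L) * 2 ^ ?v) \<le> 8 ^ ?v * fact ?n" using le by (simp only: mult_ac)
  then show ?thesis by (rule mult_left_le_imp_le) simp
qed

lemma sign_consistent_of_lengths:
  assumes "\<forall>u\<in>F. \<forall>w\<in>F. {u, w} \<in> H \<longrightarrow> \<bar>h u - h w\<bar> = \<bar>f u - f w\<bar>"
    and sigma: "\<sigma> = {{u, w} | u w. u \<in> F \<and> w \<in> F \<and> {u, w} \<in> H \<and> h u - f u = h w - f w}"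
  shows "sign_consistent H F \<sigma> f (\<lambda>u. h u - f u)"
  unfolding sign_consistent_def
proof (intro ballI impI)
  fix u w assume uw: "u \<in> F" "w \<in> F" "{u, w} \<in> H"
  show "if {u, w} \<in> \<sigma> then h u - f u = h w - f w else h u - f u + 2 * f u = h w - f w + 2 * f w"
  proof (cases "{u, w} \<in> \<sigma>")
    case True
    then show ?thesis unfolding sigma by (auto simp: doubleton_eq_iff)
  next
    case False
    then have "h u - f u \<noteq> h w - f w" using uw unfolding sigma by blast
    moreover have "\<bar>h u - h w\<bar> = \<bar>f u - f w\<bar>" using assms(1) uw by blast
    ultimately show ?thesis using False by (auto simp: abs_if split: if_splits)
  qed
qed

text \<open>Outside \<open>G\<close> every \<open>h\<close> has a central class, and outside
  \<open>L\<close> at most half of \<open>F\<close> is flexible. \<open>G\<close> is exponentially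
  rare; for \<open>L\<close> the mean number of flexible vertices is bounded. The constants depend
  on \<beta> and \<open>c\<close> alone, so the estimate is uniform in the shape of the
  expander.\<close>

lemma random_labels_rigid:
  fixes \<beta> c :: real
  assumes beta: "0 < \<beta>" "\<beta> \<le> 1" and c: "0 < c"
  shows "\<exists>C N. \<forall>V H F. finite V \<longrightarrow> F \<subseteq> V \<longrightarrow> 2 * card F \<le> card V \<longrightarrow> c * card V \<le> card F \<longrightarrow>
     N \<le> card V \<longrightarrow> cubic_expander \<beta> H F \<longrightarrow>
     real (card {\<pi>. \<pi> permutes V \<and> \<not> mostly_rigid H F \<pi>})
       \<le> C / card V * fact (card V)"
proof -
  have "(1::real) \<le> 1152" by simp
  from power_tradeoff[OF beta(1) this] obtain C N1 where C0: "1 \<le> C" "\<forall>n b d :: nat. N1 \<le> n \<longrightarrow>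
      2 \<le> d \<longrightarrow>
      \<beta> * b \<le> d \<longrightarrow> 1152 ^ b * n \<le> C * real n ^ (d - 1)" by blast
  then have C: "1 \<le> C" "\<And>n b d :: nat. N1 \<le> n \<Longrightarrow> 2 \<le> d \<Longrightarrow> \<beta> * b \<le> d \<Longrightarrow>
      1152 ^ b * n \<le> C * real n ^ (d - 1)" by blast+
  have "filterlim (\<lambda>n::nat. real n powr (\<beta> / 14)) at_top sequentially" using beta by real_asymp
  then have "\<forall>\<^sub>F n in sequentially. 32 \<le> real n powr (\<beta> / 14)" by (simp add: filterlim_at_top)
  then obtain N2 where N2: "\<And>n. N2 \<le> n \<Longrightarrow> 32 \<le> real n powr (\<beta> / 14)"
      by (auto simp: eventually_at_top_linorder)
  show ?thesis
  proof (intro exI[of _ "(1 + 4 * C) / c"] exI[of _ "max 1 (max N1 N2)"] allI impI)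
    fix V :: "real set" and H F
    assume V: "finite V" "F \<subseteq> V" "2 * card F \<le> card V" and vn: "c * card V \<le> card F"
      and N: "max 1 (max N1 N2) \<le> card V" and core: "cubic_expander \<beta> H F"
    let ?n = "card V" and ?v = "card F"
    let ?E = "{{u, w} | u w. u \<in> F \<and> w \<in> F \<and> {u, w} \<in> H}"
    have n0: "0 < real ?n" using N by simp
    then have v0: "0 < real ?v" using vn c by (metis less_le_trans mult_pos_pos)
    have fin: "finite F" using V finite_subset by blast
    obtain us where us: "distinct us" "set us = F" "\<forall>i<length us. 0 < i \<longrightarrow>
        (\<exists>j<i. {us ! j, us ! i} \<in> H)"
      using cubic_expander_order[OF core] by blast
    define G where "G = {\<pi>. \<pi> permutes V \<and> (\<exists>\<sigma>\<subseteq>?E.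
      \<beta> * ?v < 14 * card (excess H F us \<sigma>) \<and> (\<exists>a. sign_consistent H F \<sigma> \<pi> a))}"
    define PP where "PP = {\<pi>. \<pi> permutes V}"
    define L where "L = {\<pi> \<in> PP. ?v < 2 * card (flexible H F \<pi>)}"
    have finP: "finite PP" unfolding PP_def using V(1) by (rule finite_permutations)
    have G: "real (card G) * ?v \<le> fact ?n"
    proof -
      \<comment> \<open>The exponential bound is weakened to \<open>1 / card F\<close>, the form of
        the bound for \<open>L\<close>.\<close>
      have "real (card G) * ?v \<le> real (card G) * 2 ^ ?v"
        by (intro mult_left_mono) (auto simp: less_imp_le of_nat_less_two_power)
      also have "\<dots> \<le> fact ?n"
        unfolding G_def by (rule card_excess_permutations[OF core beta(1) V _ us]) (use N2 N in
            auto)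
      finally show ?thesis .
    qed
    have L: "real (card L) * ?v \<le> 4 * C * fact ?n"
    proof -
      \<comment> \<open>Markov's inequality, by double counting the pairs of a permutation and a
        flexible vertex.\<close>
      have "card L * ?v = (\<Sum>\<pi>\<in>L. ?v)" by simp
      also have "\<dots> \<le> (\<Sum>\<pi>\<in>L. 2 * card (flexible H F \<pi>))" by (rule sum_mono) (auto simp: L_def)
      also have "\<dots> \<le> (\<Sum>\<pi>\<in>PP. 2 * card (flexible H F \<pi>))"
        by (rule sum_mono2[OF finP]) (auto simp: L_def)
      also have "\<dots> = 2 * (\<Sum>\<pi>\<in>PP. card {z \<in> F. z \<in> flexible H F \<pi>})"
      proof -
        have "{z \<in> F. z \<in> flexible H F \<pi>} = flexible H F \<pi>" for \<pi> by (auto simp: flexible_def)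
        then show ?thesis by (simp add: sum_distrib_left)
      qed
      also have "(\<Sum>\<pi>\<in>PP. card {z \<in> F. z \<in> flexible H F \<pi>}) =
          (\<Sum>z\<in>F. card {\<pi> \<in> PP. z \<in> flexible H F \<pi>})"
        using sum.swap_restrict[OF finP fin, of "\<lambda>_ _. 1::nat" "\<lambda>\<pi> z. z \<in> flexible H F \<pi>"] by simp
      finally have "real (card L * ?v) * ?n \<le> real (2 * (\<Sum>z\<in>F. card {\<pi> \<in> PP.
          z \<in> flexible H F \<pi>})) * ?n"
        by (intro mult_right_mono of_nat_mono) auto
      also have "\<dots> = 2 * (\<Sum>z\<in>F. real (card {\<pi>. \<pi> permutes V \<and> z \<in> flexible H F \<pi>}) * ?n)"
        by (simp add: PP_def sum_distrib_right)
      also have "\<dots> \<le> 2 * (\<Sum>z\<in>F. 2 * C * fact ?n)"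
      proof (intro mult_left_mono sum_mono)
        show "real (card {\<pi>. \<pi> permutes V \<and> z \<in> flexible H F \<pi>}) * ?n \<le> 2 * C * fact ?n" if "z \<in> F"
            for z
          by (rule card_flexible_permutations[OF core V _ C that]) (use N in auto)
      qed simp
      also have "\<dots> = (4 * C * fact ?n) * ?v" by simp
      also have "\<dots> \<le> (4 * C * fact ?n) * ?n" using C(1) V(3) by (intro mult_left_mono) auto
      finally show ?thesis using n0 by simp
    qed
    have "{\<pi>. \<pi> permutes V \<and> \<not> mostly_rigid H F \<pi>} \<subseteq> G \<union> L"
    proof (rule subsetI, rule ccontr)
      fix \<pi> assume pi: "\<pi> \<in> {\<pi>. \<pi> permutes V \<and> \<not> mostly_rigid H F \<pi>}"
        and "\<pi> \<notin> G \<union> L"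
      then have nG: "\<pi> \<notin> G" and nL: "2 * card (flexible H F \<pi>) \<le> ?v" by (auto simp: L_def PP_def)
      let ?Z = "F - flexible H F \<pi>"
      have flF: "flexible H F \<pi> \<subseteq> F" by (auto simp: flexible_def)
      have "card ?Z = ?v - card (flexible H F \<pi>)" using flF fin
          by (meson card_Diff_subset finite_subset)
      then have "?v \<le> 2 * card ?Z" using nL by simp
      moreover have "rigid_labels H F \<pi> ?Z"
        unfolding rigid_labels_def
      proof (intro allI impI ballI)
        fix h :: "real \<Rightarrow> real" and u w
        assume h: "\<forall>u\<in>F. \<forall>w\<in>F. {u, w} \<in> H \<longrightarrow> \<bar>h u - h w\<bar> = \<bar>\<pi> u - \<pi> w\<bar>" and uw: "u \<in> ?Z" "w \<in> ?Z"
        define \<sigma> where "\<sigma> = {{u, w} | u w. u \<in> F \<and> w \<in> F \<and> {u, w} \<in> H \<and> h u - \<pi> u = h w - \<pi> w}"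
        have "sign_consistent H F \<sigma> \<pi> (\<lambda>u. h u - \<pi> u)"
          by (rule sign_consistent_of_lengths[OF h \<sigma>_def])
        moreover have "\<sigma> \<subseteq> ?E" unfolding \<sigma>_def by blast
        ultimately have "\<not> \<beta> * ?v < 14 * card (excess H F us \<sigma>)" using nG pi unfolding G_def
            by blast
        then have "14 * card (excess H F us \<sigma>) \<le> \<beta> * ?v" by simp
        then obtain s c where "2 * card {u \<in> F. sign_class H F \<sigma> s u \<noteq> c} \<le> card F"
          using sign_central_class[OF core beta us] by blast
        from rigid_of_central_class[OF core this _ \<sigma>_def uw] h
        show "\<bar>h u - h w\<bar> = \<bar>\<pi> u - \<pi> w\<bar>" by blast
      qed
      ultimately have "mostly_rigid H F \<pi>" unfolding mostly_rigid_def by blast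
      then show False using pi by blast
    qed
    then have "card {\<pi>. \<pi> permutes V \<and> \<not> mostly_rigid H F \<pi>} \<le> card (G \<union> L)"
      (is "?X \<le> _")
      by (rule card_mono[rotated]) (use finP in \<open>auto simp: G_def L_def PP_def intro:
          rev_finite_subset[OF finP]\<close>)
    also have "\<dots> \<le> card G + card L" by (rule card_Un_le)
    finally have "real ?X * ?v \<le> (real (card G) + real (card L)) * ?v"
        by (intro mult_right_mono) auto
    also have "\<dots> \<le> (1 + 4 * C) * fact ?n" using G L by (simp add: algebra_simps)
    finally have "real ?X \<le> (1 + 4 * C) * fact ?n / ?v" using v0 by (simp add: field_simps)
    also have "\<dots> \<le> (1 + 4 * C) * fact ?n / (c * ?n)"
      using vn C(1) c n0 v0 by (intro divide_left_mono) auto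
    finally show "real ?X \<le> (1 + 4 * C) / c / ?n * fact ?n" by simp
  qed
qed

section \<open>Extracting an expander from a path with random chords\<close>

definition cutset :: "'a set set \<Rightarrow> 'a set \<Rightarrow> 'a set set" where
  "cutset H S = {e \<in> H. e \<inter> S \<noteq> {} \<and> \<not> e \<subseteq> S}"

lemma vertex_pairsE:
  assumes "e \<in> vertex_pairs U"
  obtains u w where "e = {u, w}" "u \<noteq> w" "u \<in> U" "w \<in> U"
  using assms unfolding vertex_pairs_def by (auto simp: card_2_iff)

lemma card_edges_at:
  assumes "H \<subseteq> vertex_pairs U" "finite U"
  shows "card {e \<in> H. y \<in> e} = card {w. {y, w} \<in> H}" "finite {w. {y, w} \<in> H}"
proof -
  have "{w. {y, w} \<in> H} \<subseteq> U" using assms unfolding vertex_pairs_def by auto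
  then show "finite {w. {y, w} \<in> H}" using assms finite_subset by blast
  have im: "(\<lambda>w. {y, w}) ` {w. {y, w} \<in> H} = {e \<in> H. y \<in> e}"
  proof (intro equalityI subsetI)
    fix e assume e: "e \<in> {e \<in> H. y \<in> e}"
    then have "e \<in> vertex_pairs U" using assms by auto
    then obtain u w where "e = {u, w}" by (rule vertex_pairsE)
    then show "e \<in> (\<lambda>w. {y, w}) ` {w. {y, w} \<in> H}" using e by (auto simp: insert_commute)
  qed auto
  have "inj_on (\<lambda>w. {y, w}) {w. {y, w} \<in> H}" by (auto simp: inj_on_def doubleton_eq_iff)
  from card_image[OF this] show "card {e \<in> H. y \<in> e} = card {w. {y, w} \<in> H}" unfolding im .
qed

text \<open>
  Take a maximal small set \<open>X\<close> with few outgoing edges and remove it. A set \<open>S\<close> violating the expansion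
  could be added to \<open>X\<close>. If \<open>S\<close> has a single outer neighbour \<open>y\<close>, then at most one edge leaves \<open>S\<close> or
  \<open>insert y S\<close> inside the rest, hence by \<open>two\<close> at least one edge goes to \<open>X\<close>, and adding this set to
  \<open>X\<close> does not enlarge the cut.
\<close>

lemma cubic_expander_extraction:
  fixes \<zeta> :: real
  assumes fin: "finite U" and H: "H \<subseteq> vertex_pairs U" and D: "D \<subseteq> U" "8 * card D < card U"
      and m: "4 \<le> card U"
    and deg: "\<And>u. u \<in> U - D \<Longrightarrow> card {w. {u, w} \<in> H} \<le> 3"
    and two: "\<And>S. S \<subseteq> U - D \<Longrightarrow> S \<noteq> {} \<Longrightarrow> 2 \<le> card (cutset H S)"
    and gp: "\<And>S. S \<subseteq> U \<Longrightarrow> card U \<le> 8 * card S \<Longrightarrow> 8 * card S \<le> 7 * card U \<Longrightarrow> \<zeta> * card U \<le>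
        card (cutset H S)"
    and cutD: "card (cutset H D) \<le> \<zeta> / 2 * card U" and zeta: "0 < \<zeta>"
  shows "\<exists>F\<subseteq>U. 7 * card U \<le> 8 * card F \<and> cubic_expander (\<zeta> / 6) H F"
proof -
  let ?m = "card U"
  \<comment> \<open>The cut may grow by \<open>\<zeta> / 2\<close> per vertex of \<open>X\<close>.
    It then stays below \<open>\<zeta> * card U\<close>, so a set that is still at most seven
    eighths of \<open>U\<close> must by \<open>gp\<close> be below one eighth again.\<close>
  define XX where "XX = {X. D \<subseteq> X \<and> X \<subseteq> U \<and> card (cutset H X) \<le> \<zeta> / 2 * ?m + \<zeta> / 2 * card X \<and>
      8 * card X < ?m}"
  have finXX: "finite XX" by (rule finite_subset[of _ "Pow U"]) (auto simp: XX_def fin)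
  have "D \<in> XX" using D order_trans[OF cutD, of "\<zeta> / 2 * ?m + \<zeta> / 2 * card D"] zeta
      by (simp add: XX_def)
  then have "Max (card ` XX) \<in> card ` XX" using finXX by (intro Max_in) auto
  then obtain X where X: "X \<in> XX" and cX: "card X = Max (card ` XX)" by auto
  have max: "card X' \<le> card X" if "X' \<in> XX" for X' unfolding cX using that finXX by simp
  define F where "F = U - X"
  have XU: "X \<subseteq> U" "D \<subseteq> X" "8 * card X < ?m" using X by (auto simp: XX_def)
  have finX: "finite X" "finite F" using XU fin finite_subset by (auto simp: F_def)
  have cF: "card F = ?m - card X" unfolding F_def using XU finX by (simp add: card_Diff_subset)
  have ends: "\<exists>u w. e = {u, w} \<and> u \<in> U \<and> w \<in> U" if "e \<in> H" for e
    using H that vertex_pairsE[of e U] by blast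
  have finH: "finite H" using H fin finite_subset[OF _ finite_vertex_pairs] by blast
  define eX where "eX S = {e \<in> H. e \<inter> X \<noteq> {} \<and> e \<inter> S \<noteq> {}}" for S
  define eF where "eF S = {e \<in> H. e \<inter> S \<noteq> {} \<and> e \<inter> (F - S) \<noteq> {}}" for S
  have fe: "finite (eX S)" "finite (eF S)" "finite (cutset H S)" for S using finH
      by (auto simp: eX_def eF_def cutset_def)
  \<comment> \<open>Moving \<open>S\<close> into \<open>X\<close> removes from the cut the edges to
    \<open>X\<close> and adds those to the rest of \<open>F\<close>. Hence \<open>S\<close> can be
    absorbed when \<open>eF S\<close> exceeds \<open>eX S\<close> by at most
    \<open>\<zeta> / 2 * card S\<close>.\<close>
  have add: "card (cutset H (X \<union> S)) + card (eX S) \<le> card (cutset H X) + card (eF S)" if S: "S \<subseteq> F"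
      for S
  proof -
    have sub: "eX S \<subseteq> cutset H X" using S unfolding eX_def cutset_def F_def by auto
    have "cutset H (X \<union> S) \<subseteq> (cutset H X - eX S) \<union> eF S"
    proof
      fix e assume e: "e \<in> cutset H (X \<union> S)"
      then obtain u w where uw: "e = {u, w}" "u \<in> U" "w \<in> U" using ends[of e]
          by (auto simp: cutset_def)
      then show "e \<in> (cutset H X - eX S) \<union> eF S" using e S unfolding cutset_def eX_def eF_def F_def
          by auto
    qed
    then have "card (cutset H (X \<union> S)) \<le> card ((cutset H X - eX S) \<union> eF S)" using fe
        by (intro card_mono) auto
    also have "\<dots> \<le> card (cutset H X - eX S) + card (eF S)" by (rule card_Un_le)
    also have "card (cutset H X - eX S) = card (cutset H X) - card (eX S)" using sub fe
        by (simp add: card_Diff_subset)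
    finally show ?thesis using card_mono[OF fe(3) sub] by linarith
  qed
  have cutS: "card (cutset H S) \<le> card (eX S) + card (eF S)" if S: "S \<subseteq> F" for S
  proof -
    have "cutset H S \<subseteq> eX S \<union> eF S"
    proof
      fix e assume e: "e \<in> cutset H S"
      then obtain u w where uw: "e = {u, w}" "u \<in> U" "w \<in> U" using ends[of e]
          by (auto simp: cutset_def)
      then show "e \<in> eX S \<union> eF S" using e S unfolding cutset_def eX_def eF_def F_def by auto
    qed
    then have "card (cutset H S) \<le> card (eX S \<union> eF S)" using fe by (intro card_mono) auto
    also have "\<dots> \<le> card (eX S) + card (eF S)" by (rule card_Un_le)
    finally show ?thesis .
  qed
  have step: False if S: "S \<subseteq> F" "S \<noteq> {}" "8 * card S \<le> 6 * ?m"
    and c: "card (eF S) \<le> card (eX S) + \<zeta> / 2 * card S" for S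
  proof -
    let ?X = "X \<union> S"
    have finS: "finite S" using S finX finite_subset by blast
    have cX: "card ?X = card X + card S" using S finX finS
        by (intro card_Un_disjoint) (auto simp: F_def)
    have "0 < card S" using S finS by auto
    have le: "8 * card ?X \<le> 7 * ?m" using cX S XU by linarith
    have "real (card (cutset H ?X)) + real (card (eX S)) \<le> real (card (cutset H X)) +
        real (card (eF S))"
      using add[OF S(1)] by (metis of_nat_add of_nat_le_iff)
    moreover have "real (card (cutset H X)) \<le> \<zeta> / 2 * ?m + \<zeta> / 2 * card X" using X
        by (auto simp: XX_def)
    ultimately have cc: "card (cutset H ?X) \<le> \<zeta> / 2 * ?m + \<zeta> / 2 * card ?X" using c cX
        by (simp add: algebra_simps)
    also have "\<dots> < \<zeta> / 2 * ?m + \<zeta> / 2 * ?m"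
    proof -
      have "card ?X < ?m" using le m by linarith
      then have "\<zeta> * card ?X < \<zeta> * ?m" using zeta by (intro mult_strict_left_mono) auto
      then show ?thesis by simp
    qed
    finally have "card (cutset H ?X) < \<zeta> * ?m" by simp
    moreover have XU': "?X \<subseteq> U" using XU S by (auto simp: F_def)
    ultimately have "8 * card ?X < ?m" using gp[of ?X] le by linarith
    then have "?X \<in> XX" using cc XU' XU(2) unfolding XX_def by blast
    then show False using max[of ?X] cX \<open>0 < card S\<close> by simp
  qed
  have at3: "card {e \<in> H. y \<in> e} \<le> 3" if "y \<in> F" for y
    using card_edges_at(1)[OF H fin, of y] deg[of y] that XU by (auto simp: F_def)
  have finE: "finite {e \<in> H. y \<in> e}" for y using finH by simp
  have eFb: "\<exists>y\<in>outer_boundary H F S. y \<in> e" if eS: "e \<in> eF S" "S \<subseteq> F" for e S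
  proof -
    obtain u w where uw: "e = {u, w}" using eS ends[of e] by (auto simp: eF_def)
    have eH: "{u, w} \<in> H" "{w, u} \<in> H" using eS uw by (auto simp: eF_def insert_commute)
    from eS uw have "u \<in> S \<and> w \<in> F - S \<or> w \<in> S \<and> u \<in> F - S" by (auto simp: eF_def)
    then show ?thesis
    proof
      assume "u \<in> S \<and> w \<in> F - S"
      then have "w \<in> outer_boundary H F S" using eH(1) unfolding outer_boundary_def by blast
      then show ?thesis using uw by blast
    next
      assume "w \<in> S \<and> u \<in> F - S"
      then have "u \<in> outer_boundary H F S" using eH(2) unfolding outer_boundary_def by blast
      then show ?thesis using uw by blast
    qed
  qed
  have exp: "2 \<le> card (outer_boundary H F S) \<and> \<zeta> / 6 * card S \<le> card (outer_boundary H F S)"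
    if S: "S \<subseteq> F" "S \<noteq> {}" "2 * card S \<le> card F" for S
  proof -
    have finb: "finite (outer_boundary H F S)" using finX by (auto simp: outer_boundary_def)
    \<comment> \<open>The summand 8 leaves room for the additional vertex \<open>y\<close> below; it
      comes from \<open>4 \<le> card U\<close>.\<close>
    have c6: "8 * card S + 8 \<le> 6 * ?m" using S cF m by linarith
    have "eF S \<subseteq> (\<Union>y\<in>outer_boundary H F S. {e \<in> H. y \<in> e})" using eFb[OF _ S(1)]
        by (auto simp: eF_def)
    then have "card (eF S) \<le> card (\<Union>y\<in>outer_boundary H F S. {e \<in> H. y \<in> e})" using finb finE
        by (intro card_mono) auto
    also have "\<dots> \<le> (\<Sum>y\<in>outer_boundary H F S. card {e \<in> H. y \<in> e})" by (rule card_UN_le[OF finb])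
    also have "\<dots> \<le> (\<Sum>y\<in>outer_boundary H F S. 3)"
        by (rule sum_mono) (use at3 in \<open>auto simp: outer_boundary_def\<close>)
    finally have e3: "card (eF S) \<le> 3 * card (outer_boundary H F S)" by simp
    have two': "2 \<le> card (cutset H S)" using two[of S] S XU by (auto simp: F_def)
    \<comment> \<open>An outer neighbour meets at most three edges of \<open>eF S\<close>, so a
      failure would give \<open>card (eF S) \<le> \<zeta> / 2 * card S\<close>; hence the 6.\<close>
    have "\<zeta> / 6 * card S \<le> card (outer_boundary H F S)"
    proof (rule ccontr)
      assume "\<not> ?thesis"
      then have "real (3 * card (outer_boundary H F S)) \<le> \<zeta> / 2 * card S" by simp
      then have "card (eF S) \<le> card (eX S) + \<zeta> / 2 * card S" using e3 by linarith
      then show False using step[OF S(1,2)] c6 by simp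
    qed
    moreover have "2 \<le> card (outer_boundary H F S)"
    proof (rule ccontr)
      assume nb: "\<not> ?thesis"
      have ns: "0 \<le> \<zeta> / 2 * card S" for S :: "'a set" using zeta by simp
      show False
      proof (cases "card (eF S) \<le> 1")
        case True
        then have "card (eF S) \<le> card (eX S)" using two' cutS[OF S(1)] by linarith
        then have "card (eF S) \<le> card (eX S) + \<zeta> / 2 * card S" using ns[of S] by linarith
        then show False using step[OF S(1,2)] c6 by simp
      next
        case False
        then have "card (outer_boundary H F S) = 1" using nb e3 by linarith
        then obtain y where y: "outer_boundary H F S = {y}" by (auto simp: card_1_singleton_iff)
        then have yF: "y \<in> F" "y \<notin> S" by (auto simp: outer_boundary_def)
        let ?S = "insert y S"
        have sub: "?S \<subseteq> F" using yF S by auto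
        have finS: "finite S" using S finX finite_subset by blast
        \<comment> \<open>Edges between \<open>S\<close> and \<open>y\<close> are internal to
          \<open>?S\<close>. Both sets consist of edges at \<open>y\<close>, at most three in all,
          and \<open>eF S\<close> has at least two, so at most one remains for
          \<open>eF ?S\<close>.\<close>
        have "eF S \<inter> eF ?S = {}"
        proof (rule ccontr)
          assume "\<not> ?thesis"
          then obtain e where e: "e \<in> eF S" "e \<in> eF ?S" by auto
          then have "y \<in> e" using eFb[OF _ S(1)] y by auto
          moreover obtain u w where uw: "e = {u, w}" using e(1) ends[of e] by (auto simp: eF_def)
          ultimately show False using e yF unfolding eF_def by auto
        qed
        moreover have "eF S \<union> eF ?S \<subseteq> {e \<in> H. y \<in> e}"
        proof
          fix e assume "e \<in> eF S \<union> eF ?S"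
          then consider "e \<in> eF S" | "e \<in> eF ?S" "e \<in> H" by (auto simp: eF_def)
          then show "e \<in> {e \<in> H. y \<in> e}"
          proof cases
            case 1
            then show ?thesis using eFb[OF _ S(1)] y by (auto simp: eF_def)
          next
            case 2
            have "y \<in> e"
            proof (rule ccontr)
              assume "y \<notin> e"
              then have "e \<in> eF S" using 2 by (auto simp: eF_def)
              then show False using eFb[OF _ S(1)] y \<open>y \<notin> e\<close> by auto
            qed
            then show ?thesis using 2 by simp
          qed
        qed
        ultimately have "card (eF S) + card (eF ?S) \<le> card {e \<in> H. y \<in> e}"
          using card_Un_disjoint[OF fe(2) fe(2)] card_mono[OF finE] by metis
        then have "card (eF ?S) \<le> 1" using at3[OF yF(1)] False by linarith
        moreover have "2 \<le> card (cutset H ?S)" using two[of ?S] sub XU by (auto simp: F_def)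
        ultimately have "card (eF ?S) \<le> card (eX ?S)" using cutS[OF sub] by linarith
        then have "card (eF ?S) \<le> card (eX ?S) + \<zeta> / 2 * card ?S" using ns[of ?S] by linarith
        moreover have "8 * card ?S \<le> 6 * ?m" using c6 yF finS by simp
        ultimately show False using step[OF sub] by simp
      qed
    qed
    ultimately show ?thesis by simp
  qed
  have "cubic_expander (\<zeta> / 6) H F"
    unfolding cubic_expander_def
  proof (intro conjI ballI allI impI)
    show "finite F" by (rule finX)
    fix u assume u: "u \<in> F"
    have "card (neighbours H F u) \<le> card {w. {u, w} \<in> H}"
      by (rule card_mono[OF card_edges_at(2)[OF H fin]]) (auto simp: neighbours_def)
    also have "\<dots> \<le> 3" by (rule deg) (use u XU(2) in \<open>auto simp: F_def\<close>)
    finally show "card (neighbours H F u) \<le> 3" .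
  next
    fix S assume "S \<subseteq> F" "S \<noteq> {}" "2 * card S \<le> card F"
    from exp[OF this] show "2 \<le> card (outer_boundary H F S)" "\<zeta> / 6 * card S \<le>
        card (outer_boundary H F S)" by auto
  qed
  moreover have "7 * ?m \<le> 8 * card F" using cF XU by linarith
  moreover have "F \<subseteq> U" by (auto simp: F_def)
  ultimately show ?thesis by blast
qed

section \<open>Path breaks and chords across a cut\<close>

definition path_edges :: "'a list \<Rightarrow> 'a set set" where
  "path_edges xs = {{xs ! i, xs ! Suc i} | i. Suc i < length xs}"

definition breaks :: "'a list \<Rightarrow> 'a set \<Rightarrow> nat set" where
  "breaks xs S = {i. Suc i < length xs \<and> (xs ! i \<in> S \<longleftrightarrow> xs ! Suc i \<notin> S)}"

definition cross :: "'a set \<Rightarrow> 'a set \<Rightarrow> 'a set set" where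
  "cross U S = (\<lambda>(s, t). {s, t}) ` (S \<times> (U - S))"

lemma card_breaks_le:
  assumes "distinct xs" "finite H" "path_edges xs \<subseteq> H"
  shows "card (breaks xs S) \<le> card (cutset H S)"
proof (rule card_inj_on_le[of "\<lambda>i. {xs ! i, xs ! Suc i}"])
  show "inj_on (\<lambda>i. {xs ! i, xs ! Suc i}) (breaks xs S)"
    using assms(1) by (auto simp: inj_on_def breaks_def doubleton_eq_iff nth_eq_iff_index_eq)
  show "(\<lambda>i. {xs ! i, xs ! Suc i}) ` breaks xs S \<subseteq> cutset H S"
  proof
    fix e assume "e \<in> (\<lambda>i. {xs ! i, xs ! Suc i}) ` breaks xs S"
    then obtain i where i: "i \<in> breaks xs S" "e = {xs ! i, xs ! Suc i}" by blast
    then have "e \<in> path_edges xs" unfolding path_edges_def breaks_def by blast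
    then have "e \<in> H" using assms(3) by blast
    then show "e \<in> cutset H S" using i unfolding breaks_def cutset_def by auto
  qed
  show "finite (cutset H S)" using assms by (simp add: cutset_def)
qed

text \<open>Along the path, membership in \<open>S\<close> changes exactly at the breaks, so
  \<open>S\<close> is coded by one bit and its set of breaks. Few sets have few breaks, which makes
  the union bound affordable.\<close>

lemma breaks_inj: "inj_on (\<lambda>S. (xs ! 0 \<in> S, breaks xs S)) (Pow (set xs))"
proof (rule inj_onI)
  fix S T assume ST: "S \<in> Pow (set xs)" "T \<in> Pow (set xs)"
    and eq: "(xs ! 0 \<in> S, breaks xs S) = (xs ! 0 \<in> T, breaks xs T)"
  have "xs ! i \<in> S \<longleftrightarrow> xs ! i \<in> T" if "i < length xs" for i
    using that
  proof (induction i)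
    case 0
    then show ?case using eq by simp
  next
    case (Suc i)
    have "i \<in> breaks xs S \<longleftrightarrow> i \<in> breaks xs T" using eq by simp
    then show ?case using Suc by (auto simp: breaks_def)
  qed
  then have "x \<in> S \<longleftrightarrow> x \<in> T" if "x \<in> set xs" for x using that by (metis in_set_conv_nth)
  then show "S = T" using ST by blast
qed

text \<open>
  Exponential weighting: \<open>1 \<le> x ^ card A / x ^ t\<close> for the sets \<open>A\<close> that are counted.
\<close>

lemma card_small_subsets:
  fixes x :: real
  assumes "finite I" "0 < x" "x \<le> 1"
  shows "card {A. A \<subseteq> I \<and> card A \<le> t} \<le> (1 + x) ^ card I / x ^ t"
proof -
  have "real (card {A. A \<subseteq> I \<and> card A \<le> t}) * x ^ t = (\<Sum>A\<in>{A. A \<subseteq> I \<and> card A \<le> t}. x ^ t)" by simp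
  also have "\<dots> \<le> (\<Sum>A\<in>{A. A \<subseteq> I \<and> card A \<le> t}. x ^ card A)"
    by (rule sum_mono) (use assms in \<open>auto intro: power_decreasing\<close>)
  also have "\<dots> \<le> (\<Sum>A\<in>Pow I. x ^ card A)"
    by (rule sum_mono2) (use assms in auto)
  also have "\<dots> = (\<Sum>A\<in>Pow I. (\<Prod>i\<in>A. x) * (\<Prod>i\<in>I - A. 1))" by simp
  also have "\<dots> = (\<Prod>i\<in>I. x + 1)" using prod_add[OF assms(1), of "\<lambda>_. x" "\<lambda>_. 1"] by simp
  finally show ?thesis using assms by (simp add: field_simps)
qed

lemma card_few_breaks:
  fixes x :: real
  assumes "0 < x" "x \<le> 1"
  shows "card {S. S \<subseteq> set xs \<and> card (breaks xs S) \<le> t} \<le> 2 * (1 + x) ^ length xs / x ^ t"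
proof -
  let ?A = "{A. A \<subseteq> {..<length xs} \<and> card A \<le> t}"
  have "card {S. S \<subseteq> set xs \<and> card (breaks xs S) \<le> t} \<le> card ((UNIV :: bool set) \<times> ?A)"
  proof (rule card_inj_on_le)
    show "inj_on (\<lambda>S. (xs ! 0 \<in> S, breaks xs S)) {S. S \<subseteq> set xs \<and> card (breaks xs S) \<le> t}"
      by (rule inj_on_subset[OF breaks_inj]) auto
    show "(\<lambda>S. (xs ! 0 \<in> S, breaks xs S)) ` {S. S \<subseteq> set xs \<and> card (breaks xs S) \<le> t} \<subseteq> UNIV \<times> ?A"
      by (auto simp: breaks_def)
    show "finite ((UNIV :: bool set) \<times> ?A)" by (intro finite_cartesian_product) auto
  qed
  also have "\<dots> = 2 * card ?A" by (simp add: card_cartesian_product)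
  finally have "real (card {S. S \<subseteq> set xs \<and> card (breaks xs S) \<le> t}) \<le> 2 * real (card ?A)"
      by linarith
  also have "\<dots> \<le> 2 * ((1 + x) ^ length xs / x ^ t)"
    using card_small_subsets[of "{..<length xs}" x t] assms by simp
  finally show ?thesis by simp
qed

lemma cross_subset:
  assumes "S \<subseteq> U"
  shows "cross U S \<subseteq> vertex_pairs U"
  using assms unfolding cross_def vertex_pairs_def by (auto simp: card_2_iff)

text \<open>Between one eighth and seven eighths, \<open>s * (m - s)\<close> is smallest at the
  ends, where it is \<open>7 / 64 * m * m\<close>, more than a tenth of the square.\<close>

lemma card_cross_ge:
  assumes "S \<subseteq> U" "finite U" "card U \<le> 8 * card S" "8 * card S \<le> 7 * card U"
  shows "card U * card U div 10 \<le> card (cross U S)"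
proof -
  have fin: "finite S" "finite (U - S)" using assms finite_subset by auto
  have c: "card (cross U S) = card S * card (U - S)"
    unfolding cross_def by (rule card_cross_pairs[OF fin]) auto
  have d: "card (U - S) = card U - card S" using assms fin by (simp add: card_Diff_subset)
  define s m where "s = int (card S)" and "m = int (card U)"
  have sm: "m \<le> 8 * s" "8 * s \<le> 7 * m" using assms unfolding s_def m_def by linarith+
  then have "0 \<le> (8 * s - m) * (7 * m - 8 * s)" by simp
  then have "7 * (m * m) \<le> 64 * (s * (m - s))" by (simp add: algebra_simps)
  moreover have "0 \<le> m * m" by simp
  ultimately have "m * m \<le> 10 * (s * (m - s))" by linarith
  moreover have "int (card (cross U S)) = s * (m - s)"
    unfolding c d s_def m_def using card_mono[OF assms(2,1)] by (simp add: of_nat_diff)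
  ultimately have "int (card U * card U) \<le> int (10 * card (cross U S))" unfolding m_def by simp
  then have "card U * card U \<le> 10 * card (cross U S)" by linarith
  then show ?thesis by linarith
qed

text \<open>Breaks and chords both contribute to the cut, so a balanced set is dangerous only if it
  has few of either. The union bound runs over the sets with at most \<open>t\<close> breaks, each
  weighted by the lower tail
  \<open>2 ^ t * (1/2) ^ card (E \<inter> cross (set xs) S)\<close>.\<close>

lemma expansion_failure_bound:
  fixes p x :: real
  assumes V: "finite V" "set xs \<subseteq> V" and xs: "distinct xs" and p: "0 \<le> p" "p \<le> 1"
      and x: "0 < x" "x \<le> 1"
  defines "m \<equiv> length xs"
  shows "ex_graph V p (\<lambda>E. of_bool (\<exists>S\<subseteq>set xs. m \<le> 8 * card S \<and> 8 * card S \<le> 7 * m \<and>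
       card (breaks xs S) \<le> t \<and> card (E \<inter> cross (set xs) S) \<le> t))
     \<le> 2 * (1 + x) ^ m * (2 / x) ^ t * (1 - p / 2) ^ (m * m div 10)"
proof -
  let ?U = "set xs"
  have cU: "card ?U = m" unfolding m_def using xs by (rule distinct_card)
  define SS where "SS = {S. S \<subseteq> ?U \<and> card (breaks xs S) \<le> t \<and> m \<le> 8 * card S \<and> 8 * card S \<le> 7 * m}"
  have finSS: "finite SS" by (rule finite_subset[of _ "Pow ?U"]) (auto simp: SS_def)
  have cSS: "real (card SS) \<le> 2 * (1 + x) ^ m / x ^ t"
  proof -
    have "card SS \<le> card {S. S \<subseteq> ?U \<and> card (breaks xs S) \<le> t}"
      by (rule card_mono) (auto simp: SS_def)
    then show ?thesis using card_few_breaks[OF x, of xs t] unfolding m_def by linarith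
  qed
  have finV: "finite (vertex_pairs V)" using V by simp
  have "ex_graph V p (\<lambda>E. of_bool (\<exists>S\<subseteq>?U. m \<le> 8 * card S \<and> 8 * card S \<le> 7 * m \<and>
       card (breaks xs S) \<le> t \<and> card (E \<inter> cross ?U S) \<le> t))
     \<le> ex_graph V p (\<lambda>E. \<Sum>S\<in>SS. 2 ^ t * (1/2) ^ card (E \<inter> cross ?U S))"
  proof (rule ex_rsub_mono[OF finV])
    fix E assume "E \<subseteq> vertex_pairs V"
    let ?s = "\<Sum>S\<in>SS. 2 ^ t * (1/2::real) ^ card (E \<inter> cross ?U S)"
    show "of_bool (\<exists>S\<subseteq>?U. m \<le> 8 * card S \<and> 8 * card S \<le> 7 * m \<and>
       card (breaks xs S) \<le> t \<and> card (E \<inter> cross ?U S) \<le> t) \<le> ?s"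
    proof (cases "\<exists>S\<subseteq>?U. m \<le> 8 * card S \<and> 8 * card S \<le> 7 * m \<and>
       card (breaks xs S) \<le> t \<and> card (E \<inter> cross ?U S) \<le> t")
      case True
      then obtain S where S: "S \<in> SS" "card (E \<inter> cross ?U S) \<le> t" unfolding SS_def by blast
      have "(1::real) = 2 ^ t * (1/2) ^ t" by (simp flip: power_mult_distrib)
      also have "\<dots> \<le> 2 ^ t * (1/2) ^ card (E \<inter> cross ?U S)"
        using S(2) by (intro mult_left_mono power_decreasing) auto
      also have "\<dots> \<le> ?s" by (rule member_le_sum[OF S(1)]) (use finSS in auto)
      finally show ?thesis using True by simp
    next
      case False
      have "0 \<le> ?s" by (intro sum_nonneg) simp
      then show ?thesis by (simp only: False of_bool_def if_False)
    qed
  qed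
  also have "\<dots> = (\<Sum>S\<in>SS. 2 ^ t * ex_graph V p (\<lambda>E. (1/2) ^ card (E \<inter> cross ?U S)))"
    using finV by simp
  also have "\<dots> \<le> (\<Sum>S\<in>SS. 2 ^ t * (1 - p / 2) ^ (m * m div 10))"
  proof (intro sum_mono mult_left_mono)
    fix S assume S: "S \<in> SS"
    have sub: "cross ?U S \<subseteq> vertex_pairs V"
      using cross_subset[of S ?U] S V unfolding SS_def vertex_pairs_def by auto
    have "ex_graph V p (\<lambda>E. (1/2) ^ card (E \<inter> cross ?U S)) = (1 - p / 2) ^ card (cross ?U S)"
      by (rule ex_rsub_half_power[OF finV sub p])
    also have "\<dots> \<le> (1 - p / 2) ^ (m * m div 10)"
      using card_cross_ge[of S ?U] S p unfolding SS_def cU by (intro power_decreasing) auto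
    finally show "ex_graph V p (\<lambda>E. (1/2) ^ card (E \<inter> cross ?U S)) \<le> (1 - p / 2) ^ (m * m div 10)" .
  qed simp
  also have "\<dots> = real (card SS) * (2 ^ t * (1 - p / 2) ^ (m * m div 10))" by simp
  also have "\<dots> \<le> (2 * (1 + x) ^ m / x ^ t) * (2 ^ t * (1 - p / 2) ^ (m * m div 10))"
    using cSS p by (intro mult_right_mono) auto
  also have "\<dots> = 2 * (1 + x) ^ m * (2 / x) ^ t * (1 - p / 2) ^ (m * m div 10)"
    by (simp add: power_divide)
  finally show ?thesis .
qed

section \<open>Chords with a common end\<close>

definition chord_degree :: "'a set \<Rightarrow> 'a set set \<Rightarrow> 'a \<Rightarrow> nat" where
  "chord_degree U E u = card {w \<in> U. {u, w} \<in> E}"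

text \<open>The number of ordered pairs of distinct chords with a common end. Its expectation is
  easy, and up to a factor two it bounds both the number of vertices with several chords and the
  number of edges at them.\<close>

definition chord_excess :: "'a set \<Rightarrow> 'a set set \<Rightarrow> nat" where
  "chord_excess U E = (\<Sum>u\<in>U. chord_degree U E u * (chord_degree U E u - 1))"

lemma chord_excess_expectation:
  fixes p :: real
  assumes V: "finite V" "U \<subseteq> V" and p: "0 \<le> p" "p \<le> 1"
  shows "ex_graph V p (\<lambda>E. real (chord_excess U E)) \<le> real (card U) ^ 3 * p\<^sup>2"
proof -
  have finU: "finite U" and finV: "finite (vertex_pairs V)" using V finite_subset by auto
  define T where "T = {(u, w, w'). u \<in> U \<and> w \<in> U \<and> w' \<in> U \<and> w \<noteq> w' \<and> u \<noteq> w \<and> u \<noteq> w'}"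
  have TU: "T \<subseteq> U \<times> U \<times> U" unfolding T_def by auto
  have finT: "finite T" using TU finU by (meson finite_SigmaI finite_subset)
  have "card T \<le> card (U \<times> U \<times> U)" by (rule card_mono[OF _ TU]) (use finU in auto)
  then have cT: "card T \<le> card U ^ 3" by (simp add: card_cartesian_product power3_eq_cube)
  have eq: "real (chord_excess U E) = (\<Sum>(u, w, w')\<in>T. of_bool ({{u, w}, {u, w'}} \<subseteq> E))"
      if E: "E \<subseteq> vertex_pairs V" for E
  proof -
    have one: "chord_degree U E u * (chord_degree U E u - 1) =
       card {(w, w'). w \<in> {w \<in> U. {u, w} \<in> E} \<and> w' \<in> {w \<in> U. {u, w} \<in> E} \<and> w \<noteq> w'}" for u
    proof -
      let ?N = "{w \<in> U. {u, w} \<in> E}"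
      have finN: "finite ?N" using finU by simp
      have "{(w, w'). w \<in> ?N \<and> w' \<in> ?N \<and> w \<noteq> w'} = (SIGMA w:?N. ?N - {w})" by auto
      then have "card {(w, w'). w \<in> ?N \<and> w' \<in> ?N \<and> w \<noteq> w'} = (\<Sum>w\<in>?N. card (?N - {w}))"
        using finN by simp
      also have "\<dots> = (\<Sum>w\<in>?N. card ?N - 1)" by (rule sum.cong) auto
      finally show ?thesis unfolding chord_degree_def by simp
    qed
    have "T \<inter> {(u, w, w'). {{u, w}, {u, w'}} \<subseteq> E} =
      (SIGMA u:U. {(w, w'). w \<in> {w \<in> U. {u, w} \<in> E} \<and> w' \<in> {w \<in> U. {u, w} \<in> E} \<and> w \<noteq> w'})"
    proof -
      have "{u, u} \<notin> E" for u using E by (auto simp: vertex_pairs_def)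
      then show ?thesis unfolding T_def by auto
    qed
    moreover have "finite {(w, w'). w \<in> {w \<in> U. {u, w} \<in> E} \<and> w' \<in> {w \<in> U. {u, w} \<in> E} \<and> w \<noteq> w'}"
        for u
      by (rule finite_subset[of _ "U \<times> U"]) (use finU in auto)
    ultimately have "chord_excess U E = card (T \<inter> {(u, w, w'). {{u, w}, {u, w'}} \<subseteq> E})"
      unfolding chord_excess_def one using finU by simp
    also have "real \<dots> = (\<Sum>y\<in>T. of_bool (y \<in> {(u, w, w'). {{u, w}, {u, w'}} \<subseteq> E}))"
      using finT by simp
    also have "\<dots> = (\<Sum>(u, w, w')\<in>T. of_bool ({{u, w}, {u, w'}} \<subseteq> E))"
      by (rule sum.cong) auto
    finally show ?thesis .
  qed
  have "ex_graph V p (\<lambda>E. real (chord_excess U E)) =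
     ex_graph V p (\<lambda>E. \<Sum>(u, w, w')\<in>T. of_bool ({{u, w}, {u, w'}} \<subseteq> E))"
    by (rule ex_rsub_cong[OF finV eq])
  also have "\<dots> = (\<Sum>(u, w, w')\<in>T. ex_graph V p (\<lambda>E. of_bool ({{u, w}, {u, w'}} \<subseteq> E)))"
    unfolding case_prod_beta using finV by simp
  also have "\<dots> = (\<Sum>(u, w, w')\<in>T. p\<^sup>2)"
  proof (rule sum.cong[OF refl])
    fix y assume "y \<in> T"
    then obtain u w w' where y: "y = (u, w, w')" "u \<in> U" "w \<in> U" "w' \<in> U" "w \<noteq> w'" "u \<noteq> w" "u \<noteq> w'"
      unfolding T_def by auto
    have "{{u, w}, {u, w'}} \<subseteq> vertex_pairs V" using y V by (auto simp: vertex_pairs_def)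
    moreover have "card {{u, w}, {u, w'}} = 2" using y by (auto simp: doubleton_eq_iff)
    ultimately show "(case y of (u, w, w') \<Rightarrow> ex_graph V p (\<lambda>E. of_bool ({{u, w}, {u, w'}} \<subseteq> E)))
       = (case y of (u, w, w') \<Rightarrow> p\<^sup>2)"
      using ex_rsub_subset[OF finV _ p, of "{{u, w}, {u, w'}}"] y(1) by simp
  qed
  also have "\<dots> = real (card T) * p\<^sup>2" by (simp add: case_prod_beta)
  also have "\<dots> \<le> real (card U) ^ 3 * p\<^sup>2" using cT
      by (intro mult_right_mono) (auto simp flip: of_nat_power)
  finally show ?thesis .
qed

definition chord_expander :: "real \<Rightarrow> 'a list \<Rightarrow> 'a set set \<Rightarrow> bool" where
  "chord_expander \<beta> xs E \<longleftrightarrow> (\<exists>F\<subseteq>set xs. 7 * length xs \<le> 8 * card F \<and>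
     cubic_expander \<beta> (path_edges xs \<union> (E \<inter> vertex_pairs (set xs))) F)"

text \<open>Apart from the ends of the path and the vertices with two or more chords, degrees are at
  most \<open>2 + 1\<close>. In \<open>excess\<close>, the two ends account for the 6, with three
  edges each, and a vertex with \<open>d \<ge> 2\<close> chords has at most
  \<open>2 + d \<le> 2 * d * (d - 1)\<close> edges. A balanced set has at least \<open>t + 1\<close>
  breaks or chords across it, both of which count in its cut.\<close>

lemma cubic_expander_of_path_and_chords:
  fixes \<zeta> :: real
  assumes xs: "distinct xs" "m = length xs" "U = set xs" and E: "E \<subseteq> vertex_pairs V" and m: "4 \<le> m"
    and zeta: "0 < \<zeta>" "\<zeta> \<le> 1 / 2"
    and excess: "6 + 2 * chord_excess U E \<le> \<zeta> / 2 * m"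
    and t: "\<zeta> * m \<le> real t + 1"
    and gp: "\<not> (\<exists>S\<subseteq>U. m \<le> 8 * card S \<and> 8 * card S \<le> 7 * m \<and>
       card (breaks xs S) \<le> t \<and> card (E \<inter> cross U S) \<le> t)"
  shows "chord_expander (\<zeta> / 6) xs E"
proof -
  define H where "H = path_edges xs \<union> (E \<inter> vertex_pairs U)"
  have cU: "card U = m" using xs distinct_card by auto
  have finU: "finite U" using xs by simp
  have pe: "path_edges xs \<subseteq> vertex_pairs U"
  proof
    fix e assume "e \<in> path_edges xs"
    then obtain i where i: "Suc i < length xs" "e = {xs ! i, xs ! Suc i}" unfolding path_edges_def
        by blast
    then have "xs ! i \<noteq> xs ! Suc i" using xs(1) by (simp add: nth_eq_iff_index_eq)
    then show "e \<in> vertex_pairs U" using i xs(3) unfolding vertex_pairs_def by simp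
  qed
  have HU: "H \<subseteq> vertex_pairs U" unfolding H_def using pe by auto
  have finH: "finite H" using HU finU finite_subset[OF _ finite_vertex_pairs] by blast
  \<comment> \<open>A set avoiding both ends of the path is left by at least two path edges.\<close>
  define D where "D = {xs ! 0, xs ! (m - 1)} \<union> {u \<in> U. 2 \<le> chord_degree U E u}"
  have len: "0 < length xs" "m - 1 < length xs" using xs(2) m by linarith+
  have ends: "xs ! 0 \<in> U" "xs ! (m - 1) \<in> U" using nth_mem[OF len(1)] nth_mem[OF len(2)]
      unfolding xs(3) .
  have DU: "D \<subseteq> U" unfolding D_def using ends by auto
  have degH: "card {w. {u, w} \<in> H} \<le> 2 + chord_degree U E u" if uU: "u \<in> U" for u
  proof -
    obtain i where i: "i < m" "u = xs ! i" using uU xs by (auto simp: in_set_conv_nth)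
    \<comment> \<open>At an end of the path one of these entries is no neighbour
      (\<open>0 - 1 = 0\<close>, or an index out of range); the inclusion holds all the
      same.\<close>
    have "{w. {u, w} \<in> path_edges xs} \<subseteq> {xs ! (i - 1), xs ! Suc i}"
      unfolding path_edges_def i(2) using xs i(1)
      by (auto simp: doubleton_eq_iff nth_eq_iff_index_eq)
    then have "{w. {u, w} \<in> H} \<subseteq> {xs ! (i - 1), xs ! Suc i} \<union> {w \<in> U. {u, w} \<in> E}"
      unfolding H_def vertex_pairs_def by auto
    then have "card {w. {u, w} \<in> H} \<le> card ({xs ! (i - 1), xs ! Suc i} \<union> {w \<in> U. {u, w} \<in> E})"
      using finU by (intro card_mono) auto
    also have "\<dots> \<le> card {xs ! (i - 1), xs ! Suc i} + chord_degree U E u"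
      unfolding chord_degree_def by (rule card_Un_le)
    also have "card {xs ! (i - 1), xs ! Suc i} \<le> 2" by (simp add: card_insert_if)
    finally show ?thesis by simp
  qed
  have big: "card {u \<in> U. 2 \<le> chord_degree U E u} \<le> chord_excess U E"
    "(\<Sum>u\<in>{u \<in> U. 2 \<le> chord_degree U E u}. 2 + chord_degree U E u) \<le> 2 * chord_excess U E"
  proof -
    let ?B = "{u \<in> U. 2 \<le> chord_degree U E u}"
    have B: "(\<Sum>u\<in>?B. chord_degree U E u * (chord_degree U E u - 1)) \<le> chord_excess U E"
      unfolding chord_excess_def by (rule sum_mono2) (use finU in auto)
    have d: "1 \<le> d * (d - 1) \<and> 2 + d \<le> 2 * (d * (d - 1))" if d2: "2 \<le> d" for d :: nat
    proof -
      have "d * 1 \<le> d * (d - 1)" using d2 by (intro mult_le_mono) auto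
      then show ?thesis using d2 by linarith
    qed
    have "card ?B = (\<Sum>u\<in>?B. 1)" by simp
    also have "\<dots> \<le> (\<Sum>u\<in>?B. chord_degree U E u * (chord_degree U E u - 1))"
      by (rule sum_mono) (use d in auto)
    finally show "card ?B \<le> chord_excess U E" using B by simp
    have "(\<Sum>u\<in>?B. 2 + chord_degree U E u) \<le>
        (\<Sum>u\<in>?B. 2 * (chord_degree U E u * (chord_degree U E u - 1)))"
      by (rule sum_mono) (use d in auto)
    also have "\<dots> = 2 * (\<Sum>u\<in>?B. chord_degree U E u * (chord_degree U E u - 1))"
        by (simp add: sum_distrib_left)
    finally show "(\<Sum>u\<in>?B. 2 + chord_degree U E u) \<le> 2 * chord_excess U E" using B by simp
  qed
  have "\<exists>F\<subseteq>U. 7 * card U \<le> 8 * card F \<and> cubic_expander (\<zeta> / 6) H F"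
  proof (rule cubic_expander_extraction[OF finU HU DU])
    show "4 \<le> card U" using cU m by simp
    show "0 < \<zeta>" by (rule zeta)
    show "8 * card D < card U"
    proof -
      have "card D \<le> card {xs ! 0, xs ! (m - 1)} + card {u \<in> U. 2 \<le> chord_degree U E u}"
        unfolding D_def by (rule card_Un_le)
      also have "card {xs ! 0, xs ! (m - 1)} \<le> 2" by (simp add: card_insert_if)
      finally have "real (card D) \<le> 2 + real (chord_excess U E)" using big(1) by linarith
      moreover have "\<zeta> / 2 * m \<le> m / 4" using zeta mult_right_mono[of \<zeta> "1 / 2" "real m"] by simp
      ultimately have "8 * real (card D) < real m" using excess by linarith
      then show ?thesis using cU by linarith
    qed
    show "card {w. {u, w} \<in> H} \<le> 3" if "u \<in> U - D" for u
      using degH[of u] that unfolding D_def by auto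
    show "2 \<le> card (cutset H S)" if S: "S \<subseteq> U - D" "S \<noteq> {}" for S
    proof -
      define I where "I = {i. i < m \<and> xs ! i \<in> S}"
      have finI: "finite I" unfolding I_def by simp
      obtain y where "y \<in> S" "y \<in> U" using S by auto
      then have I0: "I \<noteq> {}" using xs unfolding I_def by (auto simp: in_set_conv_nth)
      define a b where "a = Min I" and "b = Max I"
      have a: "a \<in> I" "\<And>i. i \<in> I \<Longrightarrow> a \<le> i" unfolding a_def using finI I0 by auto
      have b: "b \<in> I" "\<And>i. i \<in> I \<Longrightarrow> i \<le> b" unfolding b_def using finI I0 by auto
      have S0: "xs ! 0 \<notin> S" "xs ! (m - 1) \<notin> S" using S(1) unfolding D_def by blast+
      have am: "a < m" "xs ! a \<in> S" "b < m" "xs ! b \<in> S" using a(1) b(1) unfolding I_def by auto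
      have a0: "a \<noteq> 0"
      proof
        assume "a = 0"
        then show False using am S0 by simp
      qed
      have bm: "b \<noteq> m - 1"
      proof
        assume "b = m - 1"
        then show False using am S0 by simp
      qed
      have "a - 1 \<notin> I"
      proof
        assume "a - 1 \<in> I"
        from a(2)[OF this] a0 show False by linarith
      qed
      then have "xs ! (a - 1) \<notin> S" using am unfolding I_def by simp
      then have ab: "a - 1 \<in> breaks xs S" using am a0 xs(2) unfolding breaks_def by simp
      have Sb: "Suc b < m" using am bm by linarith
      have "Suc b \<notin> I"
      proof
        assume "Suc b \<in> I"
        from b(2)[OF this] show False by simp
      qed
      then have "xs ! Suc b \<notin> S" using Sb unfolding I_def by simp
      then have "b \<in> breaks xs S" using am Sb xs(2) unfolding breaks_def by simp
      then have "{a - 1, b} \<subseteq> breaks xs S" using ab by simp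
      moreover have "a - 1 \<noteq> b" using a(2)[OF b(1)] a0 by linarith
      moreover have "finite (breaks xs S)"
          by (rule finite_subset[of _ "{..<length xs}"]) (auto simp: breaks_def)
      ultimately have "2 \<le> card (breaks xs S)" using card_mono[of "breaks xs S" "{a - 1, b}"]
          by simp
      also have "\<dots> \<le> card (cutset H S)" by (rule card_breaks_le[OF xs(1) finH]) (auto simp: H_def)
      finally show ?thesis .
    qed
    show "\<zeta> * card U \<le> card (cutset H S)"
      if S: "S \<subseteq> U" "card U \<le> 8 * card S" "8 * card S \<le> 7 * card U" for S
    proof -
      have "t < card (breaks xs S) \<or> t < card (E \<inter> cross U S)" using gp S cU by (meson not_less)
      moreover have "card (breaks xs S) \<le> card (cutset H S)"
        by (rule card_breaks_le[OF xs(1) finH]) (auto simp: H_def)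
      moreover have "card (E \<inter> cross U S) \<le> card (cutset H S)"
      proof (rule card_mono)
        show "finite (cutset H S)" using finH by (simp add: cutset_def)
        show "E \<inter> cross U S \<subseteq> cutset H S"
          using cross_subset[OF S(1)] unfolding H_def cutset_def by (auto simp: cross_def)
      qed
      ultimately have "Suc t \<le> card (cutset H S)" by linarith
      then have "real t + 1 \<le> card (cutset H S)" by linarith
      then show ?thesis using t cU by simp
    qed
    show "card (cutset H D) \<le> \<zeta> / 2 * card U"
    proof -
      let ?B = "{u \<in> U. 2 \<le> chord_degree U E u}"
      let ?h = "\<lambda>u. card {e \<in> H. u \<in> e}"
      have h: "?h u \<le> 2 + chord_degree U E u" if "u \<in> U" for u
        using card_edges_at(1)[OF HU finU, of u] degH[OF that] by simp
      have D: "D = (D - ?B) \<union> ?B" "finite D" using DU finU finite_subset by (auto simp: D_def)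
      have "cutset H D \<subseteq> (\<Union>u\<in>D. {e \<in> H. u \<in> e})" unfolding cutset_def by auto
      then have "card (cutset H D) \<le> card (\<Union>u\<in>D. {e \<in> H. u \<in> e})" using finH D(2)
          by (intro card_mono) auto
      also have "\<dots> \<le> (\<Sum>u\<in>D. ?h u)" by (rule card_UN_le[OF D(2)])
      also have "\<dots> = (\<Sum>u\<in>D - ?B. ?h u) + (\<Sum>u\<in>?B. ?h u)"
        using D(2) by (subst D(1), subst sum.union_disjoint) (auto simp: finU)
      also have "(\<Sum>u\<in>D - ?B. ?h u) \<le> (\<Sum>u\<in>D - ?B. 3)"
        by (rule sum_mono) (use h DU in fastforce)
      also have "(\<Sum>u\<in>D - ?B. 3) \<le> (\<Sum>u\<in>{xs ! 0, xs ! (m - 1)}. 3::nat)"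
        by (rule sum_mono2) (auto simp: D_def)
      also have "\<dots> \<le> 6" by (simp add: card_insert_if)
      also have "(\<Sum>u\<in>?B. ?h u) \<le> (\<Sum>u\<in>?B. 2 + chord_degree U E u)" by (rule sum_mono) (use h in auto)
      also have "\<dots> \<le> 2 * chord_excess U E" by (rule big(2))
      finally have "card (cutset H D) \<le> 6 + 2 * chord_excess U E" by simp
      then have "real (card (cutset H D)) \<le> 6 + 2 * real (chord_excess U E)" by linarith
      then show ?thesis using excess cU by simp
    qed
  qed
  then show ?thesis unfolding chord_expander_def H_def cU unfolding xs(2,3) .
qed

text \<open>The choice \<open>x = \<delta>\<^sup>2 / 160\<close> makes the number of break sets and
  the factor \<open>(2 / x) ^ t\<close> cost at most \<open>exp (\<delta>\<^sup>2 * m / 160)\<close>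
  each, against a gain of \<open>exp (\<delta>\<^sup>2 * m / 40)\<close> from the chords. The
  additional power of \<delta> in \<open>t\<close> absorbs the logarithm of \<open>2 / x\<close>, by
  \<open>ln\<close>.\<close>

lemma expansion_exponent:
  fixes \<delta> :: real
  assumes d: "0 < \<delta>" "\<delta> \<le> 1" and ln: "\<delta> * ln (320 / \<delta>\<^sup>2) \<le> 1 / 160" and m: "5 \<le> m"
    and t: "real t \<le> \<delta> ^ 3 * m"
  shows "2 * (1 + \<delta>\<^sup>2 / 160) ^ m * (2 / (\<delta>\<^sup>2 / 160)) ^ t * (1 - \<delta>\<^sup>2 / m / 2) ^ (m * m div 10)
     \<le> 2 * exp (- (\<delta>\<^sup>2 * m / 80))"
proof -
  let ?x = "\<delta>\<^sup>2 / 160" and ?k = "m * m div 10" and ?L = "ln (320 / \<delta>\<^sup>2)"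
  have d2: "0 < \<delta>\<^sup>2" "\<delta>\<^sup>2 \<le> 1" using d by (auto simp: power_le_one)
  have m0: "0 < real m" using m by simp
  have A: "(1 + ?x) ^ m \<le> exp (?x * m)"
  proof -
    have "(1 + ?x) ^ m \<le> exp ?x ^ m" using d2 by (intro power_mono exp_ge_add_one_self) auto
    then show ?thesis by (simp add: exp_of_nat_mult[symmetric] mult.commute)
  qed
  have L0: "0 \<le> ?L" using d2 by (intro ln_ge_zero) (simp add: field_simps)
  have B: "(2 / ?x) ^ t \<le> exp (?x * m)"
  proof -
    have "(2 / ?x) ^ t = exp ?L ^ t" using d2 by simp
    also have "\<dots> = exp (real t * ?L)" by (simp add: exp_of_nat_mult)
    also have "\<dots> \<le> exp (?x * m)"
    proof -
      have "real t * ?L \<le> \<delta> ^ 3 * m * ?L" using t L0 by (intro mult_right_mono)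
      also have "\<dots> = (\<delta> * ?L) * (\<delta>\<^sup>2 * m)" by (simp add: power2_eq_square power3_eq_cube)
      also have "\<dots> \<le> (1 / 160) * (\<delta>\<^sup>2 * m)" using ln by (intro mult_right_mono) auto
      finally show ?thesis by simp
    qed
    finally show ?thesis .
  qed
  have C: "(1 - \<delta>\<^sup>2 / m / 2) ^ ?k \<le> exp (- (\<delta>\<^sup>2 * m / 40))"
  proof -
    have le1: "\<delta>\<^sup>2 / m \<le> 1" using d2 m by (simp add: field_simps)
    have "1 - \<delta>\<^sup>2 / m / 2 \<le> exp (- (\<delta>\<^sup>2 / m / 2))" using exp_ge_add_one_self[of "- (\<delta>\<^sup>2 / m / 2)"]
        by simp
    then have "(1 - \<delta>\<^sup>2 / m / 2) ^ ?k \<le> exp (- (\<delta>\<^sup>2 / m / 2)) ^ ?k" using le1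
        by (intro power_mono) auto
    also have "\<dots> = exp (- (real ?k * (\<delta>\<^sup>2 / m / 2)))" by (simp flip: exp_of_nat_mult)
    also have "\<dots> \<le> exp (- (\<delta>\<^sup>2 * m / 40))"
    proof -
      have "20 \<le> m * m" using mult_le_mono[OF m m] by simp
      then have "m * m \<le> 20 * ?k" by linarith
      then have "real (m * m) \<le> real (20 * ?k)" by (rule of_nat_mono)
      then have "real m * real m / 20 \<le> real ?k" by simp
      then have "(real m * real m / 20) * (\<delta>\<^sup>2 / m / 2) \<le> real ?k * (\<delta>\<^sup>2 / m / 2)"
        using d2 m0 by (intro mult_right_mono) auto
      moreover have "(real m * real m / 20) * (\<delta>\<^sup>2 / m / 2) = \<delta>\<^sup>2 * m / 40" using m0
          by (simp add: field_simps)
      ultimately have "\<delta>\<^sup>2 * m / 40 \<le> real ?k * (\<delta>\<^sup>2 / m / 2)" by (simp only:)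
      then show ?thesis by (simp only: exp_le_cancel_iff neg_le_iff_le)
    qed
    finally show ?thesis .
  qed
  have "2 * (1 + ?x) ^ m * (2 / ?x) ^ t * (1 - \<delta>\<^sup>2 / m / 2) ^ ?k
     \<le> 2 * exp (?x * m) * exp (?x * m) * exp (- (\<delta>\<^sup>2 * m / 40))"
  proof (intro mult_mono A B C)
    have "\<delta>\<^sup>2 / m / 2 \<le> 1" using d2 m by (simp add: field_simps)
    then show "0 \<le> (1 - \<delta>\<^sup>2 / m / 2) ^ ?k" by simp
  qed (use d2 in auto)
  also have "\<dots> = 2 * exp (- (\<delta>\<^sup>2 * m / 80))" by (simp add: exp_add[symmetric] field_simps)
  finally show ?thesis .
qed

text \<open>A failure is charged to a balanced set with few breaks and chords or, by Markov's
  inequality, to a large chord excess. Twice its mean \<open>\<delta> ^ 4 * m\<close> against the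
  threshold \<open>\<delta> ^ 3 / 2 * m\<close> gives \<open>4 * \<delta>\<close>; the ends of the
  path give \<open>12 / (\<delta> ^ 3 * m)\<close>.\<close>

lemma cubic_expander_failure_bound:
  fixes \<delta> :: real
  assumes d: "0 < \<delta>" "\<delta> \<le> 1 / 2" and ln: "\<delta> * ln (320 / \<delta>\<^sup>2) \<le> 1 / 160"
      and m: "5 \<le> m" "m = length xs"
    and V: "finite V" "set xs \<subseteq> V" and xs: "distinct xs"
  shows "ex_graph V (\<delta>\<^sup>2 / m) (\<lambda>E. of_bool (\<not> chord_expander (\<delta> ^ 3 / 6) xs E))
     \<le> 2 * exp (- (\<delta>\<^sup>2 * m / 80)) + (4 * \<delta> + 12 / (\<delta> ^ 3 * m))"
proof -
  let ?p = "\<delta>\<^sup>2 / m" and ?U = "set xs" and ?z = "\<delta> ^ 3"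
  define t where "t = nat \<lfloor>?z * m\<rfloor>"
  have z0: "0 < ?z" using d by simp
  have d2: "0 < \<delta>\<^sup>2" "\<delta>\<^sup>2 \<le> 1" using d by (auto simp: power_le_one)
  have m0: "0 < real m" using m(1) by linarith
  have "\<delta>\<^sup>2 \<le> real m" using d2 m(1) by linarith
  then have p: "0 \<le> ?p" "?p \<le> 1" using m0 by (simp_all add: divide_le_eq)
  have "0 \<le> ?z * m" using z0 by simp
  then have t: "real t \<le> ?z * m" "?z * m \<le> real t + 1" unfolding t_def by linarith+
  have z2: "?z \<le> 1 / 2"
  proof -
    have "\<delta> ^ 3 \<le> \<delta> ^ 1" using d by (intro power_decreasing) auto
    then show ?thesis using d by simp
  qed
  define gp where "gp E \<longleftrightarrow> (\<exists>S\<subseteq>?U. m \<le> 8 * card S \<and> 8 * card S \<le> 7 * m \<and>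
       card (breaks xs S) \<le> t \<and> card (E \<inter> cross ?U S) \<le> t)" for E
  have finV: "finite (vertex_pairs V)" using V by simp
  let ?bad = "\<lambda>E. \<not> chord_expander (?z / 6) xs E"
  let ?c = "2 / (?z * m)"
  have "ex_graph V ?p (\<lambda>E. of_bool (?bad E)) \<le>
     ex_graph V ?p (\<lambda>E. of_bool (gp E) + (6 + 2 * real (chord_excess ?U E)) * ?c)"
  proof (rule ex_rsub_mono[OF finV])
    fix E assume E: "E \<subseteq> vertex_pairs V"
    have nn: "0 \<le> (6 + 2 * real (chord_excess ?U E)) * ?c" using z0 by simp
    show "of_bool (?bad E) \<le> of_bool (gp E) + (6 + 2 * real (chord_excess ?U E)) * ?c"
    proof (cases "gp E")
      case True
      then show ?thesis using nn by simp
    next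
      case False
      show ?thesis
      proof (cases "6 + 2 * chord_excess ?U E \<le> ?z / 2 * m")
        case True
        have m4: "4 \<le> m" using m(1) by simp
        from cubic_expander_of_path_and_chords[OF xs m(2) refl E m4 z0 z2 True t(2) False[unfolded
            gp_def]]
        have nb: "(?bad E) = False" by blast
        show ?thesis unfolding nb using nn by simp
      next
        case F2: False
        then have "?z / 2 * m < 6 + 2 * real (chord_excess ?U E)" by simp
        then have "1 \<le> (6 + 2 * real (chord_excess ?U E)) * ?c" using z0 m0
            by (simp add: field_simps)
        then show ?thesis by (simp add: of_bool_def)
      qed
    qed
  qed
  also have "\<dots> = ex_graph V ?p (\<lambda>E. of_bool (gp E)) +
      (6 + 2 * ex_graph V ?p (\<lambda>E. real (chord_excess ?U E))) * ?c"
    using finV by simp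
  also have "ex_graph V ?p (\<lambda>E. of_bool (gp E)) \<le> 2 * exp (- (\<delta>\<^sup>2 * m / 80))"
  proof -
    have x: "0 < \<delta>\<^sup>2 / 160" "\<delta>\<^sup>2 / 160 \<le> 1" using d2 by auto
    have "\<delta> \<le> 1" using d by simp
    from order_trans[OF expansion_failure_bound[OF V xs p x, of t, folded m(2)]
       expansion_exponent[OF d(1) this ln m(1) t(1)]]
    show ?thesis unfolding gp_def .
  qed
  also have "ex_graph V ?p (\<lambda>E. real (chord_excess ?U E)) \<le> m * \<delta> ^ 4"
  proof -
    have "ex_graph V ?p (\<lambda>E. real (chord_excess ?U E)) \<le> real (card ?U) ^ 3 * ?p\<^sup>2"
      by (rule chord_excess_expectation[OF V p])
    also have "\<dots> = m * \<delta> ^ 4"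
      using xs m m0 by (simp add: distinct_card power_divide power2_eq_square power3_eq_cube
          power4_eq_xxxx field_simps)
    finally show ?thesis .
  qed
  also have "(6 + 2 * (m * \<delta> ^ 4)) * ?c = 4 * \<delta> + 12 / (\<delta> ^ 3 * m)"
  proof -
    have "(6 + 2 * (m * (\<delta> * w))) * (2 / (w * m)) = 4 * \<delta> + 12 / (w * m)" if "0 < w" for w :: real
      using that m0 by (simp add: field_simps)
    moreover have "\<delta> ^ 4 = \<delta> * \<delta> ^ 3" by (simp add: power_numeral_reduce)
    ultimately show ?thesis using z0 by simp
  qed
  finally show ?thesis using z0 by (simp add: divide_right_mono mult_right_mono)
qed

lemma cubic_expander_failure_small:
  fixes \<eta> \<delta>0 :: real
  assumes "0 < \<eta>" "0 < \<delta>0"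
  shows "\<exists>\<delta> M. 0 < \<delta> \<and> \<delta> \<le> \<delta>0 \<and> \<delta> \<le> 1 / 2 \<and> (\<forall>V xs. finite V \<longrightarrow> set xs \<subseteq> V \<longrightarrow> distinct xs \<longrightarrow>
      M \<le> length xs \<longrightarrow>
     ex_graph V (\<delta>\<^sup>2 / length xs) (\<lambda>E. of_bool (\<not> chord_expander (\<delta> ^ 3 / 6) xs E)) \<le> \<eta>)"
proof -
  have "((\<lambda>d::real. d * ln (320 / d\<^sup>2)) \<longlongrightarrow> 0) (at_right 0)" by real_asymp
  then have ev: "\<forall>\<^sub>F d in at_right (0::real). d * ln (320 / d\<^sup>2) < 1 / 160"
      by (rule order_tendstoD) simp
  have "\<forall>\<^sub>F d in at_right (0::real). d \<in> {0<..<min \<delta>0 (min (1/2) (\<eta> / 16))}"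
    by (rule eventually_at_right_real) (use assms in auto)
  with ev have "\<forall>\<^sub>F d in at_right (0::real). d * ln (320 / d\<^sup>2) < 1 / 160 \<and>
      d \<in> {0<..<min \<delta>0 (min (1/2) (\<eta> / 16))}"
    by (rule eventually_conj)
  from eventually_happens'[OF trivial_limit_at_right_real this] obtain \<delta> :: real where
    dd: "\<delta> * ln (320 / \<delta>\<^sup>2) < 1 / 160 \<and> \<delta> \<in> {0<..<min \<delta>0 (min (1/2) (\<eta> / 16))}" by blast
  then have d: "0 < \<delta>" "\<delta> \<le> \<delta>0" "\<delta> \<le> 1 / 2" "\<delta> \<le> \<eta> / 16" "\<delta> * ln (320 / \<delta>\<^sup>2) \<le> 1 / 160" by auto
  have "((\<lambda>m::nat. 2 * exp (- (\<delta>\<^sup>2 * m / 80)) + (4 * \<delta> + 12 / (\<delta> ^ 3 * m))) \<longlongrightarrow> 4 * \<delta>) sequentially"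
    using d by real_asymp
  then have "\<forall>\<^sub>F m in sequentially. 2 * exp (- (\<delta>\<^sup>2 * real m / 80)) + (4 * \<delta> + 12 / (\<delta> ^ 3 * m)) <
      \<eta>"
    by (rule order_tendstoD) (use d assms in linarith)
  then obtain M where M: "\<And>m. M \<le> m \<Longrightarrow> 2 * exp (- (\<delta>\<^sup>2 * real m / 80)) + (4 * \<delta> + 12 / (\<delta> ^ 3 * m)) <
      \<eta>"
    by (auto simp: eventually_at_top_linorder)
  show ?thesis
  proof (intro exI[of _ \<delta>] exI[of _ "max 5 M"] conjI allI impI)
    fix V :: "'a set" and xs assume a: "finite V" "set xs \<subseteq> V" "distinct xs" "max 5 M \<le> length xs"
    from a(4) have "5 \<le> length xs" "M \<le> length xs" by auto
    from order_trans[OF cubic_expander_failure_bound[OF d(1,3,5) this(1) refl a(1-3)] less_imp_le[OF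
        M[OF this(2)]]]
    show "ex_graph V (\<delta>\<^sup>2 / length xs) (\<lambda>E. of_bool (\<not> chord_expander (\<delta> ^ 3 / 6) xs E)) \<le> \<eta>" .
  qed (use d in auto)
qed

text \<open>About \<open>e * n\<^sup>2 / 4\<close> queries find \<open>e * (1 + e) * n / 4\<close>
  edges on average; \<open>k\<close> is smaller by a relative gap of order \<open>e\<close>. Still
  \<open>k * (n - k)\<close> exceeds \<open>N\<close> by order \<open>e\<^sup>2 * n\<^sup>2\<close>,
  which leaves room for a stack of order \<open>e\<^sup>2 * n\<close>. A relative deviation
  \<open>e\<close> among order \<open>e * n\<close> edges costs the exponent
  \<open>e ^ 3 * n\<close>.\<close>

lemma path_failure_small:
  fixes e :: real
  assumes e: "0 < e" "e \<le> 1 / 2"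
  shows "\<exists>N0. \<forall>V :: 'a set. finite V \<longrightarrow> N0 \<le> card V \<longrightarrow>
     ex_graph V ((1 + e) / card V) (\<lambda>E. of_bool (\<not> has_path V (nat \<lfloor>e\<^sup>2 * card V / 80\<rfloor>) E))
       \<le> exp (1 - e ^ 3 * card V / 256)"
proof -
  define N0 where "N0 = nat \<lceil>1000 / e\<^sup>2\<rceil>"
  show ?thesis
  proof (intro exI[of _ N0] allI impI)
    fix V :: "'a set" assume fin: "finite V" and big: "N0 \<le> card V"
    define n where "n = real (card V)"
    have e2: "0 < e\<^sup>2" "e\<^sup>2 \<le> e / 2" using e by (auto simp: power2_eq_square)
    have n: "1000 / e\<^sup>2 \<le> n" using big unfolding N0_def n_def by linarith
    have ne2: "1000 \<le> e\<^sup>2 * n" using n e2 by (simp add: field_simps)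
    have n0: "0 < n" using n e2 by (metis divide_pos_pos less_le_trans zero_less_numeral)
    have ne: "2000 \<le> e * n" using ne2 mult_right_mono[OF e2(2), of n] n0 by linarith
    have nn: "4000 \<le> n" using ne mult_right_mono[OF e(2), of n] n0 by linarith
    define l N k where "l = nat \<lfloor>e\<^sup>2 * n / 80\<rfloor>" and "N = nat \<lfloor>e * n\<^sup>2 / 4\<rfloor>"
        and "k = nat \<lceil>e * (1 + e / 2) * n / 4\<rceil>"
    have l: "real l \<le> e\<^sup>2 * n / 80" "e\<^sup>2 * n / 80 - 1 \<le> real l"
      unfolding l_def using e2 n0 by (auto simp: floor_le_iff) linarith+
    have N: "real N \<le> e * n\<^sup>2 / 4" "e * n\<^sup>2 / 4 - 1 \<le> real N"
    proof -
      have "0 \<le> e * n\<^sup>2 / 4" using e by simp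
      then show "real N \<le> e * n\<^sup>2 / 4" "e * n\<^sup>2 / 4 - 1 \<le> real N" unfolding N_def by linarith+
    qed
    have k: "e * (1 + e / 2) * n / 4 \<le> real k" "real k \<le> e * (1 + e / 2) * n / 4 + 1"
    proof -
      have "0 \<le> e * (1 + e / 2) * n / 4" using e n0 by simp
      then show "e * (1 + e / 2) * n / 4 \<le> real k" "real k \<le> e * (1 + e / 2) * n / 4 + 1"
          unfolding k_def by linarith+
    qed
    have k_eq: "e * (1 + e / 2) * n / 4 = e * n / 4 + e\<^sup>2 * n / 8"
        by (simp add: field_simps power2_eq_square)
    have en: "e * n \<le> n / 2" "e\<^sup>2 * n \<le> n / 4" "e\<^sup>2 * n \<le> e * n / 2"
    proof -
      show "e * n \<le> n / 2" using mult_right_mono[OF e(2), of n] n0 by linarith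
      show "e\<^sup>2 * n \<le> e * n / 2" using mult_right_mono[OF e2(2), of n] n0 by linarith
      then show "e\<^sup>2 * n \<le> n / 4" using \<open>e * n \<le> n / 2\<close> by simp
    qed
    have kl: "l < k"
    proof -
      have "real l < real k" using l(1) k(1) k_eq en ne by linarith
      then show ?thesis by simp
    qed
    have l1: "1 \<le> l" using l(2) ne2 by linarith
    have k2: "2 * k \<le> card V"
    proof -
      have "2 * real k \<le> n" using k(2) k_eq en nn by linarith
      then show ?thesis unfolding n_def by linarith
    qed
    have l2: "2 * l + 2 < card V"
    proof -
      have "2 * real l + 2 < n" using l(1) en nn by linarith
      then show ?thesis unfolding n_def by linarith
    qed
    have half: "2 * N < card V div 2 * (card V - 2 * l - 2)"
    proof -
      have "n - 1 \<le> 2 * real (card V div 2)" unfolding n_def by linarith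
      then have a: "n / 2 - 1/2 \<le> real (card V div 2)" by simp
      have b: "n - 2 * real l - 2 \<le> real (card V - 2 * l - 2)" using l2 unfolding n_def by linarith
      have b': "9 / 10 * n \<le> n - 2 * real l - 2" using l(1) en nn by linarith
      have "2 * real N \<le> n\<^sup>2 / 4" using N(1) mult_right_mono[OF e(2), of "n\<^sup>2"] by simp
      also have "\<dots> < (n / 2 - 1 / 2) * (9 / 10 * n)"
      proof -
        have "n * 4000 \<le> n * n" using nn n0 by (intro mult_left_mono) auto
        then show ?thesis using nn by (simp add: field_simps power2_eq_square)
      qed
      also have "\<dots> \<le> real (card V div 2) * real (card V - 2 * l - 2)"
        using a b b' nn by (intro mult_mono) auto
      finally have "real (2 * N) < real (card V div 2 * (card V - 2 * l - 2))"
        by (simp only: of_nat_mult of_nat_numeral)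
      then show ?thesis by (simp only: of_nat_less_iff)
    qed
    have main: "int N < (int k - int l) * (int (card V) - int k)"
    proof -
      \<comment> \<open>In \<open>A * B\<close> the term of order \<open>e * n\<^sup>2\<close>
        cancels against \<open>N\<close>. Of order \<open>e\<^sup>2 * n\<^sup>2\<close> there
        remains \<open>1 / 16 - 1 / 80 = 1 / 20\<close>, where \<open>1 / 80\<close> is the share of
        \<open>l\<close>.\<close>
      define A B where "A = e * n / 4 + e\<^sup>2 * n / 8 - e\<^sup>2 * n / 80"
          and "B = n - e * n / 4 - e\<^sup>2 * n / 8 - 1"
      have kA: "A \<le> real k - real l" using k(1) k_eq l(1) unfolding A_def by linarith
      have kB: "B \<le> n - real k" using k(2) k_eq unfolding B_def by linarith
      have A0: "0 \<le> A" unfolding A_def using e n0 by (simp add: field_simps)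
      have B0: "0 \<le> B" unfolding B_def using en nn by linarith
      have "e * n\<^sup>2 / 4 < A * B"
      proof -
        have "A * B - e * n\<^sup>2 / 4 =
            n\<^sup>2 * (e / 4 + e\<^sup>2 / 8 - e\<^sup>2 / 80) * (1 - e / 4 - e\<^sup>2 / 8) - A - e * n\<^sup>2 / 4"
          unfolding A_def B_def by (simp add: field_simps power2_eq_square)
        also have "n\<^sup>2 * (e / 4 + e\<^sup>2 / 8 - e\<^sup>2 / 80) * (1 - e / 4 - e\<^sup>2 / 8) =
           n\<^sup>2 * e / 4 + n\<^sup>2 * e\<^sup>2 * (1 / 20 - e * 19 / 320 - e\<^sup>2 * 9 / 640)"
          by (simp add: field_simps power2_eq_square)
        also have "\<dots> - A - e * n\<^sup>2 / 4 = n\<^sup>2 * e\<^sup>2 * (1 / 20 - e * 19 / 320 - e\<^sup>2 * 9 / 640) - A"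
            by (simp add: field_simps)
        finally have eq: "A * B - e * n\<^sup>2 / 4 =
            n\<^sup>2 * e\<^sup>2 * (1 / 20 - e * 19 / 320 - e\<^sup>2 * 9 / 640) - A" .
        have "1 / 80 \<le> 1 / 20 - e * 19 / 320 - e\<^sup>2 * 9 / 640" using e e2 by linarith
        then have "n\<^sup>2 * e\<^sup>2 * (1 / 80) \<le> n\<^sup>2 * e\<^sup>2 * (1 / 20 - e * 19 / 320 - e\<^sup>2 * 9 / 640)"
            by (intro mult_left_mono) auto
        moreover have "A < n" unfolding A_def using en n0 by linarith
        moreover have "n * 1000 \<le> n\<^sup>2 * e\<^sup>2" using ne2 mult_left_mono[of 1000 "e\<^sup>2 * n" n] n0
            by (simp add: power2_eq_square mult_ac)
        ultimately show ?thesis using eq n0 by linarith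
      qed
      also have "A * B \<le> (real k - real l) * (n - real k)" using kA kB A0 B0
          by (intro mult_mono) auto
      finally have "real N < (real k - real l) * (n - real k)" using N(1) by linarith
      then have "real_of_int (int N) < real_of_int ((int k - int l) * (int (card V) - int k))"
          unfolding n_def by simp
      then show ?thesis by (simp only: of_int_less_iff)
    qed
    \<comment> \<open>The tilt \<open>z = 1 - s\<close>: its second-order loss, a factor
      \<open>1 + 2 * s = 1 + e / 8\<close> on \<open>k\<close>, stays well below the relative gap of
      about \<open>e / 2\<close> between \<open>k\<close> and \<open>p * N\<close>.\<close>
    define p s where "p = (1 + e) / n" and "s = e / 16"
    have p: "0 \<le> p" "p \<le> 1" unfolding p_def using e nn by (auto simp: field_simps)
    have s: "0 < s" "s \<le> 1 / 32" unfolding s_def using e by auto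
    have "ex_graph V p (\<lambda>E. of_bool (\<not> has_path V l E)) \<le> (1 - p + p * (1 - s)) ^ N / (1 - s) ^ k"
      by (rule path_failure_bound[OF fin p _ _ main half l1 kl k2 l2]) (use s in auto)
    also have "\<dots> \<le> exp (- (p * s * N)) / exp (- (k * (s + 2 * s\<^sup>2)))"
    proof (rule frac_le)
      have "1 - p + p * (1 - s) = 1 - p * s" by (simp add: algebra_simps)
      also have "\<dots> ^ N \<le> exp (- (p * s)) ^ N"
      proof (rule power_mono)
        show "1 - p * s \<le> exp (- (p * s))" using exp_ge_add_one_self[of "- (p * s)"] by simp
        have "p * s \<le> 1 * 1" using p s by (intro mult_mono) auto
        then show "0 \<le> 1 - p * s" by simp
      qed
      also have "\<dots> = exp (- (p * s * N))" by (simp add: exp_of_nat_mult[symmetric] mult_ac)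
      finally show "(1 - p + p * (1 - s)) ^ N \<le> exp (- (p * s * N))" .
      have "exp (- (s + 2 * s\<^sup>2)) \<le> 1 - s"
      proof -
        have "- s - 2 * s\<^sup>2 \<le> ln (1 - s)" using s by (intro ln_one_minus_pos_lower_bound) auto
        then have "exp (- s - 2 * s\<^sup>2) \<le> exp (ln (1 - s))" by simp
        then show ?thesis using s by simp
      qed
      then have "exp (- (s + 2 * s\<^sup>2)) ^ k \<le> (1 - s) ^ k" by (intro power_mono) auto
      then show "exp (- (k * (s + 2 * s\<^sup>2))) \<le> (1 - s) ^ k"
        by (simp only: exp_of_nat_mult[symmetric] mult_minus_right)
    qed auto
    also have "\<dots> = exp (s * (k * (1 + 2 * s) - p * N))"
      by (simp add: exp_diff[symmetric] algebra_simps power2_eq_square)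
    also have "\<dots> \<le> exp (1 - e ^ 3 * n / 256)"
    proof -
      have "k * (1 + 2 * s) \<le> (e * (1 + e / 2) * n / 4 + 1) * (1 + 2 * s)" using k(2) s
          by (intro mult_right_mono) auto
      also have "\<dots> = e * n / 4 * (1 + 5 * e / 8 + e\<^sup>2 / 16) + (1 + e / 8)"
        unfolding s_def by (simp add: field_simps power2_eq_square)
      also have "\<dots> \<le> e * n / 4 * (1 + 21 * e / 32) + 2"
      proof -
        have "1 + 5 * e / 8 + e\<^sup>2 / 16 \<le> 1 + 21 * e / 32" using e2 by linarith
        then have "e * n / 4 * (1 + 5 * e / 8 + e\<^sup>2 / 16) \<le> e * n / 4 * (1 + 21 * e / 32)"
          using e n0 by (intro mult_left_mono) auto
        then show ?thesis using e by linarith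
      qed
      finally have 1: "k * (1 + 2 * s) \<le> e * n / 4 * (1 + 21 * e / 32) + 2" .
      have "p * (e * n\<^sup>2 / 4 - 1) \<le> p * N" using N(2) p by (intro mult_left_mono)
      moreover have "p * (e * n\<^sup>2 / 4 - 1) = (1 + e) * (e * n / 4) - p"
        unfolding p_def using n0 by (simp add: field_simps power2_eq_square)
      ultimately have 2: "(1 + e) * (e * n / 4) - 1 \<le> p * N" using p by linarith
      have "k * (1 + 2 * s) - p * N \<le> 3 - e * n / 4 * (11 * e / 32)"
        using 1 2 by (simp add: field_simps)
      then have "s * (k * (1 + 2 * s) - p * N) \<le> s * (3 - e * n / 4 * (11 * e / 32))" using s
          by (intro mult_left_mono) auto
      also have "\<dots> = 3 * s - e ^ 3 * n * (11 / 2048)" unfolding s_def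
          by (simp add: field_simps power3_eq_cube)
      also have "\<dots> \<le> 1 - e ^ 3 * n / 256"
      proof -
        have "0 \<le> e ^ 3 * n" using e n0 by simp
        then show ?thesis using s by linarith
      qed
      finally show ?thesis by simp
    qed
    finally show "ex_graph V ((1 + e) / card V)
        (\<lambda>E. of_bool (\<not> has_path V (nat \<lfloor>e\<^sup>2 * card V / 80\<rfloor>) E)) \<le> exp (1 - e ^ 3 * card V / 256)"
      unfolding p_def l_def n_def .
  qed
qed

section \<open>Relabelling and conclusion\<close>

definition reconstructs :: "real \<Rightarrow> real set \<Rightarrow> real set set \<Rightarrow> bool" where
  "reconstructs r V E \<longleftrightarrow> (\<exists>V'. V' \<subseteq> V \<and> real (card V') \<ge> r \<and> reconstructible V E V')"

lemma reconstructs_mono: "reconstructs r V E \<Longrightarrow> E \<subseteq> E' \<Longrightarrow> reconstructs r V E'"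
proof -
  assume r: "reconstructs r V E" and sub: "E \<subseteq> E'"
  then obtain V' where V': "V' \<subseteq> V" "r \<le> card V'" "reconstructible V E V'"
      unfolding reconstructs_def by blast
  have "reconstructible V E' V'"
    unfolding reconstructible_def
  proof (intro conjI allI impI)
    fix g :: "real \<Rightarrow> real"
    assume g: "inj_on g V" "\<forall>x\<in>V. \<forall>y\<in>V. {x, y} \<in> E' \<longrightarrow> \<bar>g x - g y\<bar> = \<bar>x - y\<bar>"
    then have "\<forall>x\<in>V. \<forall>y\<in>V. {x, y} \<in> E \<longrightarrow> \<bar>g x - g y\<bar> = \<bar>x - y\<bar>" using sub by (meson subsetD)
    then show "\<forall>u\<in>V'. \<forall>v\<in>V'. \<bar>g u - g v\<bar> = \<bar>u - v\<bar>" using V'(3) g(1) unfolding reconstructible_def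
        by simp
  qed (rule V'(1))
  then show "reconstructs r V E'" unfolding reconstructs_def using V' by (intro exI[of _ V'] conjI)
qed

text \<open>Composing \<open>g\<close> with \<pi> turns a map that preserves the distances revealed
  by the relabelled graph into a map \<open>h\<close> on the vertices of \<open>F\<close> as in
  \<open>rigid_labels\<close>.\<close>

lemma reconstructs_of_rigid_labels:
  fixes r :: real
  assumes pi: "\<pi> permutes V" and H: "H \<subseteq> E" and F: "F \<subseteq> V" and Z: "Z \<subseteq> F" "r \<le> card Z"
    and rigid: "rigid_labels H F \<pi> Z"
  shows "reconstructs r V ((`) ((`) \<pi>) E)"
  unfolding reconstructs_def
proof (intro exI[of _ "\<pi> ` Z"] conjI)
  show sub: "\<pi> ` Z \<subseteq> V" using pi Z F permutes_in_image by fastforce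
  have "inj_on \<pi> Z" using permutes_inj[OF pi] by (rule inj_on_subset) simp
  then show "r \<le> real (card (\<pi> ` Z))" using Z by (simp add: card_image)
  show "reconstructible V ((`) ((`) \<pi>) E) (\<pi> ` Z)"
    unfolding reconstructible_def
  proof (intro conjI allI impI)
    fix g :: "real \<Rightarrow> real"
    assume g: "\<forall>x\<in>V. \<forall>y\<in>V. {x, y} \<in> (`) ((`) \<pi>) E \<longrightarrow> \<bar>g x - g y\<bar> = \<bar>x - y\<bar>"
    have "\<bar>g (\<pi> u) - g (\<pi> w)\<bar> = \<bar>\<pi> u - \<pi> w\<bar>" if "u \<in> F" "w \<in> F" "{u, w} \<in> H" for u w
    proof -
      have "\<pi> ` {u, w} \<in> (`) ((`) \<pi>) E" using that H by blast
      then have "{\<pi> u, \<pi> w} \<in> (`) ((`) \<pi>) E" by simp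
      moreover have "\<pi> u \<in> V" "\<pi> w \<in> V" using that F permutes_in_image[OF pi] by auto
      ultimately show ?thesis using g by blast
    qed
    then have "\<forall>u\<in>Z. \<forall>w\<in>Z. \<bar>g (\<pi> u) - g (\<pi> w)\<bar> = \<bar>\<pi> u - \<pi> w\<bar>"
      using rigid[unfolded rigid_labels_def, rule_format, of "\<lambda>x. g (\<pi> x)"] by blast
    then show "\<forall>u\<in>\<pi> ` Z. \<forall>v\<in>\<pi> ` Z. \<bar>g u - g v\<bar> = \<bar>u - v\<bar>" by blast
  qed (use sub in simp)
qed

lemma image_vertex_pairs:
  assumes "\<pi> permutes V"
  shows "(`) \<pi> ` vertex_pairs V = vertex_pairs V" "inj_on ((`) \<pi>) (vertex_pairs V)"
proof -
  have inj: "inj \<pi>" using assms by (rule permutes_inj)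
  have card: "card (\<pi> ` e) = card e" for e using inj by (metis card_image inj_on_subset subset_UNIV)
  have sub: "(`) \<tau> ` vertex_pairs V \<subseteq> vertex_pairs V" if "\<tau> permutes V" for \<tau>
  proof
    fix e assume "e \<in> (`) \<tau> ` vertex_pairs V"
    then obtain e' where e': "e = \<tau> ` e'" "e' \<subseteq> V" "card e' = 2" unfolding vertex_pairs_def by auto
    have "card e = card e'" unfolding e'(1) using permutes_inj[OF that]
        by (metis card_image inj_on_subset subset_UNIV)
    moreover have "e \<subseteq> V" using e' permutes_in_image[OF that] by auto
    ultimately show "e \<in> vertex_pairs V" using e' unfolding vertex_pairs_def by simp
  qed
  show "inj_on ((`) \<pi>) (vertex_pairs V)" using inj by (auto simp: inj_on_def inj_image_eq_iff)
  have "e \<in> (`) \<pi> ` vertex_pairs V" if e: "e \<in> vertex_pairs V" for e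
  proof -
    have "inv \<pi> ` e \<in> vertex_pairs V" using sub[OF permutes_inv[OF assms]] e by blast
    moreover have "e = \<pi> ` (inv \<pi> ` e)" using permutes_surj[OF assms] by (simp add: image_f_inv_f)
    ultimately show ?thesis by blast
  qed
  then show "(`) \<pi> ` vertex_pairs V = vertex_pairs V" using sub[OF assms] by blast
qed

lemma ex_rsub_permute:
  assumes "finite V" "\<pi> permutes V"
  shows "ex_graph V p (\<lambda>E. f ((`) ((`) \<pi>) E)) = ex_graph V p f"
proof -
  have "rsub (vertex_pairs V) p = map_pmf ((`) ((`) \<pi>)) (rsub (vertex_pairs V) p)"
    using map_image_rsub[OF finite_vertex_pairs[OF assms(1)] image_vertex_pairs(2)[OF assms(2)],
        of p]
      image_vertex_pairs(1)[OF assms(2)] by simp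
  then have "ex_graph V p f =
      measure_pmf.expectation (map_pmf ((`) ((`) \<pi>)) (rsub (vertex_pairs V) p)) f"
    by simp
  then show ?thesis by simp
qed

text \<open>Averaging over all relabellings makes the labels independent of the shape of the graph.\<close>

lemma ex_rsub_relabel_le:
  assumes V: "finite V" and "\<And>E. E \<subseteq> vertex_pairs V \<Longrightarrow>
      real (card {\<pi>. \<pi> permutes V \<and> B ((`) ((`) \<pi>) E)}) \<le> h E * fact (card V)"
  shows "ex_graph V p (\<lambda>E. of_bool (B E)) \<le> ex_graph V p h"
proof -
  let ?P = "{\<pi>. \<pi> permutes V}"
  have finP: "finite ?P" using V by (rule finite_permutations)
  have cP: "card ?P = fact (card V)" by (rule card_permutations[OF refl V])
  have finV: "finite (vertex_pairs V)" using V by simp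
  have "fact (card V) * ex_graph V p (\<lambda>E. of_bool (B E)) =
     (\<Sum>\<pi>\<in>?P. ex_graph V p (\<lambda>E. of_bool (B E)))" using cP by simp
  also have "\<dots> = (\<Sum>\<pi>\<in>?P. ex_graph V p (\<lambda>E. of_bool (B ((`) ((`) \<pi>) E))))"
  proof (rule sum.cong[OF refl])
    fix \<pi> assume "\<pi> \<in> ?P"
    then have "\<pi> permutes V" by simp
    from ex_rsub_permute[OF V this, of p "\<lambda>E. of_bool (B E)"]
    show "ex_graph V p (\<lambda>E. of_bool (B E)) =
      ex_graph V p (\<lambda>E. of_bool (B ((`) ((`) \<pi>) E)))" by simp
  qed
  also have "\<dots> = ex_graph V p (\<lambda>E. \<Sum>\<pi>\<in>?P. of_bool (B ((`) ((`) \<pi>) E)))"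
    using finV by simp
  also have "\<dots> \<le> ex_graph V p (\<lambda>E. h E * fact (card V))"
  proof (rule ex_rsub_mono[OF finV])
    fix E assume E: "E \<subseteq> vertex_pairs V"
    have "(\<Sum>\<pi>\<in>?P. of_bool (B ((`) ((`) \<pi>) E))) = real (card (?P \<inter> {\<pi>. B ((`) ((`) \<pi>) E)}))"
      using finP by simp
    also have "?P \<inter> {\<pi>. B ((`) ((`) \<pi>) E)} = {\<pi>. \<pi> permutes V \<and> B ((`) ((`) \<pi>) E)}" by auto
    finally show "(\<Sum>\<pi>\<in>?P. of_bool (B ((`) ((`) \<pi>) E))) \<le> h E * fact (card V)" using assms(2)[OF E]
        by simp
  qed
  also have "\<dots> = fact (card V) * ex_graph V p h" by simp
  finally show ?thesis by simp
qed

text \<open>The upper bound on \<open>card F\<close> is recorded because the label estimates need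
  \<open>F\<close> to be at most half of \<open>V\<close>.\<close>

definition has_cubic_expander :: "real \<Rightarrow> nat \<Rightarrow> 'a set \<Rightarrow> 'a set set \<Rightarrow> bool" where
  "has_cubic_expander \<beta> m V E \<longleftrightarrow> (\<exists>H\<subseteq>E. \<exists>F\<subseteq>V. 7 * m \<le> 8 * card F \<and> card F \<le> m \<and>
      cubic_expander \<beta> H F)"

text \<open>The path \<open>xs\<close> is chosen from the first graph and the second one is
  independent of it; therefore the chord estimate is assumed for every list of \<open>m\<close>
  distinct vertices.\<close>

lemma cubic_expander_failure_union:
  fixes \<eta> e q :: real
  assumes V: "finite V" and e: "0 \<le> p1" "p1 \<le> 1" and q: "0 \<le> q" "q \<le> 1"
    and eta: "0 \<le> \<eta>" and path: "ex_graph V p1 (\<lambda>E. of_bool (\<not> has_path V m E)) \<le> \<theta>"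
    and chords: "\<And>xs. set xs \<subseteq> V \<Longrightarrow> distinct xs \<Longrightarrow> length xs = m \<Longrightarrow>
     ex_graph V q (\<lambda>E. of_bool (\<not> chord_expander \<beta> xs E)) \<le> \<eta>"
  shows "ex_graph V (p1 + q - p1 * q) (\<lambda>E. of_bool (\<not> has_cubic_expander \<beta> m V E)) \<le> \<theta> + \<eta>"
proof -
  have finV: "finite (vertex_pairs V)" using V by simp
  have "ex_graph V (p1 + q - p1 * q) (\<lambda>E. of_bool (\<not> has_cubic_expander \<beta> m V E)) =
    ex_graph V p1 (\<lambda>E1. ex_graph V q (\<lambda>E2. of_bool (\<not> has_cubic_expander \<beta> m V (E1 \<union> E2))))"
    by (rule ex_rsub_union[OF finV e q, symmetric])
  also have "\<dots> \<le> ex_graph V p1 (\<lambda>E1. of_bool (\<not> has_path V m E1) + \<eta>)"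
  proof (rule ex_rsub_mono[OF finV])
    fix E1 assume "E1 \<subseteq> vertex_pairs V"
    show "ex_graph V q (\<lambda>E2. of_bool (\<not> has_cubic_expander \<beta> m V (E1 \<union> E2))) \<le>
        of_bool (\<not> has_path V m E1) + \<eta>"
    proof (cases "has_path V m E1")
      case False
      have "ex_graph V q (\<lambda>E2. of_bool (\<not> has_cubic_expander \<beta> m V (E1 \<union> E2))) \<le>
        ex_graph V q (\<lambda>E2. 1)" by (rule ex_rsub_mono[OF finV]) simp
      then show ?thesis using False eta by simp
    next
      case True
      then obtain xs where xs0: "distinct xs \<and> length xs = m \<and> set xs \<subseteq> V \<and>
          (\<forall>i. Suc i < m \<longrightarrow> {xs ! i, xs ! Suc i} \<in> E1)" unfolding has_path_def by (rule exE)
      then have xs: "distinct xs" "length xs = m" "set xs \<subseteq> V" by simp_all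
      have pE: "path_edges xs \<subseteq> E1"
      proof
        fix a assume "a \<in> path_edges xs"
        then obtain i where "a = {xs ! i, xs ! Suc i}" "Suc i < m" unfolding path_edges_def xs(2)
            by (rule CollectE) auto
        then show "a \<in> E1" using xs0 by simp
      qed
      have "ex_graph V q (\<lambda>E2. of_bool (\<not> has_cubic_expander \<beta> m V (E1 \<union> E2))) \<le>
        ex_graph V q (\<lambda>E. of_bool (\<not> chord_expander \<beta> xs E))"
      proof (rule ex_rsub_mono[OF finV])
        fix E2
        have imp: "has_cubic_expander \<beta> m V (E1 \<union> E2)" if ce: "chord_expander \<beta> xs E2"
        proof -
          obtain F where F: "F \<subseteq> set xs" "7 * length xs \<le> 8 * card F"
            "cubic_expander \<beta> (path_edges xs \<union> (E2 \<inter> vertex_pairs (set xs))) F" using ce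
                unfolding chord_expander_def by blast
          have "card F \<le> m" using card_mono[OF _ F(1)] xs(1,2) by (simp add: distinct_card)
          moreover have "path_edges xs \<union> (E2 \<inter> vertex_pairs (set xs)) \<subseteq> E1 \<union> E2" using pE by blast
          moreover have "F \<subseteq> V" "7 * m \<le> 8 * card F" using F xs(2,3) by auto
          ultimately show ?thesis unfolding has_cubic_expander_def using F(3)
            by (intro exI[of _ "path_edges xs \<union> (E2 \<inter> vertex_pairs (set xs))"] exI[of _ F] conjI)
        qed
        show "of_bool (\<not> has_cubic_expander \<beta> m V (E1 \<union> E2)) \<le>
            (of_bool (\<not> chord_expander \<beta> xs E2) :: real)"
          by (cases "has_cubic_expander \<beta> m V (E1 \<union> E2)") (use imp in \<open>auto simp: of_bool_def\<close>)
      qed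
      also have "\<dots> \<le> \<eta>" by (rule chords[OF xs(3,1,2)])
      finally show ?thesis using True by simp
    qed
  qed
  also have "\<dots> = ex_graph V p1 (\<lambda>E. of_bool (\<not> has_path V m E)) + \<eta>" using finV by simp
  finally show ?thesis using path by simp
qed

lemma reconstruction_failure_small:
  fixes e \<eta> :: real
  assumes e: "0 < e" "e \<le> 1 / 2" and eta: "0 < \<eta>"
  shows "\<exists>N. \<forall>V p. finite V \<longrightarrow> N \<le> card V \<longrightarrow> (1 + 2 * e) / card V \<le> p \<longrightarrow> p \<le> 1 \<longrightarrow>
     ex_graph V p (\<lambda>E. of_bool (\<not> reconstructs (e\<^sup>2 * card V / 400) V E)) \<le> \<eta>"
proof -
  \<comment> \<open>As \<open>m \<ge> e\<^sup>2 * n / 81\<close>, this makes the chord density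
    \<open>\<delta>\<^sup>2 / m\<close> at most \<open>e / n\<close>, so both rounds fit into
    \<open>(1 + 2 * e) / n\<close>. The 81 in place of 80 covers the rounding in
    \<open>m\<close>.\<close>
  define \<delta>0 where "\<delta>0 = e ^ 3 / 81"
  have e2: "0 < e\<^sup>2" "e\<^sup>2 \<le> 1 / 4" using e power_mono[of e "1/2" 2] by (auto simp: power2_eq_square)
  have d0: "0 < \<delta>0" using e by (simp add: \<delta>0_def)
  have eta3: "0 < \<eta> / 3" using eta by simp
  obtain \<delta> M where d: "0 < \<delta>" "\<delta> \<le> \<delta>0" "\<delta> \<le> 1 / 2" and M: "\<And>V xs. finite V \<Longrightarrow> set xs \<subseteq> V \<Longrightarrow>
      distinct xs \<Longrightarrow> M \<le> length xs \<Longrightarrow>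
     ex_graph V (\<delta>\<^sup>2 / length xs) (\<lambda>E. of_bool (\<not> chord_expander (\<delta> ^ 3 / 6) (xs :: real list) E)) \<le>
         \<eta> / 3"
    using cubic_expander_failure_small[OF eta3 d0] by blast
  have beta: "0 < \<delta> ^ 3 / 6" "\<delta> ^ 3 / 6 \<le> 1"
  proof -
    have "\<delta> ^ 3 \<le> 1" using d by (intro power_le_one) auto
    then show "0 < \<delta> ^ 3 / 6" "\<delta> ^ 3 / 6 \<le> 1" using d by auto
  qed
  have c: "0 < e\<^sup>2 / 200" using e2 by simp
  obtain C N1 where CN: "\<And>V H F. finite V \<Longrightarrow> F \<subseteq> V \<Longrightarrow> 2 * card F \<le> card V \<Longrightarrow> e\<^sup>2 / 200 * card V \<le>
      card F \<Longrightarrow>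
     N1 \<le> card V \<Longrightarrow> cubic_expander (\<delta> ^ 3 / 6) H F \<Longrightarrow>
     real (card {\<pi>. \<pi> permutes V \<and> \<not> mostly_rigid H F \<pi>})
       \<le> C / card V * fact (card V)"
    using random_labels_rigid[OF beta c] by blast
  obtain N2 where N2: "\<And>V :: real set. finite V \<Longrightarrow> N2 \<le> card V \<Longrightarrow>
     ex_graph V ((1 + e) / card V) (\<lambda>E. of_bool (\<not> has_path V (nat \<lfloor>e\<^sup>2 * card V / 80\<rfloor>) E))
       \<le> exp (1 - e ^ 3 * card V / 256)"
    using path_failure_small[OF e] by blast
  have "((\<lambda>n::nat. exp (1 - e ^ 3 * n / 256)) \<longlonglongrightarrow> 0)" using e by real_asymp
  then have "\<forall>\<^sub>F n in sequentially. exp (1 - e ^ 3 * real n / 256) < \<eta> / 3"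
      by (rule order_tendstoD) (use eta3 in auto)
  moreover have "((\<lambda>n::nat. \<bar>C\<bar> / real n) \<longlonglongrightarrow> 0)" by real_asymp
  then have "\<forall>\<^sub>F n in sequentially. \<bar>C\<bar> / real n < \<eta> / 3"
      by (rule order_tendstoD) (use eta3 in auto)
  ultimately have "\<forall>\<^sub>F n in sequentially. exp (1 - e ^ 3 * real n / 256) < \<eta> / 3 \<and> \<bar>C\<bar> / real n <
      \<eta> / 3"
    by (rule eventually_conj)
  then obtain N3 where N3: "\<And>n. N3 \<le> n \<Longrightarrow> exp (1 - e ^ 3 * real n / 256) < \<eta> / 3 \<and> \<bar>C\<bar> / real n <
      \<eta> / 3"
    by (auto simp: eventually_at_top_linorder)
  define N where "N = max (max N1 N2) (max N3 (nat \<lceil>80 * (real M + 100) / e\<^sup>2\<rceil>))"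
  show ?thesis
  proof (intro exI[of _ N] allI impI)
    fix V :: "real set" and p :: real
    assume V: "finite V" and NV: "N \<le> card V" and p: "(1 + 2 * e) / card V \<le> p" "p \<le> 1"
    define n m where "n = card V" and "m = nat \<lfloor>e\<^sup>2 * n / 80\<rfloor>"
    have Ns: "N1 \<le> n" "N2 \<le> n" "N3 \<le> n" using NV unfolding N_def n_def by auto
    define a where "a = e\<^sup>2 * real n"
    have "80 * (real M + 100) / e\<^sup>2 \<le> real n" using NV unfolding N_def n_def by linarith
    then have "80 * (real M + 100) \<le> a" unfolding a_def using e2 by (simp add: field_simps)
    then have big: "8000 \<le> a" "real M + 100 \<le> a / 80" by auto
    have "0 \<le> a" unfolding a_def by simp
    then have m: "real m \<le> a / 80" "a / 80 - 1 \<le> real m" unfolding m_def a_def[symmetric]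
        by linarith+
    have e2n: "a \<le> real n / 4" unfolding a_def using mult_right_mono[OF e2(2), of "real n"] by simp
    have "real (M + 99) \<le> real m" using m(2) big(2) by simp
    then have "M + 99 \<le> m" by (simp only: of_nat_le_iff)
    then have mM: "M \<le> m" "99 \<le> m" by simp_all
    have nbig: "100 \<le> real n" using big e2n by simp
    then have n0: "0 < real n" by simp
    have m0: "0 < real m" using mM by simp
    have "real (2 * m) \<le> real n" using m(1) e2n nbig big(1) by simp
    then have m2: "2 * m \<le> n" by (simp only: of_nat_le_iff)
    have "a / 81 \<le> real m" using m(2) big(1) by simp
    then have m_lower: "e\<^sup>2 * n / 81 \<le> real m" unfolding a_def .
    define p1 q where "p1 = (1 + e) / n" and "q = \<delta>\<^sup>2 / m"
    have p1: "0 \<le> p1" "p1 \<le> 1" unfolding p1_def using e nbig by (auto simp: divide_le_eq)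
    have d2: "\<delta>\<^sup>2 \<le> 1" using d by (intro power_le_one) auto
    have q: "0 \<le> q" "q \<le> 1" unfolding q_def using d2 m0 mM by (auto simp: divide_le_eq)
    have qe: "q \<le> e / n"
    proof -
      have "\<delta>\<^sup>2 \<le> \<delta> * 1" unfolding power2_eq_square using d by (intro mult_left_mono) auto
      also have "\<dots> \<le> e ^ 3 / 81" using d(2) unfolding \<delta>0_def by simp
      finally have "\<delta>\<^sup>2 * n \<le> e ^ 3 / 81 * n" by (intro mult_right_mono) auto
      also have "\<dots> = e * (e\<^sup>2 * n / 81)" by (simp add: power2_eq_square power3_eq_cube)
      also have "\<dots> \<le> e * m" using m_lower e by (intro mult_left_mono) auto
      finally show ?thesis unfolding q_def using m0 n0 by (simp add: field_simps)
    qed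
    \<comment> \<open>The rigid part is at least half of \<open>F\<close>, and
      \<open>card F \<ge> 7 * m / 8 \<ge> e\<^sup>2 * n / 200\<close>.\<close>
    let ?r = "e\<^sup>2 * n / 400" and ?\<beta> = "\<delta> ^ 3 / 6"
    have finV: "finite (vertex_pairs V)" using V by simp
    have pq: "0 \<le> p1 + q - p1 * q" "p1 + q - p1 * q \<le> p"
    proof -
      have "p1 * q \<le> p1 * 1" using p1 q by (intro mult_left_mono) auto
      then show "0 \<le> p1 + q - p1 * q" using q by simp
      have "p1 + e / n = (1 + 2 * e) / n" unfolding p1_def
          by (simp add: add_divide_distrib[symmetric])
      then have "p1 + q \<le> p" using qe p(1) unfolding n_def by linarith
      moreover have "0 \<le> p1 * q" using p1 q by simp
      ultimately show "p1 + q - p1 * q \<le> p" by linarith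
    qed
    have neg: "ex_graph V x (\<lambda>E. of_bool (\<not> reconstructs ?r V E)) =
        1 - ex_graph V x (\<lambda>E. of_bool (reconstructs ?r V E))" for x
      using finV by (simp add: of_bool_not_iff)
    have "ex_graph V (p1 + q - p1 * q) (\<lambda>E. of_bool (reconstructs ?r V E))
       \<le> ex_graph V p (\<lambda>E. of_bool (reconstructs ?r V E))"
    proof (rule ex_rsub_prob_mono[OF finV pq p(2)])
      show "(of_bool (reconstructs ?r V E) :: real) \<le> of_bool (reconstructs ?r V E')" if "E \<subseteq> E'"
          for E E'
        using reconstructs_mono[OF _ that, of ?r V] by (simp add: of_bool_def)
    qed
    then have "ex_graph V p (\<lambda>E. of_bool (\<not> reconstructs ?r V E))
       \<le> ex_graph V (p1 + q - p1 * q) (\<lambda>E. of_bool (\<not> reconstructs ?r V E))"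
      unfolding neg by simp
    also have "\<dots> \<le> ex_graph V (p1 + q - p1 * q) (\<lambda>E. of_bool (\<not> has_cubic_expander ?\<beta> m V E) +
        \<bar>C\<bar> / n)"
    \<comment> \<open>A shape without an expander counts as a failure for all relabellings; with an
      expander only a fraction \<open>C / n\<close> of them fails.\<close>
    proof (rule ex_rsub_relabel_le[OF V])
      fix E assume "E \<subseteq> vertex_pairs V"
      let ?X = "{\<pi>. \<pi> permutes V \<and> \<not> reconstructs ?r V ((`) ((`) \<pi>) E)}"
      have finP: "finite {\<pi>. \<pi> permutes V}" using V by (rule finite_permutations)
      show "real (card ?X) \<le> (of_bool (\<not> has_cubic_expander ?\<beta> m V E) + \<bar>C\<bar> / n) * fact (card V)"
      proof (cases "has_cubic_expander ?\<beta> m V E")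
        case False
        have "card ?X \<le> card {\<pi>. \<pi> permutes V}" by (rule card_mono[OF finP]) auto
        also have "\<dots> = fact (card V)" by (rule card_permutations[OF refl V])
        finally have "real (card ?X) \<le> real (fact (card V))" by (rule of_nat_mono)
        also have "\<dots> = 1 * fact (card V)" by simp
        also have "\<dots> \<le> (of_bool (\<not> has_cubic_expander ?\<beta> m V E) + \<bar>C\<bar> / n) * fact (card V)"
          using False by (intro mult_right_mono) auto
        finally show ?thesis .
      next
        case True
        then obtain H F where HF: "H \<subseteq> E" "F \<subseteq> V" "7 * m \<le> 8 * card F" "card F \<le> m"
            "cubic_expander ?\<beta> H F"
          unfolding has_cubic_expander_def by blast
        have F2: "2 * card F \<le> card V" using HF(4) m2 unfolding n_def by linarith
        have "real (7 * m) \<le> real (8 * card F)" using HF(3) by (rule of_nat_mono)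
        moreover have "0 \<le> e\<^sup>2 * n" by simp
        ultimately have Fl: "e\<^sup>2 * n / 200 \<le> card F" using m_lower by simp
        have "card ?X \<le> card {\<pi>. \<pi> permutes V \<and> \<not> mostly_rigid H F \<pi>}"
        proof (rule card_mono)
          show "finite {\<pi>. \<pi> permutes V \<and> \<not> mostly_rigid H F \<pi>}"
            by (rule finite_subset[OF _ finP]) auto
          show "?X \<subseteq> {\<pi>. \<pi> permutes V \<and> \<not> mostly_rigid H F \<pi>}"
          proof
            fix \<pi> assume "\<pi> \<in> ?X"
            then have pi: "\<pi> permutes V \<and> \<not> reconstructs ?r V ((`) ((`) \<pi>) E)" by (rule CollectD)
            have "\<not> mostly_rigid H F \<pi>"
            proof
              assume "mostly_rigid H F \<pi>"
              then obtain Z where Z: "Z \<subseteq> F" "card F \<le> 2 * card Z" "rigid_labels H F \<pi> Z"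
                unfolding mostly_rigid_def by blast
              have "real (card F) \<le> real (2 * card Z)" using Z(2) by (rule of_nat_mono)
              then have "?r \<le> card Z" using Fl by simp
              from reconstructs_of_rigid_labels[OF conjunct1[OF pi] HF(1,2) Z(1) this Z(3)]
              show False by (rule notE[OF conjunct2[OF pi]])
            qed
            with conjunct1[OF pi] show "\<pi> \<in> {\<pi>. \<pi> permutes V \<and>
                \<not> mostly_rigid H F \<pi>}"
              by (intro CollectI conjI)
          qed
        qed
        then have "real (card ?X) \<le> real (card {\<pi>. \<pi> permutes V \<and>
            \<not> mostly_rigid H F \<pi>})" by (rule of_nat_mono)
        also have "\<dots> \<le> C / n * fact (card V)" unfolding n_def
          by (rule CN[OF V HF(2) F2 _ _ HF(5)]) (use Fl Ns in \<open>simp_all add: n_def\<close>)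
        also have "\<dots> \<le> (of_bool (\<not> has_cubic_expander ?\<beta> m V E) + \<bar>C\<bar> / n) * fact (card V)"
          using n0 by (intro mult_right_mono) (simp_all add: True divide_right_mono)
        finally show ?thesis .
      qed
    qed
    also have "\<dots> = ex_graph V (p1 + q - p1 * q) (\<lambda>E. of_bool (\<not> has_cubic_expander ?\<beta> m V E)) +
        \<bar>C\<bar> / n"
      using finV by simp
    also have "ex_graph V (p1 + q - p1 * q) (\<lambda>E. of_bool (\<not> has_cubic_expander ?\<beta> m V E))
       \<le> exp (1 - e ^ 3 * n / 256) + \<eta> / 3"
    proof (rule cubic_expander_failure_union[OF V p1 q])
      show "0 \<le> \<eta> / 3" using eta by simp
      show "ex_graph V p1 (\<lambda>E. of_bool (\<not> has_path V m E)) \<le> exp (1 - e ^ 3 * n / 256)"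
        using N2[OF V] Ns(2) unfolding p1_def m_def n_def by simp
      show "ex_graph V q (\<lambda>E. of_bool (\<not> chord_expander ?\<beta> xs E)) \<le> \<eta> / 3"
        if xs: "set xs \<subseteq> V" "distinct xs" "length xs = m" for xs
        using M[OF V xs(1,2)] mM(1) unfolding q_def xs(3) by simp
    qed
    finally have "ex_graph V p (\<lambda>E. of_bool (\<not> reconstructs ?r V E)) \<le>
       exp (1 - e ^ 3 * n / 256) + \<eta> / 3 + \<bar>C\<bar> / n" by simp
    moreover have "exp (1 - e ^ 3 * n / 256) < \<eta> / 3" "\<bar>C\<bar> / n < \<eta> / 3" using N3[OF Ns(3)] by auto
    ultimately have "ex_graph V p (\<lambda>E. of_bool (\<not> reconstructs ?r V E)) \<le> \<eta>" by linarith
    then show "ex_graph V p (\<lambda>E. of_bool (\<not> reconstructs (e\<^sup>2 * card V / 400) V E)) \<le> \<eta>"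
      unfolding n_def .
  qed
qed

theorem theorem1p1:
  shows "\<exists>c::real. c > 0 \<and>
    (\<forall>\<epsilon>::real. \<epsilon> > 0 \<longrightarrow>
      (\<forall>V :: nat \<Rightarrow> real set. (\<forall>n. finite (V n) \<and> card (V n) = n) \<longrightarrow>
        (\<lambda>n. measure_pmf.prob (random_graph (V n) ((1 + \<epsilon>) / real n))
              {E. \<exists>V'. V' \<subseteq> V n \<and> real (card V') \<ge> c * min 1 (\<epsilon> ^ 3) * real n \<and>
                       reconstructible (V n) E V'})
          \<longlonglongrightarrow> 1))"
proof (intro exI[of _ "1 / 1600 :: real"] conjI allI impI)
  fix \<epsilon> :: real and V :: "nat \<Rightarrow> real set"
  assume eps: "\<epsilon> > 0" and V: "\<forall>n. finite (V n) \<and> card (V n) = n"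
  define e where "e = min 1 \<epsilon> / 2"
  have e: "0 < e" "e \<le> 1 / 2" "2 * e \<le> \<epsilon>" using eps by (auto simp: e_def)
  have r: "1 / 1600 * min 1 (\<epsilon> ^ 3) * real n \<le> e\<^sup>2 * real n / 400" for n
  proof -
    \<comment> \<open>For \<open>\<epsilon> \<le> 1\<close> the square dominates the cube; with
      \<open>e = min 1 \<epsilon> / 2\<close> the constant is \<open>1 / (4 * 400)\<close>.\<close>
    have "min 1 (\<epsilon> ^ 3) \<le> (min 1 \<epsilon>)\<^sup>2"
    proof (cases "\<epsilon> \<le> 1")
      case True
      then have "\<epsilon> ^ 3 \<le> \<epsilon> ^ 2" using eps by (intro power_decreasing) auto
      then show ?thesis using True by simp
    qed simp
    then have "min 1 (\<epsilon> ^ 3) * real n \<le> (min 1 \<epsilon>)\<^sup>2 * real n" by (rule mult_right_mono) simp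
    then show ?thesis by (simp add: e_def power_divide)
  qed
  let ?P = "\<lambda>n. measure_pmf.prob (random_graph (V n) ((1 + \<epsilon>) / real n))
     {E. \<exists>V'. V' \<subseteq> V n \<and> real (card V') \<ge> 1 / 1600 * min 1 (\<epsilon> ^ 3) * real n \<and>
         reconstructible (V n) E V'}"
  show "?P \<longlonglongrightarrow> 1"
  proof (rule LIMSEQ_I)
    fix \<eta> :: real assume eta: "0 < \<eta>"
    then have "0 < \<eta> / 2" by simp
    from reconstruction_failure_small[OF e(1,2) this] obtain N where
      N: "\<And>V p. finite V \<Longrightarrow> N \<le> card V \<Longrightarrow> (1 + 2 * e) / card V \<le> p \<Longrightarrow> p \<le> 1 \<Longrightarrow>
       ex_graph V p (\<lambda>E. of_bool (\<not> reconstructs (e\<^sup>2 * card V / 400) V E)) \<le> \<eta> / 2" by blast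
    show "\<exists>no. \<forall>n\<ge>no. norm (?P n - 1) < \<eta>"
    \<comment> \<open>From \<open>1 + \<epsilon>\<close> on the edge probability is at most 1 and is
      not clamped.\<close>
    proof (intro exI[of _ "max N (nat \<lceil>1 + \<epsilon>\<rceil>)"] allI impI)
      fix n assume n: "max N (nat \<lceil>1 + \<epsilon>\<rceil>) \<le> n"
      then have n1: "1 + \<epsilon> \<le> real n" by linarith
      then have n0: "0 < real n" using eps by linarith
      have Vn: "finite (V n)" "card (V n) = n" using V by auto
      let ?p = "(1 + \<epsilon>) / real n"
      have "(1 + 2 * e) / real n \<le> ?p" using e n0 by (intro divide_right_mono) auto
      moreover have "?p \<le> 1" using n1 n0 by (simp add: divide_le_eq)
      ultimately have "ex_rsub (vertex_pairs (V n)) ?p (\<lambda>E.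
          of_bool (\<not> reconstructs (e\<^sup>2 * real n / 400) (V n) E)) \<le> \<eta> / 2"
        using N[of "V n" ?p] Vn n by simp
      moreover have "1 - ?P n \<le> ex_rsub (vertex_pairs (V n)) ?p (\<lambda>E.
          of_bool (\<not> reconstructs (e\<^sup>2 * real n / 400) (V n) E))"
      proof -
        have fin: "finite (vertex_pairs (V n))" using Vn by simp
        have "ex_rsub (vertex_pairs (V n)) ?p (\<lambda>E.
            1 - of_bool (\<not> reconstructs (e\<^sup>2 * real n / 400) (V n) E)) \<le> ?P n"
          unfolding random_graph_eq_rsub prob_eq_ex_rsub
        proof (rule ex_rsub_mono[OF fin])
          fix E
          let ?G = "{E. \<exists>V'. V' \<subseteq> V n \<and> real (card V') \<ge> 1 / 1600 * min 1 (\<epsilon> ^ 3) * real n \<and>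
              reconstructible (V n) E V'}"
          have imp: "E \<in> ?G" if "reconstructs (e\<^sup>2 * real n / 400) (V n) E"
          proof -
            have "\<exists>V'. V' \<subseteq> V n \<and> real (card V') \<ge> 1 / 1600 * min 1 (\<epsilon> ^ 3) * real n \<and>
                reconstructible (V n) E V'"
              using that r[of n] unfolding reconstructs_def by (meson order_trans)
            then show ?thesis by (rule CollectI)
          qed
          show "1 - of_bool (\<not> reconstructs (e\<^sup>2 * real n / 400) (V n) E) \<le>
              (of_bool (E \<in> ?G) :: real)"
          proof (cases "reconstructs (e\<^sup>2 * real n / 400) (V n) E")
            case True
            then have "E \<in> ?G" by (rule imp)
            then have "of_bool (E \<in> ?G) = (1::real)" by (simp only: of_bool_eq)
            then show ?thesis by simp
          qed simp
        qed
        then show ?thesis using fin by simp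
      qed
      moreover have "?P n \<le> 1" by simp
      ultimately show "norm (?P n - 1) < \<eta>" using eta unfolding real_norm_def by linarith
    qed
  qed
qed simp

end
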